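(* The dual space $Su(T^* )^*$ contains a continuum of subsymmetric basic sequences with (pairwise) non-equivalent fundamental functions. Hence, by duality, $Su(T^* )$ has a continuum of quotient spaces with subsymmetric bases whose fundamental functions are (pairwise) non-equivalent.
   Context: A basic sequence is subsymmetric if it is unconditional and equivalent to each of its subsequences (equivalence of basic sequences $(x_j)$, $(y_j)$: $\sum a_jx_j$ converges if and only if $\sum a_jy_j$ converges). The fundamental function of a subsymmetric sequence $(u_i)$ is $\Phi(n)=\|\sum_{i=1}^nu_i\|$; two fundamental functions $\Phi,\Psi$ are equivalent if there is $K>0$ with $K^{-1}\Phi(n)\le\Psi(n)\le K\Phi(n)$ for all $n\in\mathbb N$. "A continuum" means a family of cardinality $2^{\aleph_0}$. The Tsirelson space $T$ (Figiel–Johnson construction) is the completion of $c_{00}$, with unit vectors $(t_n)$, under the unique norm satisfying, for $x=\sum_n a_nt_n$, $$\|x\| = \max\Big\{ \max_n |a_n|,\ \tfrac12 \sup \sum_{j=1}^k \|E_jx\|\Big\},$$ where the supremum is over all $k\in\mathbb N$ and finite sets $E_1<E_2<\dots<E_k$ of natural numbers with $k\le \min E_1$; here $E<F$ means $\max E<\min F$, and $Ex=\sum_{n\in E}a_nt_n$. $T^*$ denotes the dual of $T$ and $(t_n^* )$ the biorthogonal functionals of $(t_n)$, which form a basis of $T^*$. The subsymmetrization $Su(T^* )$ is the completion of the space of finitely supported sequences under the norm $$\Big\|\sum_n a_nt_n^*\Big\|=\sup\Big\{\Big\|\sum_i a_{n_i}t^*_i\Big\|_{T^*} : n_1<n_2<\cdots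 \Big\},$$ and its unit vector basis is again denoted $(t_n^* )$. $Su(T^* )^*$ is its dual Banach space. *)

theory Defs
  imports "HOL-Analysis.Analysis" "HOL-Library.Equipollence"
begin

definition cauchy_equiv :: "(nat \<Rightarrow> 'a::real_normed_vector) \<Rightarrow> (nat \<Rightarrow> 'a) \<Rightarrow> bool" where
  "cauchy_equiv x y \<longleftrightarrow> Cauchy x \<and> Cauchy y \<and> (\<lambda>n. x n - y n) \<longlonglongrightarrow> 0"

lemma part_equivp_cauchy_equiv:
  "part_equivp (cauchy_equiv :: (nat \<Rightarrow> 'a::real_normed_vector) \<Rightarrow> _)" (is "part_equivp ?R")
proof (rule part_equivpI)
  show "\<exists>x. ?R x x"
    by (rule exI[of _ "\<lambda>_. 0"]) (simp add: cauchy_equiv_def convergent_Cauchy convergent_const)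
  show "symp ?R"
    using tendsto_minus by (fastforce simp: cauchy_equiv_def symp_def)
  show "transp ?R"
  proof (rule transpI)
    fix x y z :: "nat \<Rightarrow> 'a"
    assume "cauchy_equiv x y" "cauchy_equiv y z"
    then show "cauchy_equiv x z"
      using tendsto_add[of "\<lambda>n. x n - y n" 0 sequentially "\<lambda>n. y n - z n" 0]
      by (simp add: cauchy_equiv_def)
  qed
qed

quotient_type (overloaded) 'a completion = "nat \<Rightarrow> 'a::real_normed_vector" / partial: cauchy_equiv
  by (rule part_equivp_cauchy_equiv)

lemma Cauchy_scaleR_seq:
  fixes x :: "nat \<Rightarrow> 'a::real_normed_vector"
  shows "Cauchy x \<Longrightarrow> Cauchy (\<lambda>n. r *\<^sub>R x n)"
  by (rule bounded_linear.Cauchy[OF bounded_linear_scaleR_right])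

lemma Cauchy_add_seq:
  fixes x y :: "nat \<Rightarrow> 'a::real_normed_vector"
  assumes x: "Cauchy x" and y: "Cauchy y"
  shows "Cauchy (\<lambda>n. x n + y n)"
  unfolding Cauchy_iff
proof (intro allI impI)
  fix e :: real assume "e > 0"
  then have e: "e / 2 > 0" by simp
  obtain M where M: "\<forall>m\<ge>M. \<forall>n\<ge>M. norm (x m - x n) < e / 2"
    using x e unfolding Cauchy_iff by blast
  obtain N where N: "\<forall>m\<ge>N. \<forall>n\<ge>N. norm (y m - y n) < e / 2"
    using y e unfolding Cauchy_iff by blast
  have "norm (x m + y m - (x n + y n)) < e" if "m \<ge> max M N" "n \<ge> max M N" for m n
    using M N that norm_diff_triangle_ineq[of "x m" "y m" "x n" "y n"]
    by (smt (verit) field_sum_of_halves max.bounded_iff)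
  then show "\<exists>M. \<forall>m\<ge>M. \<forall>n\<ge>M. norm (x m + y m - (x n + y n)) < e" by blast
qed

lemma Cauchy_minus_seq:
  fixes x :: "nat \<Rightarrow> 'a::real_normed_vector"
  shows "Cauchy x \<Longrightarrow> Cauchy (\<lambda>n. - x n)"
  using Cauchy_scaleR_seq[of x "-1"] by simp

lemma Cauchy_convergent_norm:
  fixes x :: "nat \<Rightarrow> 'a::real_normed_vector"
  assumes "Cauchy x"
  shows "convergent (\<lambda>n. norm (x n))"
proof -
  have "Cauchy (\<lambda>n. norm (x n))"
    unfolding Cauchy_def
  proof (intro allI impI)
    fix e :: real assume "e > 0"
    then obtain M where M: "\<forall>m\<ge>M. \<forall>n\<ge>M. dist (x m) (x n) < e"
      using assms unfolding Cauchy_def by blast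
    have "dist (norm (x m)) (norm (x n)) < e" if "m \<ge> M" "n \<ge> M" for m n
      using norm_triangle_ineq3[of "x m" "x n"] M that by (force simp: dist_norm)
    then show "\<exists>M. \<forall>m\<ge>M. \<forall>n\<ge>M. dist (norm (x m)) (norm (x n)) < e" by blast
  qed
  then show ?thesis by (simp add: Cauchy_convergent_iff)
qed

lemma lim_norm_cauchy_equiv:
  fixes x y :: "nat \<Rightarrow> 'a::real_normed_vector"
  assumes "cauchy_equiv x y"
  shows "lim (\<lambda>n. norm (x n)) = lim (\<lambda>n. norm (y n))"
proof -
  have y: "(\<lambda>n. norm (y n)) \<longlonglongrightarrow> lim (\<lambda>n. norm (y n))"
    using assms Cauchy_convergent_norm convergent_LIMSEQ_iff unfolding cauchy_equiv_def by blast
  have "(\<lambda>n. norm (x n - y n)) \<longlonglongrightarrow> 0"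
    using assms tendsto_norm_zero unfolding cauchy_equiv_def by blast
  then have "(\<lambda>n. norm (x n) - norm (y n)) \<longlonglongrightarrow> 0"
    by (rule Lim_null_comparison[rotated]) (auto intro!: always_eventually norm_triangle_ineq3)
  from tendsto_add[OF this y] have "(\<lambda>n. norm (x n)) \<longlonglongrightarrow> lim (\<lambda>n. norm (y n))" by simp
  then show ?thesis by (rule limI)
qed

instantiation completion :: (real_normed_vector) real_normed_vector
begin

lift_definition zero_completion :: "'a completion" is "\<lambda>_. 0"
  by (simp add: cauchy_equiv_def convergent_Cauchy convergent_const)

lift_definition plus_completion :: "'a completion \<Rightarrow> 'a completion \<Rightarrow> 'a completion"
  is "\<lambda>x y n. x n + y n"
proof -
  fix x x' y y' :: "nat \<Rightarrow> 'a"
  assume "cauchy_equiv x x'" "cauchy_equiv y y'"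
  then show "cauchy_equiv (\<lambda>n. x n + y n) (\<lambda>n. x' n + y' n)"
    using tendsto_add[of "\<lambda>n. x n - x' n" 0 sequentially "\<lambda>n. y n - y' n" 0]
    by (auto simp: cauchy_equiv_def algebra_simps intro!: Cauchy_add_seq)
qed

lift_definition uminus_completion :: "'a completion \<Rightarrow> 'a completion" is "\<lambda>x n. - x n"
proof -
  fix x x' :: "nat \<Rightarrow> 'a"
  assume "cauchy_equiv x x'"
  then show "cauchy_equiv (\<lambda>n. - x n) (\<lambda>n. - x' n)"
    using tendsto_minus[of "\<lambda>n. x n - x' n" 0 sequentially]
    by (auto simp: cauchy_equiv_def algebra_simps intro!: Cauchy_minus_seq)
qed

definition minus_completion :: "'a completion \<Rightarrow> 'a completion \<Rightarrow> 'a completion" where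
  "minus_completion x y = x + - y"

lift_definition scaleR_completion :: "real \<Rightarrow> 'a completion \<Rightarrow> 'a completion"
  is "\<lambda>r x n. r *\<^sub>R x n"
proof -
  fix r and x x' :: "nat \<Rightarrow> 'a"
  assume "cauchy_equiv x x'"
  then show "cauchy_equiv (\<lambda>n. r *\<^sub>R x n) (\<lambda>n. r *\<^sub>R x' n)"
    using tendsto_scaleR[OF tendsto_const, of "\<lambda>n. x n - x' n" 0 sequentially r]
    by (auto simp: cauchy_equiv_def algebra_simps intro!: Cauchy_scaleR_seq)
qed

lift_definition norm_completion :: "'a completion \<Rightarrow> real" is "\<lambda>x. lim (\<lambda>n. norm (x n))"
  by (rule lim_norm_cauchy_equiv)

definition sgn_completion :: "'a completion \<Rightarrow> 'a completion" where
  "sgn_completion x = scaleR (inverse (norm x)) x"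
definition dist_completion :: "'a completion \<Rightarrow> 'a completion \<Rightarrow> real" where
  "dist_completion x y = norm (x - y)"
definition uniformity_completion :: "('a completion \<times> 'a completion) filter" where
  "uniformity_completion = (INF e\<in>{0<..}. principal {(x, y). dist x y < e})"
definition open_completion :: "'a completion set \<Rightarrow> bool" where
  "open_completion U = (\<forall>x\<in>U. \<forall>\<^sub>F (x', y) in uniformity. x' = x \<longrightarrow> y \<in> U)"

instance
proof
  fix x y z :: "'a completion" and r s :: real
  show "x + y + z = x + (y + z)"
    by transfer (simp add: cauchy_equiv_def add.assoc Cauchy_add_seq)
  show "x + y = y + x"
    by transfer (simp add: cauchy_equiv_def add.commute Cauchy_add_seq)
  show "0 + x = x"
    by transfer (simp add: cauchy_equiv_def)
  show "- x + x = 0"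
    by transfer (simp add: cauchy_equiv_def convergent_Cauchy convergent_const)
  show "x - y = x + - y" by (rule minus_completion_def)
  show "r *\<^sub>R (x + y) = r *\<^sub>R x + r *\<^sub>R y"
    by transfer (simp add: cauchy_equiv_def scaleR_add_right Cauchy_add_seq Cauchy_scaleR_seq)
  show "(r + s) *\<^sub>R x = r *\<^sub>R x + s *\<^sub>R x"
    by transfer (simp add: cauchy_equiv_def scaleR_add_left Cauchy_add_seq Cauchy_scaleR_seq)
  show "r *\<^sub>R s *\<^sub>R x = (r * s) *\<^sub>R x"
    by transfer (simp add: cauchy_equiv_def Cauchy_scaleR_seq)
  show "1 *\<^sub>R x = x"
    by transfer (simp add: cauchy_equiv_def)
  show "sgn x = inverse (norm x) *\<^sub>R x" by (rule sgn_completion_def)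
  show "dist x y = norm (x - y)" by (rule dist_completion_def)
  show "uniformity = (INF e\<in>{0<..}. principal {(x :: 'a completion, y). dist x y < e})"
    by (rule uniformity_completion_def)
  show "open U = (\<forall>x\<in>U. \<forall>\<^sub>F (x', y) in uniformity. x' = x \<longrightarrow> y \<in> U)"
    for U :: "'a completion set"
    by (rule open_completion_def)
  show "(norm x = 0) = (x = 0)"
  proof transfer
    fix x :: "nat \<Rightarrow> 'a"
    assume x: "cauchy_equiv x x"
    then have "(\<lambda>n. norm (x n)) \<longlonglongrightarrow> lim (\<lambda>n. norm (x n))"
      using Cauchy_convergent_norm convergent_LIMSEQ_iff unfolding cauchy_equiv_def by blast
    then have "lim (\<lambda>n. norm (x n)) = 0 \<longleftrightarrow> x \<longlonglongrightarrow> 0"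
      using limI tendsto_norm_zero_iff by metis
    then show "(lim (\<lambda>n. norm (x n)) = 0) = cauchy_equiv x (\<lambda>_. 0)"
      using x by (simp add: cauchy_equiv_def convergent_Cauchy convergent_const)
  qed
  show "norm (x + y) \<le> norm x + norm y"
  proof transfer
    fix x y :: "nat \<Rightarrow> 'a"
    assume "cauchy_equiv x x" "cauchy_equiv y y"
    then have "(\<lambda>n. norm (x n)) \<longlonglongrightarrow> lim (\<lambda>n. norm (x n))" "(\<lambda>n. norm (y n)) \<longlonglongrightarrow> lim (\<lambda>n. norm (y n))"
      and xy: "(\<lambda>n. norm (x n + y n)) \<longlonglongrightarrow> lim (\<lambda>n. norm (x n + y n))"
      using Cauchy_convergent_norm Cauchy_add_seq[of x y] convergent_LIMSEQ_iff
      unfolding cauchy_equiv_def by blast+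
    then have "(\<lambda>n. norm (x n) + norm (y n)) \<longlonglongrightarrow> lim (\<lambda>n. norm (x n)) + lim (\<lambda>n. norm (y n))"
      by (intro tendsto_add)
    from xy this show "lim (\<lambda>n. norm (x n + y n)) \<le> lim (\<lambda>n. norm (x n)) + lim (\<lambda>n. norm (y n))"
      by (rule LIMSEQ_le) (use norm_triangle_ineq in blast)
  qed
  show "norm (r *\<^sub>R x) = \<bar>r\<bar> * norm x"
  proof transfer
    fix r and x :: "nat \<Rightarrow> 'a"
    assume "cauchy_equiv x x"
    then have "(\<lambda>n. norm (x n)) \<longlonglongrightarrow> lim (\<lambda>n. norm (x n))"
      using Cauchy_convergent_norm convergent_LIMSEQ_iff unfolding cauchy_equiv_def by blast
    then have "(\<lambda>n. norm (r *\<^sub>R x n)) \<longlonglongrightarrow> \<bar>r\<bar> * lim (\<lambda>n. norm (x n))"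
      by (auto intro: tendsto_mult_left)
    then show "lim (\<lambda>n. norm (r *\<^sub>R x n)) = \<bar>r\<bar> * lim (\<lambda>n. norm (x n))"
      by (rule limI)
  qed
qed

end

lift_definition to_completion :: "'a::real_normed_vector \<Rightarrow> 'a completion" is "\<lambda>x _. x"
  by (simp add: cauchy_equiv_def convergent_Cauchy convergent_const)

lemma to_completion_add: "to_completion (x + y) = to_completion x + to_completion y"
  by transfer (simp add: cauchy_equiv_def convergent_Cauchy convergent_const)

lemma to_completion_scaleR: "to_completion (r *\<^sub>R x) = r *\<^sub>R to_completion x"
  by transfer (simp add: cauchy_equiv_def convergent_Cauchy convergent_const)

lemma norm_to_completion: "norm (to_completion x) = norm x"
  by transfer simp

lemma linear_to_completion: "linear to_completion"
  by (simp add: linearI to_completion_add to_completion_scaleR)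

lemma to_completion_diff: "to_completion (x - y) = to_completion x - to_completion y"
  by (rule linear_diff[OF linear_to_completion])


lemma completion_rep_exists:
  "\<exists>z. Cauchy z \<and> (\<forall>a. norm (to_completion a - x) = lim (\<lambda>m. norm (a - z m)))"
  unfolding minus_completion_def
  by transfer (auto simp: cauchy_equiv_def)

lemma completion_of_Cauchy_exists:
  "Cauchy z \<Longrightarrow> \<exists>x. \<forall>a. norm (to_completion a - x) = lim (\<lambda>m. norm (a - z m))"
  unfolding minus_completion_def
  by transfer (auto simp: cauchy_equiv_def)

lemma to_completion_tendsto:
  fixes z :: "nat \<Rightarrow> 'a::real_normed_vector"
  assumes z: "Cauchy z" and x: "\<And>a. norm (to_completion a - x) = lim (\<lambda>m. norm (a - z m))"
  shows "(\<lambda>n. to_completion (z n)) \<longlonglongrightarrow> x"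
proof (rule LIMSEQ_I)
  fix e :: real assume "e > 0"
  then obtain N where N: "\<forall>m\<ge>N. \<forall>n\<ge>N. norm (z m - z n) < e / 2"
    using z unfolding Cauchy_iff by (meson half_gt_zero)
  have "norm (to_completion (z n) - x) < e" if "n \<ge> N" for n
  proof -
    have "Cauchy (\<lambda>m. z n - z m)"
      using Cauchy_add_seq[OF convergent_Cauchy[OF convergent_const] Cauchy_minus_seq[OF z]] by simp
    then have "(\<lambda>m. norm (z n - z m)) \<longlonglongrightarrow> norm (to_completion (z n) - x)"
      using Cauchy_convergent_norm convergent_LIMSEQ_iff x by metis
    then have "norm (to_completion (z n) - x) \<le> e / 2"
      using N that by (intro LIMSEQ_le_const2) (auto intro!: exI[of _ N] less_imp_le)
    then show ?thesis using \<open>e > 0\<close> by simp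
  qed
  then show "\<exists>no. \<forall>n\<ge>no. norm (to_completion (z n) - x) < e" by blast
qed

lemma completion_approx:
  obtains z where "Cauchy z" "(\<lambda>n. to_completion (z n)) \<longlonglongrightarrow> x"
proof -
  obtain z where z: "Cauchy z" "\<forall>a. norm (to_completion a - x) = lim (\<lambda>m. norm (a - z m))"
    using completion_rep_exists[of x] by blast
  with to_completion_tendsto[of z x] show ?thesis by (intro that[of z]) auto
qed

lemma Cauchy_to_completion_iff: "Cauchy (\<lambda>n. to_completion (z n)) \<longleftrightarrow> Cauchy z"
  by (simp add: Cauchy_iff norm_to_completion flip: to_completion_diff)

lemma closure_range_to_completion: "closure (range (to_completion :: 'a::real_normed_vector \<Rightarrow> _)) = UNIV"
proof -
  have "x \<in> closure (range to_completion)" for x :: "'a completion"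
  proof -
    obtain z where "(\<lambda>n. to_completion (z n)) \<longlonglongrightarrow> x" using completion_approx[of x] by blast
    then show ?thesis unfolding closure_sequential by (intro exI[of _ "\<lambda>n. to_completion (z n)"]) simp
  qed
  then show ?thesis by blast
qed

instance completion :: (real_normed_vector) banach
proof
  fix X :: "nat \<Rightarrow> 'a completion"
  assume X: "Cauchy X"
  have "\<exists>a. dist (to_completion a) (X n) < inverse (real (Suc n))" for n
    using closure_range_to_completion[where 'a = 'a] closure_approachable[of "X n" "range to_completion"]
    by (auto simp del: of_nat_Suc)
  then obtain z where z: "\<And>n. dist (to_completion (z n)) (X n) < inverse (real (Suc n))"
    by metis
  have d: "(\<lambda>n. to_completion (z n) - X n) \<longlonglongrightarrow> 0"
    by (rule Lim_null_comparison[OF _ LIMSEQ_inverse_real_of_nat])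
      (use z in \<open>auto intro!: always_eventually less_imp_le simp: dist_norm\<close>)
  have "Cauchy (\<lambda>n. X n + (to_completion (z n) - X n))"
    using X d by (intro Cauchy_add_seq) (auto intro: LIMSEQ_imp_Cauchy)
  then have zC: "Cauchy z" by (simp add: Cauchy_to_completion_iff)
  then obtain x where "\<forall>a. norm (to_completion a - x) = lim (\<lambda>m. norm (a - z m))"
    using completion_of_Cauchy_exists by blast
  then have "(\<lambda>n. to_completion (z n)) \<longlonglongrightarrow> x" using to_completion_tendsto[OF zC] by blast
  from tendsto_diff[OF this d] show "convergent X" by (auto simp: convergent_def)
qed

lemma completion_extend:
  fixes f :: "'a::real_normed_vector \<Rightarrow> real"
  assumes f: "bounded_linear f"
  shows "\<exists>g :: 'a completion \<Rightarrow>\<^sub>L real. \<forall>x. blinfun_apply g (to_completion x) = f x"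
proof -
  interpret f: bounded_linear f by fact
  have fl: "\<exists>l. \<forall>z. Cauchy z \<longrightarrow> (\<lambda>n. to_completion (z n)) \<longlonglongrightarrow> x \<longrightarrow> (\<lambda>n. f (z n)) \<longlonglongrightarrow> l" for x
  proof -
    obtain w where w: "Cauchy w" "(\<lambda>n. to_completion (w n)) \<longlonglongrightarrow> x" using completion_approx by blast
    obtain l where l: "(\<lambda>n. f (w n)) \<longlonglongrightarrow> l"
      using convergentD[OF Cauchy_convergent[OF f.Cauchy[OF w(1)]]] by auto
    have "(\<lambda>n. f (z n)) \<longlonglongrightarrow> l" if z: "Cauchy z" "(\<lambda>n. to_completion (z n)) \<longlonglongrightarrow> x" for z
    proof -
      have "(\<lambda>n. to_completion (z n - w n)) \<longlonglongrightarrow> 0"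
        using tendsto_diff[OF z(2) w(2)] by (simp add: to_completion_diff)
      from tendsto_norm_zero[OF this] have "(\<lambda>n. norm (z n - w n)) \<longlonglongrightarrow> 0"
        by (simp only: norm_to_completion)
      then have "(\<lambda>n. z n - w n) \<longlonglongrightarrow> 0" by (rule tendsto_norm_zero_cancel)
      from tendsto_add[OF f.tendsto_zero[OF this] l] show ?thesis by (simp add: f.diff)
    qed
    then show ?thesis by blast
  qed
  then obtain g where g: "\<And>x z. Cauchy z \<Longrightarrow> (\<lambda>n. to_completion (z n)) \<longlonglongrightarrow> x \<Longrightarrow> (\<lambda>n. f (z n)) \<longlonglongrightarrow> g x"
    using choice[of "\<lambda>x l. \<forall>z. Cauchy z \<longrightarrow> (\<lambda>n. to_completion (z n)) \<longlonglongrightarrow> x \<longrightarrow> (\<lambda>n. f (z n)) \<longlonglongrightarrow> l"] by blast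
  obtain K where K: "\<And>x. norm (f x) \<le> norm x * K" using f.bounded by blast
  have "bounded_linear g"
  proof (rule bounded_linear_intro)
    fix x y :: "'a completion"
    obtain z where z: "Cauchy z" "(\<lambda>n. to_completion (z n)) \<longlonglongrightarrow> x" using completion_approx by blast
    obtain w where w: "Cauchy w" "(\<lambda>n. to_completion (w n)) \<longlonglongrightarrow> y" using completion_approx by blast
    have "(\<lambda>n. to_completion (z n + w n)) \<longlonglongrightarrow> x + y"
      using tendsto_add[OF z(2) w(2)] by (simp add: to_completion_add)
    with g[OF Cauchy_add_seq[OF z(1) w(1)]] have "(\<lambda>n. f (z n) + f (w n)) \<longlonglongrightarrow> g (x + y)"
      by (simp add: f.add)
    with tendsto_add[OF g[OF z] g[OF w]] show "g (x + y) = g x + g y"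
      using LIMSEQ_unique by blast
    show "g (r *\<^sub>R x) = r *\<^sub>R g x" for r
    proof -
      have "(\<lambda>n. to_completion (r *\<^sub>R z n)) \<longlonglongrightarrow> r *\<^sub>R x"
        using tendsto_scaleR[OF tendsto_const z(2)] by (simp add: to_completion_scaleR)
      with g[OF Cauchy_scaleR_seq[OF z(1)]] have "(\<lambda>n. r *\<^sub>R f (z n)) \<longlonglongrightarrow> g (r *\<^sub>R x)"
        by (simp add: f.scaleR)
      with tendsto_scaleR[OF tendsto_const g[OF z]] show ?thesis
        using LIMSEQ_unique by blast
    qed
    have "(\<lambda>n. norm (z n)) \<longlonglongrightarrow> norm x"
      using tendsto_norm[OF z(2)] by (simp add: norm_to_completion)
    from LIMSEQ_le[OF tendsto_norm[OF g[OF z]] tendsto_mult_right[OF this]]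
    show "norm (g x) \<le> norm x * K" using K by blast
  qed
  moreover have "g (to_completion x) = f x" for x
  proof -
    have "(\<lambda>_. f x) \<longlonglongrightarrow> g (to_completion x)"
      using g[of "\<lambda>_. x"] by (simp add: convergent_Cauchy convergent_const)
    then show ?thesis by (simp add: LIMSEQ_const_iff)
  qed
  ultimately show ?thesis by (intro exI[of _ "Blinfun g"]) (simp add: bounded_linear_Blinfun_apply)
qed

typedef c00 = "{x :: nat \<Rightarrow> real. finite {n. x n \<noteq> 0}}"
  morphisms coord Abs_c00
  by (rule exI[of _ "\<lambda>_. 0"]) simp

setup_lifting type_definition_c00

instantiation c00 :: real_vector
begin

lift_definition zero_c00 :: c00 is "\<lambda>_. 0" by simp
lift_definition plus_c00 :: "c00 \<Rightarrow> c00 \<Rightarrow> c00" is "\<lambda>x y n. x n + y n"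
proof -
  fix x y :: "nat \<Rightarrow> real"
  assume "finite {n. x n \<noteq> 0}" "finite {n. y n \<noteq> 0}"
  then show "finite {n. x n + y n \<noteq> 0}"
    by (rule finite_subset[rotated, OF finite_UnI]) auto
qed
lift_definition minus_c00 :: "c00 \<Rightarrow> c00 \<Rightarrow> c00" is "\<lambda>x y n. x n - y n"
proof -
  fix x y :: "nat \<Rightarrow> real"
  assume "finite {n. x n \<noteq> 0}" "finite {n. y n \<noteq> 0}"
  then show "finite {n. x n - y n \<noteq> 0}"
    by (rule finite_subset[rotated, OF finite_UnI]) auto
qed
lift_definition uminus_c00 :: "c00 \<Rightarrow> c00" is "\<lambda>x n. - x n" by simp
lift_definition scaleR_c00 :: "real \<Rightarrow> c00 \<Rightarrow> c00" is "\<lambda>r x n. r * x n"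
  by (rule finite_subset[rotated]) auto

instance
  by standard (transfer; simp add: fun_eq_iff algebra_simps)+

end

lift_definition unit_vec :: "nat \<Rightarrow> c00" is "\<lambda>k n. if n = k then 1 else 0"
  by simp

lift_definition proj :: "nat set \<Rightarrow> c00 \<Rightarrow> c00" is "\<lambda>E x n. if n \<in> E then x n else 0"
  by (rule finite_subset[rotated]) auto

definition supp :: "c00 \<Rightarrow> nat set" where
  "supp x = {n. coord x n \<noteq> 0}"

lemma finite_supp: "finite (supp x)"
  unfolding supp_def using coord by blast

lemma coord_simps [simp]:
  "coord 0 n = 0" "coord (x + y) n = coord x n + coord y n" "coord (x - y) n = coord x n - coord y n"
  "coord (- x) n = - coord x n" "coord (r *\<^sub>R x) n = r * coord x n"
  "coord (unit_vec k) n = (if n = k then 1 else 0)"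
  "coord (proj E x) n = (if n \<in> E then coord x n else 0)"
  by (transfer; simp)+

lemma c00_eqI: "(\<And>n. coord x n = coord y n) \<Longrightarrow> x = y"
  by (simp add: coord_inject[symmetric] fun_eq_iff)

lemma coord_sum [simp]: "coord (sum f A) n = (\<Sum>a\<in>A. coord (f a) n)"
  by (induction A rule: infinite_finite_induct) simp_all

lemma c00_expansion: "x = (\<Sum>n\<in>supp x. coord x n *\<^sub>R unit_vec n)"
proof (rule c00_eqI)
  fix m
  have "coord (\<Sum>n\<in>supp x. coord x n *\<^sub>R unit_vec n) m = (\<Sum>n\<in>supp x. if n = m then coord x n else 0)"
    by (simp, rule sum.cong) auto
  also have "\<dots> = coord x m" using finite_supp[of x] by (simp add: supp_def)
  finally show "coord x m = coord (\<Sum>n\<in>supp x. coord x n *\<^sub>R unit_vec n) m" by simp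
qed

lemma proj_simps:
  "proj E (x + y) = proj E x + proj E y" "proj E (r *\<^sub>R x) = r *\<^sub>R proj E x"
  "proj E 0 = 0"
  by (rule c00_eqI; simp)+

lemma supp_proj: "supp (proj E x) = E \<inter> supp x"
  by (auto simp: supp_def)

text \<open>Coordinates are indexed from \<open>0\<close>, so that \<open>unit_vec i\<close> is the vector usually written \<open>t\<^bsub>i+1\<^esub>\<close>; the condition
  \<open>k \<le> min E\<^sub>1\<close> on sets \<open>E\<^sub>1 < \<dots> < E\<^sub>k\<close> of positive integers therefore becomes \<open>k \<le> Suc (Min (E 0))\<close>.\<close>

definition admissible :: "nat \<Rightarrow> (nat \<Rightarrow> nat set) \<Rightarrow> bool" where
  "admissible k E \<longleftrightarrow> k \<ge> 1 \<and> (\<forall>j<k. finite (E j) \<and> E j \<noteq> {}) \<and>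
     (\<forall>j. Suc j < k \<longrightarrow> Max (E j) < Min (E (Suc j))) \<and> k \<le> Suc (Min (E 0))"

definition sup_coord :: "c00 \<Rightarrow> real" where
  "sup_coord x = Max (range (\<lambda>n. \<bar>coord x n\<bar>))"

definition admissible_sums :: "(c00 \<Rightarrow> real) \<Rightarrow> c00 \<Rightarrow> real set" where
  "admissible_sums N x = {(\<Sum>j<k. N (proj (E j) x)) |k E. admissible k E}"

definition is_norm :: "('a::real_vector \<Rightarrow> real) \<Rightarrow> bool" where
  "is_norm N \<longleftrightarrow> (\<forall>x y. N (x + y) \<le> N x + N y) \<and> (\<forall>r x. N (r *\<^sub>R x) = \<bar>r\<bar> * N x) \<and>
     (\<forall>x. N x = 0 \<longleftrightarrow> x = 0)"

definition tsirelson_norm :: "c00 \<Rightarrow> real" where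
  "tsirelson_norm = (THE N. is_norm N \<and>
     (\<forall>x. N x = max (sup_coord x) (1 / 2 * Sup (admissible_sums N x))))"

lemma finite_range_coord: "finite (range (\<lambda>n. \<bar>coord x n\<bar>))"
proof (rule finite_subset)
  show "range (\<lambda>n. \<bar>coord x n\<bar>) \<subseteq> insert 0 ((\<lambda>n. \<bar>coord x n\<bar>) ` supp x)"
    by (auto simp: supp_def)
qed (simp add: finite_supp)

lemma abs_coord_le: "\<bar>coord x n\<bar> \<le> sup_coord x"
  unfolding sup_coord_def using finite_range_coord by (intro Max_ge) auto

lemma sup_coord_le: "(\<And>n. \<bar>coord x n\<bar> \<le> c) \<Longrightarrow> sup_coord x \<le> c"
  unfolding sup_coord_def using finite_range_coord by (subst Max_le_iff) auto

lemma sup_coord_nonneg: "0 \<le> sup_coord x"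
  using abs_coord_le[of x 0] by linarith

definition weight_norm :: "(nat \<Rightarrow> real) \<Rightarrow> c00 \<Rightarrow> real" where
  "weight_norm w x = (\<Sum>n\<in>supp x. w n * \<bar>coord x n\<bar>)"

lemma weight_norm_superset:
  "finite A \<Longrightarrow> supp x \<subseteq> A \<Longrightarrow> weight_norm w x = (\<Sum>n\<in>A. w n * \<bar>coord x n\<bar>)"
  unfolding weight_norm_def by (rule sum.mono_neutral_left) (auto simp: supp_def)

lemma admissible_increasing:
  assumes E: "admissible k E" and "i < j" "j < k"
  shows "Max (E i) < Min (E j)"
  using assms(2,3)
proof (induction j)
  case (Suc j)
  have e: "finite (E j)" "E j \<noteq> {}" "Max (E j) < Min (E (Suc j))"
    using E Suc.prems by (auto simp: admissible_def)
  show ?case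
  proof (cases "i = j")
    case True
    with e show ?thesis by simp
  next
    case False
    with Suc have "Max (E i) < Min (E j)" by simp
    moreover have "Min (E j) \<le> Max (E j)" by (rule Min.coboundedI[OF e(1) Max_in[OF e(1,2)]])
    ultimately show ?thesis using e(3) by linarith
  qed
qed simp

lemma admissible_disjoint:
  assumes E: "admissible k E" and "i < k" "j < k" "i \<noteq> j"
  shows "E i \<inter> E j = {}"
proof -
  have "E i \<inter> E j = {}" if "i < j" "j < k" for i j
  proof -
    have f: "finite (E i)" "finite (E j)" using E that by (auto simp: admissible_def)
    show ?thesis
      using admissible_increasing[OF E that] Max_ge[OF f(1)] Min_le[OF f(2)] by fastforce
  qed
  then show ?thesis using assms(2-4) by (metis inf_commute nat_neq_iff)
qed

lemma admissible_sum_le: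
  assumes E: "admissible k E" and w: "\<And>n. 0 \<le> w n" and N: "\<And>x. N x \<le> weight_norm w x"
  shows "(\<Sum>j<k. N (proj (E j) x)) \<le> weight_norm w x"
proof -
  have "(\<Sum>j<k. N (proj (E j) x)) \<le> (\<Sum>j<k. weight_norm w (proj (E j) x))"
    by (intro sum_mono N)
  also have "\<dots> = (\<Sum>j<k. \<Sum>n\<in>E j \<inter> supp x. w n * \<bar>coord x n\<bar>)"
    by (auto simp: weight_norm_def supp_proj intro!: sum.cong)
  also have "\<dots> = (\<Sum>n\<in>(\<Union>j<k. E j \<inter> supp x). w n * \<bar>coord x n\<bar>)"
    using admissible_disjoint[OF E] finite_supp[of x]
    by (intro sum.UNION_disjoint[symmetric]) auto
  also have "\<dots> \<le> weight_norm w x"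
    unfolding weight_norm_def by (intro sum_mono2) (auto simp: finite_supp w)
  finally show ?thesis .
qed

lemma admissible_trivial: "admissible 1 (\<lambda>_. {0})"
  by (simp add: admissible_def)

lemma admissible_sums_nonempty: "admissible_sums N x \<noteq> {}"
  unfolding admissible_sums_def using admissible_trivial by blast

lemma admissible_sums_bdd:
  assumes "\<And>n. 0 \<le> w n" "\<And>x. N x \<le> weight_norm w x"
  shows "bdd_above (admissible_sums N x)"
  using admissible_sum_le[of _ _ w N x] assms
  by (auto simp: admissible_sums_def intro!: bdd_aboveI[of _ "weight_norm w x"])

lemma is_norm_sum:
  assumes "is_norm N"
  shows "N (sum f A) \<le> (\<Sum>a\<in>A. N (f a))"
proof -
  have "N 0 = 0" and t: "N (x + y) \<le> N x + N y" for x y using assms by (auto simp: is_norm_def)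
  then show ?thesis
    by (induction A rule: infinite_finite_induct) (auto intro: order_trans[OF t])
qed

lemma is_norm_nonneg:
  assumes "is_norm N"
  shows "0 \<le> N x"
proof -
  have t: "N (u + v) \<le> N u + N v" "N (r *\<^sub>R u) = \<bar>r\<bar> * N u" "N 0 = 0" for u v r
    using assms by (auto simp: is_norm_def)
  show ?thesis using t(1)[of x "- 1 *\<^sub>R x"] t(2)[of "-1" x] t(3) by simp
qed

lemma is_norm_le_weight_norm:
  assumes "is_norm N"
  shows "N x \<le> weight_norm (\<lambda>n. N (unit_vec n)) x"
proof -
  have "N x = N (\<Sum>n\<in>supp x. coord x n *\<^sub>R unit_vec n)" using c00_expansion by metis
  also have "\<dots> \<le> (\<Sum>n\<in>supp x. N (coord x n *\<^sub>R unit_vec n))" by (rule is_norm_sum[OF assms])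
  also have "\<dots> = weight_norm (\<lambda>n. N (unit_vec n)) x"
    using assms by (simp add: is_norm_def weight_norm_def mult.commute)
  finally show ?thesis .
qed

lemma tsirelson_norm_unique_le:
  assumes N: "is_norm N" and N': "is_norm N'"
    and eq: "\<And>x. N x = max (sup_coord x) (1 / 2 * Sup (admissible_sums N x))"
    and eq': "\<And>x. N' x = max (sup_coord x) (1 / 2 * Sup (admissible_sums N' x))"
  shows "N x \<le> N' x"
proof (induction "card (supp x)" arbitrary: x rule: less_induct)
  case less
  have "s \<le> 2 * max (N' x) (N x / 2)" if sN: "s \<in> admissible_sums N x" for s
  proof -
    obtain k E where E: "admissible k E" and s: "s = (\<Sum>j<k. N (proj (E j) x))"
      using sN unfolding admissible_sums_def by blast
    show ?thesis
    proof (cases "\<exists>i<k. supp x \<subseteq> E i")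
      case True
      then obtain i where i: "i < k" "supp x \<subseteq> E i" by blast
      have "N (proj (E j) x) = (if j = i then N x else 0)" if "j < k" for j
      proof (cases "j = i")
        case True
        then have "proj (E j) x = x" using i by (intro c00_eqI) (auto simp: supp_def)
        then show ?thesis using True by simp
      next
        case False
        then have "proj (E j) x = 0"
          using i admissible_disjoint[OF E that i(1)] by (intro c00_eqI) (auto simp: supp_def)
        then show ?thesis using False N by (simp add: is_norm_def)
      qed
      then have "s = N x" using i(1) by (simp add: s)
      then show ?thesis by simp
    next
      case False
      have "N (proj (E j) x) \<le> N' (proj (E j) x)" if "j < k" for j
        using False that
        by (intro less psubset_card_mono finite_supp) (auto simp: supp_proj)
      then have "s \<le> (\<Sum>j<k. N' (proj (E j) x))" unfolding s by (intro sum_mono) auto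
      also have "\<dots> \<le> Sup (admissible_sums N' x)"
        using E is_norm_le_weight_norm[OF N'] is_norm_nonneg[OF N']
        by (intro cSup_upper admissible_sums_bdd[of "\<lambda>n. N' (unit_vec n)"])
          (auto simp: admissible_sums_def)
      also have "\<dots> \<le> 2 * N' x" using eq'[of x] by linarith
      finally show ?thesis by simp
    qed
  qed
  then have "Sup (admissible_sums N x) \<le> 2 * max (N' x) (N x / 2)"
    by (intro cSup_least admissible_sums_nonempty) auto
  moreover have "sup_coord x \<le> N' x" using eq'[of x] by linarith
  ultimately have "N x \<le> max (N' x) (N x / 2)" using eq[of x] by linarith
  moreover have "0 \<le> N' x" by (rule is_norm_nonneg[OF N'])
  ultimately show ?case by linarith
qed

definition tsirelson_step :: "(c00 \<Rightarrow> real) \<Rightarrow> c00 \<Rightarrow> real" where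
  "tsirelson_step N x = max (sup_coord x) (1 / 2 * Sup (admissible_sums N x))"

definition good_seminorm :: "(c00 \<Rightarrow> real) \<Rightarrow> bool" where
  "good_seminorm N \<longleftrightarrow> (\<forall>x. 0 \<le> N x \<and> N x \<le> weight_norm (\<lambda>_. 1) x) \<and>
     (\<forall>x y. N (x + y) \<le> N x + N y) \<and> (\<forall>r x. N (r *\<^sub>R x) \<le> \<bar>r\<bar> * N x)"

lemma good_bdd: "good_seminorm N \<Longrightarrow> bdd_above (admissible_sums N x)"
  by (rule admissible_sums_bdd[of "\<lambda>_. 1"]) (auto simp: good_seminorm_def)

lemma good_le_Sup:
  "good_seminorm N \<Longrightarrow> admissible k E \<Longrightarrow>
    (\<Sum>j<k. N (proj (E j) x)) \<le> Sup (admissible_sums N x)"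
  by (intro cSup_upper good_bdd) (auto simp: admissible_sums_def)

lemma Sup_admissible_sums_le:
  "(\<And>k E. admissible k E \<Longrightarrow> (\<Sum>j<k. N (proj (E j) x)) \<le> c) \<Longrightarrow> Sup (admissible_sums N x) \<le> c"
  by (intro cSup_least admissible_sums_nonempty) (auto simp: admissible_sums_def)

lemma good_sup_coord: "good_seminorm sup_coord"
  unfolding good_seminorm_def
proof (intro conjI allI)
  fix x y r
  show "0 \<le> sup_coord x" by (rule sup_coord_nonneg)
  show "sup_coord x \<le> weight_norm (\<lambda>_. 1) x"
  proof (rule sup_coord_le)
    fix n
    show "\<bar>coord x n\<bar> \<le> weight_norm (\<lambda>_. 1) x"
    proof (cases "n \<in> supp x")
      case True
      then show ?thesis
        using member_le_sum[of n "supp x" "\<lambda>n. \<bar>coord x n\<bar>"] by (simp add: weight_norm_def finite_supp)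
    next
      case False
      then show ?thesis by (simp add: supp_def weight_norm_def sum_nonneg)
    qed
  qed
  show "sup_coord (x + y) \<le> sup_coord x + sup_coord y"
  proof (rule sup_coord_le)
    fix n
    show "\<bar>coord (x + y) n\<bar> \<le> sup_coord x + sup_coord y"
      using abs_coord_le[of x n] abs_coord_le[of y n] by simp
  qed
  show "sup_coord (r *\<^sub>R x) \<le> \<bar>r\<bar> * sup_coord x"
    by (rule sup_coord_le) (simp add: abs_mult mult_left_mono abs_coord_le)
qed

lemma good_step:
  assumes N: "good_seminorm N"
  shows "good_seminorm (tsirelson_step N)"
  unfolding good_seminorm_def
proof (intro conjI allI)
  fix x y r
  note [simp] = sup_coord_nonneg
  have c: "sup_coord x \<le> weight_norm (\<lambda>_. 1) x" "sup_coord (x + y) \<le> sup_coord x + sup_coord y"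
      "sup_coord (r *\<^sub>R x) \<le> \<bar>r\<bar> * sup_coord x"
    using good_sup_coord by (auto simp: good_seminorm_def)
  have Nx: "0 \<le> N x" "N x \<le> weight_norm (\<lambda>_. 1) x" "N (x + y) \<le> N x + N y"
    "N (r *\<^sub>R x) \<le> \<bar>r\<bar> * N x" for x y r
    using N by (auto simp: good_seminorm_def)
  show "0 \<le> tsirelson_step N x" unfolding tsirelson_step_def by (simp add: le_max_iff_disj)
  have "Sup (admissible_sums N x) \<le> weight_norm (\<lambda>_. 1) x"
    by (rule Sup_admissible_sums_le, rule admissible_sum_le) (auto simp: Nx)
  moreover have "0 \<le> weight_norm (\<lambda>_. 1) x" by (simp add: weight_norm_def sum_nonneg)
  ultimately show "tsirelson_step N x \<le> weight_norm (\<lambda>_. 1) x" using c by (simp add: tsirelson_step_def)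
  have "Sup (admissible_sums N (x + y)) \<le> Sup (admissible_sums N x) + Sup (admissible_sums N y)"
  proof (rule Sup_admissible_sums_le)
    fix k E assume E: "admissible k E"
    have "(\<Sum>j<k. N (proj (E j) (x + y))) \<le> (\<Sum>j<k. N (proj (E j) x)) + (\<Sum>j<k. N (proj (E j) y))"
      by (simp add: proj_simps Nx sum_mono flip: sum.distrib)
    with good_le_Sup[OF N E, of x] good_le_Sup[OF N E, of y]
    show "(\<Sum>j<k. N (proj (E j) (x + y))) \<le> Sup (admissible_sums N x) + Sup (admissible_sums N y)"
      by linarith
  qed
  then show "tsirelson_step N (x + y) \<le> tsirelson_step N x + tsirelson_step N y"
    using c(2) unfolding tsirelson_step_def by linarith
  have "Sup (admissible_sums N (r *\<^sub>R x)) \<le> \<bar>r\<bar> * Sup (admissible_sums N x)"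
  proof (rule Sup_admissible_sums_le)
    fix k E assume E: "admissible k E"
    have "(\<Sum>j<k. N (proj (E j) (r *\<^sub>R x))) \<le> \<bar>r\<bar> * (\<Sum>j<k. N (proj (E j) x))"
      by (simp add: proj_simps Nx sum_mono sum_distrib_left)
    also have "\<dots> \<le> \<bar>r\<bar> * Sup (admissible_sums N x)"
      by (intro mult_left_mono good_le_Sup[OF N E]) simp
    finally show "(\<Sum>j<k. N (proj (E j) (r *\<^sub>R x))) \<le> \<bar>r\<bar> * Sup (admissible_sums N x)" .
  qed
  moreover have "\<bar>r\<bar> * sup_coord x \<le> \<bar>r\<bar> * tsirelson_step N x"
    "\<bar>r\<bar> * (1 / 2 * Sup (admissible_sums N x)) \<le> \<bar>r\<bar> * tsirelson_step N x"
    by (intro mult_left_mono; simp add: tsirelson_step_def)+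
  ultimately show "tsirelson_step N (r *\<^sub>R x) \<le> \<bar>r\<bar> * tsirelson_step N x"
    using c(3) unfolding tsirelson_step_def[of N "r *\<^sub>R x"] by simp
qed

lemma step_mono:
  assumes N': "good_seminorm N'" and le: "\<And>x. N x \<le> N' x"
  shows "tsirelson_step N x \<le> tsirelson_step N' x"
proof -
  have "Sup (admissible_sums N x) \<le> Sup (admissible_sums N' x)"
    by (rule Sup_admissible_sums_le) (rule order_trans[OF sum_mono[OF le] good_le_Sup[OF N']])
  then show ?thesis unfolding tsirelson_step_def by linarith
qed

definition tsirelson_approx :: "nat \<Rightarrow> c00 \<Rightarrow> real" where
  "tsirelson_approx m = (tsirelson_step ^^ m) sup_coord"

lemma good_approx: "good_seminorm (tsirelson_approx m)"
  by (induction m) (auto simp: tsirelson_approx_def good_sup_coord good_step)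

lemma approx_mono: "tsirelson_approx m x \<le> tsirelson_approx (Suc m) x"
proof (induction m arbitrary: x)
  case 0
  show ?case by (simp add: tsirelson_approx_def tsirelson_step_def)
next
  case (Suc m)
  have eq: "tsirelson_approx (Suc k) = tsirelson_step (tsirelson_approx k)" for k
    by (simp add: tsirelson_approx_def)
  show ?case unfolding eq[of "Suc m"] by (subst eq) (rule step_mono[OF good_approx Suc])
qed

lemma tsirelson_norm_exists:
  "\<exists>N. is_norm N \<and> (\<forall>x. N x = max (sup_coord x) (1 / 2 * Sup (admissible_sums N x)))"
proof -
  let ?A = tsirelson_approx
  have eq: "?A (Suc k) = tsirelson_step (?A k)" for k
    by (simp add: tsirelson_approx_def)
  have A: "0 \<le> ?A m x" "?A m x \<le> weight_norm (\<lambda>_. 1) x" "?A m (x + y) \<le> ?A m x + ?A m y"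
    "?A m (r *\<^sub>R x) \<le> \<bar>r\<bar> * ?A m x" for m x y r
    using good_approx[of m] by (auto simp: good_seminorm_def)
  have inc: "incseq (\<lambda>m. ?A m x)" for x
    by (rule incseq_SucI) (rule approx_mono)
  define N where "N x = lim (\<lambda>m. ?A m x)" for x
  have lim: "(\<lambda>m. ?A m x) \<longlonglongrightarrow> N x" for x
  proof -
    obtain L where "(\<lambda>m. ?A m x) \<longlonglongrightarrow> L"
      using incseq_convergent[OF inc[of x], of "weight_norm (\<lambda>_. 1) x"] A(2) by blast
    then show ?thesis unfolding N_def using limI by metis
  qed
  have le: "?A m x \<le> N x" for m x by (rule incseq_le[OF inc lim])
  have good: "good_seminorm N"
    unfolding good_seminorm_def
  proof (intro conjI allI)
    fix x y r
    show "0 \<le> N x" by (rule LIMSEQ_le_const[OF lim]) (use A in auto)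
    show "N x \<le> weight_norm (\<lambda>_. 1) x" by (rule LIMSEQ_le_const2[OF lim]) (use A in auto)
    show "N (x + y) \<le> N x + N y"
      by (rule LIMSEQ_le[OF lim tendsto_add[OF lim lim]]) (use A in auto)
    show "N (r *\<^sub>R x) \<le> \<bar>r\<bar> * N x"
      by (rule LIMSEQ_le[OF lim tendsto_mult_left[OF lim]]) (use A in auto)
  qed
  have "N x = tsirelson_step N x" for x
  proof (rule antisym)
    show "N x \<le> tsirelson_step N x"
    proof (rule LIMSEQ_le_const2[OF lim], intro exI allI impI)
      fix m :: nat
      have "?A m x \<le> ?A (Suc m) x" by (rule approx_mono)
      also have "\<dots> \<le> tsirelson_step N x" unfolding eq by (rule step_mono[OF good le])
      finally show "?A m x \<le> tsirelson_step N x" .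
    qed
    have "sup_coord x \<le> N x" using le[of 0 x] by (simp add: tsirelson_approx_def)
    moreover have "Sup (admissible_sums N x) \<le> 2 * N x"
    proof (rule Sup_admissible_sums_le)
      fix k E assume E: "admissible k E"
      have l: "(\<lambda>m. \<Sum>j<k. ?A m (proj (E j) x)) \<longlonglongrightarrow> (\<Sum>j<k. N (proj (E j) x))"
        by (intro tendsto_sum lim)
      show "(\<Sum>j<k. N (proj (E j) x)) \<le> 2 * N x"
      proof (rule LIMSEQ_le_const2[OF l], intro exI allI impI)
        fix m :: nat
        have "(\<Sum>j<k. ?A m (proj (E j) x)) \<le> Sup (admissible_sums (?A m) x)"
          by (rule good_le_Sup[OF good_approx E])
        also have "\<dots> \<le> 2 * ?A (Suc m) x" unfolding eq tsirelson_step_def by linarith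
        also have "\<dots> \<le> 2 * N x" using le by simp
        finally show "(\<Sum>j<k. ?A m (proj (E j) x)) \<le> 2 * N x" .
      qed
    qed
    ultimately show "tsirelson_step N x \<le> N x" by (simp add: tsirelson_step_def)
  qed
  moreover have "is_norm N"
    unfolding is_norm_def
  proof (intro conjI allI)
    fix x y r
    have g: "0 \<le> N x" "N x \<le> weight_norm (\<lambda>_. 1) x" "N (x + y) \<le> N x + N y"
      "N (r *\<^sub>R x) \<le> \<bar>r\<bar> * N x" for x y r
      using good by (auto simp: good_seminorm_def)
    show "N (x + y) \<le> N x + N y" by (rule g)
    show "N x = 0 \<longleftrightarrow> x = 0"
    proof
      assume "x = 0"
      then show "N x = 0" using g(1,2)[of 0] by (simp add: weight_norm_def supp_def)
    next
      assume "N x = 0"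
      then have "sup_coord x \<le> 0" using le[of 0 x] by (simp add: tsirelson_approx_def)
      then have "coord x n = 0" for n using abs_coord_le[of x n] by linarith
      then show "x = 0" by (intro c00_eqI) simp
    qed
    then have N0: "N 0 = 0" for x by (metis g(1) g(4) abs_zero antisym mult_zero_left scaleR_zero_left)
    show "N (r *\<^sub>R x) = \<bar>r\<bar> * N x"
    proof (cases "r = 0")
      case False
      have "N (inverse r *\<^sub>R (r *\<^sub>R x)) \<le> \<bar>inverse r\<bar> * N (r *\<^sub>R x)" by (rule g)
      then have "\<bar>r\<bar> * N x \<le> N (r *\<^sub>R x)" using False by (simp add: field_simps)
      then show ?thesis using g(4)[of r x] by simp
    qed (simp add: N0)
  qed
  ultimately show ?thesis by (auto simp: tsirelson_step_def)
qed

lemma is_norm_tsirelson: "is_norm tsirelson_norm"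
  and tsirelson_norm_eq:
    "tsirelson_norm x = max (sup_coord x) (1 / 2 * Sup (admissible_sums tsirelson_norm x))"
proof -
  have "\<exists>!N. is_norm N \<and> (\<forall>x. N x = max (sup_coord x) (1 / 2 * Sup (admissible_sums N x)))"
    using tsirelson_norm_exists tsirelson_norm_unique_le by (auto intro!: ext antisym)
  from theI'[OF this] show "is_norm tsirelson_norm"
    "tsirelson_norm x = max (sup_coord x) (1 / 2 * Sup (admissible_sums tsirelson_norm x))"
    unfolding tsirelson_norm_def by blast+
qed

typedef tsirelson_c00 = "UNIV :: c00 set" morphisms seq_of_tsirelson Tsirelson_c00 ..

setup_lifting type_definition_tsirelson_c00

instantiation tsirelson_c00 :: real_normed_vector
begin

lift_definition zero_tsirelson_c00 :: tsirelson_c00 is 0 .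
lift_definition plus_tsirelson_c00 :: "tsirelson_c00 \<Rightarrow> tsirelson_c00 \<Rightarrow> tsirelson_c00" is "(+)" .
lift_definition minus_tsirelson_c00 :: "tsirelson_c00 \<Rightarrow> tsirelson_c00 \<Rightarrow> tsirelson_c00" is "(-)" .
lift_definition uminus_tsirelson_c00 :: "tsirelson_c00 \<Rightarrow> tsirelson_c00" is uminus .
lift_definition scaleR_tsirelson_c00 :: "real \<Rightarrow> tsirelson_c00 \<Rightarrow> tsirelson_c00" is scaleR .
lift_definition norm_tsirelson_c00 :: "tsirelson_c00 \<Rightarrow> real" is tsirelson_norm .

definition sgn_tsirelson_c00 :: "tsirelson_c00 \<Rightarrow> tsirelson_c00" where
  "sgn_tsirelson_c00 x = scaleR (inverse (norm x)) x"
definition dist_tsirelson_c00 :: "tsirelson_c00 \<Rightarrow> tsirelson_c00 \<Rightarrow> real" where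
  "dist_tsirelson_c00 x y = norm (x - y)"
definition uniformity_tsirelson_c00 :: "(tsirelson_c00 \<times> tsirelson_c00) filter" where
  "uniformity_tsirelson_c00 = (INF e\<in>{0<..}. principal {(x, y). dist x y < e})"
definition open_tsirelson_c00 :: "tsirelson_c00 set \<Rightarrow> bool" where
  "open_tsirelson_c00 U = (\<forall>x\<in>U. \<forall>\<^sub>F (x', y) in uniformity. x' = x \<longrightarrow> y \<in> U)"

instance
proof
  fix x y z :: tsirelson_c00 and r s :: real
  show "x + y + z = x + (y + z)" "x + y = y + x" "0 + x = x" "- x + x = 0" "x - y = x + - y"
    "r *\<^sub>R (x + y) = r *\<^sub>R x + r *\<^sub>R y" "(r + s) *\<^sub>R x = r *\<^sub>R x + s *\<^sub>R x"
    "r *\<^sub>R s *\<^sub>R x = (r * s) *\<^sub>R x" "1 *\<^sub>R x = x"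
    by (transfer; simp add: algebra_simps)+
  show "(norm x = 0) = (x = 0)" "norm (x + y) \<le> norm x + norm y" "norm (r *\<^sub>R x) = \<bar>r\<bar> * norm x"
    using is_norm_tsirelson unfolding is_norm_def
    by (simp_all add: norm_tsirelson_c00.rep_eq zero_tsirelson_c00.rep_eq plus_tsirelson_c00.rep_eq scaleR_tsirelson_c00.rep_eq
        flip: seq_of_tsirelson_inject)
qed (simp_all only: sgn_tsirelson_c00_def dist_tsirelson_c00_def uniformity_tsirelson_c00_def
      open_tsirelson_c00_def)

end

type_synonym tsirelson = "tsirelson_c00 completion"
type_synonym tsirelson_dual = "tsirelson \<Rightarrow>\<^sub>L real"

definition t_vec :: "nat \<Rightarrow> tsirelson" where
  "t_vec n = to_completion (Tsirelson_c00 (unit_vec n))"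

definition t_star :: "nat \<Rightarrow> tsirelson_dual" where
  "t_star n = (THE f. \<forall>m. blinfun_apply f (t_vec m) = (if m = n then 1 else 0))"

lemma blinfun_eq_on_to_completion:
  fixes f g :: "'a::real_normed_vector completion \<Rightarrow>\<^sub>L real"
  assumes "\<And>a. blinfun_apply f (to_completion a) = blinfun_apply g (to_completion a)"
  shows "f = g"
proof (rule blinfun_eqI)
  fix x :: "'a completion"
  obtain z where z: "(\<lambda>n. to_completion (z n)) \<longlonglongrightarrow> x" using completion_approx by blast
  have "(\<lambda>n. blinfun_apply f (to_completion (z n))) \<longlonglongrightarrow> blinfun_apply f x"
    "(\<lambda>n. blinfun_apply g (to_completion (z n))) \<longlonglongrightarrow> blinfun_apply g x"
    by (intro tendsto_intros z)+
  then show "blinfun_apply f x = blinfun_apply g x"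
    using LIMSEQ_unique assms by auto
qed

lemma abs_coord_le_tsirelson_norm: "\<bar>coord x n\<bar> \<le> tsirelson_norm x"
  using abs_coord_le[of x n] tsirelson_norm_eq[of x] by linarith

lemma linear_Tsirelson_c00: "linear Tsirelson_c00"
  by (rule linearI) (simp_all add: plus_tsirelson_c00.abs_eq scaleR_tsirelson_c00.abs_eq)

lemma norm_Tsirelson_c00: "norm (Tsirelson_c00 x) = tsirelson_norm x"
  by (rule norm_tsirelson_c00.abs_eq)

lemma t_vec_expansion:
  "to_completion (Tsirelson_c00 x) = (\<Sum>n\<in>supp x. coord x n *\<^sub>R t_vec n)"
proof -
  have l: "linear (\<lambda>x. to_completion (Tsirelson_c00 x))"
    using linear_compose[OF linear_Tsirelson_c00 linear_to_completion] by (simp add: o_def)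
  show ?thesis
    by (subst c00_expansion) (simp add: linear_sum[OF l] linear_scale[OF l] t_vec_def)
qed

lemma t_star_ex1:
  "\<exists>!f :: tsirelson_dual. \<forall>m. blinfun_apply f (t_vec m) = (if m = n then 1 else 0)"
proof -
  have "bounded_linear (\<lambda>x. coord (seq_of_tsirelson x) n)"
  proof (rule bounded_linear_intro)
    fix x y :: tsirelson_c00 and r :: real
    show "coord (seq_of_tsirelson (x + y)) n = coord (seq_of_tsirelson x) n + coord (seq_of_tsirelson y) n"
      "coord (seq_of_tsirelson (r *\<^sub>R x)) n = r *\<^sub>R coord (seq_of_tsirelson x) n"
      by (transfer; simp)+
    show "norm (coord (seq_of_tsirelson x) n) \<le> norm x * 1"
      using abs_coord_le_tsirelson_norm by transfer simp
  qed
  from completion_extend[OF this] obtain f :: tsirelson_dual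
    where "\<And>x. blinfun_apply f (to_completion x) = coord (seq_of_tsirelson x) n" by blast
  then have "\<forall>m. blinfun_apply f (t_vec m) = (if m = n then 1 else 0)"
    by (simp add: t_vec_def Tsirelson_c00_inverse)
  moreover have "f = g" if "\<forall>m. blinfun_apply f (t_vec m) = (if m = n then 1 else 0)"
    "\<forall>m. blinfun_apply g (t_vec m) = (if m = n then 1 else 0)" for f g :: tsirelson_dual
  proof (rule blinfun_eq_on_to_completion)
    fix a :: tsirelson_c00
    obtain x where "a = Tsirelson_c00 x" by (cases a) auto
    then show "blinfun_apply f (to_completion a) = blinfun_apply g (to_completion a)"
      using that by (simp add: t_vec_expansion blinfun.sum_right blinfun.scaleR_right)
  qed
  ultimately show ?thesis by blast
qed

lemma t_star_t_vec: "blinfun_apply (t_star n) (t_vec m) = (if m = n then 1 else 0)"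
  using theI'[OF t_star_ex1[of n]] unfolding t_star_def by blast

lemma t_star_to_completion: "blinfun_apply (t_star n) (to_completion (Tsirelson_c00 x)) = coord x n"
proof -
  have "blinfun_apply (t_star n) (to_completion (Tsirelson_c00 x))
      = (\<Sum>m\<in>supp x. if m = n then coord x m else 0)"
    unfolding t_vec_expansion blinfun.sum_right
    by (rule sum.cong) (auto simp: blinfun.scaleR_right t_star_t_vec)
  also have "\<dots> = coord x n" using finite_supp[of x] by (simp add: supp_def)
  finally show ?thesis .
qed

lemma norm_t_star_le: "norm (t_star n) \<le> 1"
proof (rule norm_blinfun_bound)
  fix x :: tsirelson
  obtain z where z: "(\<lambda>k. to_completion (z k)) \<longlonglongrightarrow> x" using completion_approx by blast
  have "norm (blinfun_apply (t_star n) (to_completion a)) \<le> norm (to_completion a)" for a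
  proof -
    obtain y where "a = Tsirelson_c00 y" by (cases a) auto
    then show ?thesis
      by (simp add: t_star_to_completion norm_to_completion norm_Tsirelson_c00 abs_coord_le_tsirelson_norm)
  qed
  moreover have "(\<lambda>k. norm (blinfun_apply (t_star n) (to_completion (z k)))) \<longlonglongrightarrow> norm (blinfun_apply (t_star n) x)"
    "(\<lambda>k. norm (to_completion (z k))) \<longlonglongrightarrow> norm x"
    by (intro tendsto_intros z)+
  ultimately show "norm (blinfun_apply (t_star n) x) \<le> 1 * norm x"
    by (simp add: LIMSEQ_le)
qed simp

definition su_norm :: "c00 \<Rightarrow> real" where
  "su_norm x = (SUP r\<in>{r :: nat \<Rightarrow> nat. strict_mono r}.
     norm (\<Sum>i | coord x (r i) \<noteq> 0. coord x (r i) *\<^sub>R t_star i))"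

definition spread_functional :: "(nat \<Rightarrow> nat) \<Rightarrow> c00 \<Rightarrow> tsirelson_dual" where
  "spread_functional r x = (\<Sum>i | coord x (r i) \<noteq> 0. coord x (r i) *\<^sub>R t_star i)"

lemma finite_spread: "strict_mono (r :: nat \<Rightarrow> nat) \<Longrightarrow> finite {i. coord x (r i) \<noteq> 0}"
proof -
  assume "strict_mono r"
  then have "inj r" by (rule strict_mono_imp_inj_on)
  from finite_vimageI[OF finite_supp[of x] this] show ?thesis
    by (simp only: supp_def vimage_def mem_Collect_eq)
qed

lemma spread_functional_superset:
  "finite A \<Longrightarrow> {i. coord x (r i) \<noteq> 0} \<subseteq> A \<Longrightarrow>
    spread_functional r x = (\<Sum>i\<in>A. coord x (r i) *\<^sub>R t_star i)"
  unfolding spread_functional_def by (rule sum.mono_neutral_left) auto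

lemma spread_functional_add:
  assumes "strict_mono r"
  shows "spread_functional r (x + y) = spread_functional r x + spread_functional r y"
proof -
  let ?A = "{i. coord x (r i) \<noteq> 0} \<union> {i. coord y (r i) \<noteq> 0}"
  have f: "finite ?A" using finite_spread[OF assms] by simp
  have "spread_functional r z = (\<Sum>i\<in>?A. coord z (r i) *\<^sub>R t_star i)" if "z \<in> {x, y, x + y}" for z
    by (rule spread_functional_superset[OF f]) (use that in auto)
  then show ?thesis by (simp add: scaleR_add_left sum.distrib)
qed

lemma spread_functional_scaleR:
  assumes "strict_mono r"
  shows "spread_functional r (c *\<^sub>R x) = c *\<^sub>R spread_functional r x"
proof -
  let ?A = "{i. coord x (r i) \<noteq> 0}"
  have f: "finite ?A" using finite_spread[OF assms] by simp
  have "spread_functional r z = (\<Sum>i\<in>?A. coord z (r i) *\<^sub>R t_star i)" if "z \<in> {x, c *\<^sub>R x}" for z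
    by (rule spread_functional_superset[OF f]) (use that in auto)
  then show ?thesis by (simp add: scaleR_sum_right)
qed

lemma norm_spread_functional_le:
  assumes r: "strict_mono r"
  shows "norm (spread_functional r x) \<le> weight_norm (\<lambda>_. 1) x"
proof -
  let ?A = "{i. coord x (r i) \<noteq> 0}"
  have "norm (spread_functional r x) \<le> (\<Sum>i\<in>?A. norm (coord x (r i) *\<^sub>R t_star i))"
    unfolding spread_functional_def by (rule norm_sum)
  also have "\<dots> \<le> (\<Sum>i\<in>?A. \<bar>coord x (r i)\<bar>)"
    by (rule sum_mono) (simp add: mult_left_le norm_t_star_le)
  also have "\<dots> = (\<Sum>n\<in>r ` ?A. \<bar>coord x n\<bar>)"
    using inj_on_subset[OF strict_mono_imp_inj_on[OF r] subset_UNIV, of ?A] by (simp add: sum.reindex)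
  also have "\<dots> \<le> (\<Sum>n\<in>supp x. \<bar>coord x n\<bar>)"
    by (rule sum_mono2) (auto simp: finite_supp, auto simp: supp_def)
  finally show ?thesis by (simp add: weight_norm_def)
qed

lemma su_norm_eq: "su_norm x = (SUP r\<in>{r. strict_mono r}. norm (spread_functional r x))"
  by (simp add: su_norm_def spread_functional_def)

lemma spread_le_su_norm: "strict_mono r \<Longrightarrow> norm (spread_functional r x) \<le> su_norm x"
proof -
  assume "strict_mono r"
  moreover have "bdd_above ((\<lambda>r. norm (spread_functional r x)) ` {r. strict_mono r})"
    by (rule bdd_aboveI2[of _ _ "weight_norm (\<lambda>_. 1) x"]) (simp add: norm_spread_functional_le)
  ultimately show ?thesis unfolding su_norm_eq by (intro cSUP_upper) simp_all
qed

lemma su_norm_le: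
  assumes "\<And>r. strict_mono r \<Longrightarrow> norm (spread_functional r x) \<le> c"
  shows "su_norm x \<le> c"
  unfolding su_norm_eq
proof (rule cSUP_least)
  show "{r :: nat \<Rightarrow> nat. strict_mono r} \<noteq> {}" using strict_mono_id[where 'a = nat] by (auto simp del: id_apply)
qed (use assms in simp)

lemma is_norm_su: "is_norm su_norm"
  unfolding is_norm_def
proof (intro conjI allI)
  fix x y c
  show "su_norm (x + y) \<le> su_norm x + su_norm y"
  proof (rule su_norm_le)
    fix r :: "nat \<Rightarrow> nat" assume r: "strict_mono r"
    show "norm (spread_functional r (x + y)) \<le> su_norm x + su_norm y"
      using norm_triangle_ineq[of "spread_functional r x" "spread_functional r y"]
        spread_le_su_norm[OF r, of x] spread_le_su_norm[OF r, of y]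
      by (simp add: spread_functional_add[OF r])
  qed
  have scale: "su_norm (c *\<^sub>R x) \<le> \<bar>c\<bar> * su_norm x" for c x
    by (rule su_norm_le) (simp add: spread_functional_scaleR spread_le_su_norm mult_left_mono)
  have nonneg: "0 \<le> su_norm x" for x
    using spread_le_su_norm[OF strict_mono_id, of x] norm_ge_zero order_trans by blast
  show zero: "su_norm x = 0 \<longleftrightarrow> x = 0" for x
  proof
    assume "su_norm x = 0"
    then have "spread_functional id x = 0"
      using spread_le_su_norm[OF strict_mono_id, of x] by simp
    then have *: "(\<Sum>i\<in>supp x. coord x i *\<^sub>R t_star i) = 0"
      by (simp add: spread_functional_def supp_def)
    have "coord x m = 0" for m
    proof -
      have "(\<Sum>i\<in>supp x. if i = m then coord x i else 0)
          = blinfun_apply (\<Sum>i\<in>supp x. coord x i *\<^sub>R t_star i) (t_vec m)"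
        unfolding blinfun.sum_left
        by (rule sum.cong) (auto simp: blinfun.scaleR_left t_star_t_vec)
      then show ?thesis using finite_supp[of x] * by (simp add: supp_def split: if_splits)
    qed
    then show "x = 0" by (intro c00_eqI) simp
  next
    assume "x = 0"
    then show "su_norm x = 0" using scale[of 0 0] nonneg[of 0] by simp
  qed
  show "su_norm (c *\<^sub>R x) = \<bar>c\<bar> * su_norm x"
  proof (cases "c = 0")
    case False
    have "su_norm (inverse c *\<^sub>R (c *\<^sub>R x)) \<le> \<bar>inverse c\<bar> * su_norm (c *\<^sub>R x)" by (rule scale)
    then have "\<bar>c\<bar> * su_norm x \<le> su_norm (c *\<^sub>R x)" using False by (simp add: field_simps)
    then show ?thesis using scale[of c x] by simp
  qed (use zero[of 0] in simp)
qed

typedef su_c00 = "UNIV :: c00 set" morphisms seq_of_su Su_c00 ..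

setup_lifting type_definition_su_c00

instantiation su_c00 :: real_normed_vector
begin

lift_definition zero_su_c00 :: su_c00 is 0 .
lift_definition plus_su_c00 :: "su_c00 \<Rightarrow> su_c00 \<Rightarrow> su_c00" is "(+)" .
lift_definition minus_su_c00 :: "su_c00 \<Rightarrow> su_c00 \<Rightarrow> su_c00" is "(-)" .
lift_definition uminus_su_c00 :: "su_c00 \<Rightarrow> su_c00" is uminus .
lift_definition scaleR_su_c00 :: "real \<Rightarrow> su_c00 \<Rightarrow> su_c00" is scaleR .
lift_definition norm_su_c00 :: "su_c00 \<Rightarrow> real" is su_norm .

definition sgn_su_c00 :: "su_c00 \<Rightarrow> su_c00" where
  "sgn_su_c00 x = scaleR (inverse (norm x)) x"
definition dist_su_c00 :: "su_c00 \<Rightarrow> su_c00 \<Rightarrow> real" where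
  "dist_su_c00 x y = norm (x - y)"
definition uniformity_su_c00 :: "(su_c00 \<times> su_c00) filter" where
  "uniformity_su_c00 = (INF e\<in>{0<..}. principal {(x, y). dist x y < e})"
definition open_su_c00 :: "su_c00 set \<Rightarrow> bool" where
  "open_su_c00 U = (\<forall>x\<in>U. \<forall>\<^sub>F (x', y) in uniformity. x' = x \<longrightarrow> y \<in> U)"

instance
proof
  fix x y z :: su_c00 and r s :: real
  show "x + y + z = x + (y + z)" "x + y = y + x" "0 + x = x" "- x + x = 0" "x - y = x + - y"
    "r *\<^sub>R (x + y) = r *\<^sub>R x + r *\<^sub>R y" "(r + s) *\<^sub>R x = r *\<^sub>R x + s *\<^sub>R x"
    "r *\<^sub>R s *\<^sub>R x = (r * s) *\<^sub>R x" "1 *\<^sub>R x = x"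
    by (transfer; simp add: algebra_simps)+
  show "(norm x = 0) = (x = 0)" "norm (x + y) \<le> norm x + norm y" "norm (r *\<^sub>R x) = \<bar>r\<bar> * norm x"
    using is_norm_su unfolding is_norm_def
    by (simp_all add: norm_su_c00.rep_eq zero_su_c00.rep_eq plus_su_c00.rep_eq scaleR_su_c00.rep_eq
        flip: seq_of_su_inject)
qed (simp_all only: sgn_su_c00_def dist_su_c00_def uniformity_su_c00_def open_su_c00_def)

end

type_synonym Su = "su_c00 completion"
type_synonym Su_dual = "Su \<Rightarrow>\<^sub>L real"

text \<open>A quotient \<open>X/M\<close> depends on the term \<open>M\<close> and so is not a type. Sequences are therefore
  considered in normed spaces given by an explicit carrier; \<open>full_space\<close> turns a type of class
  \<open>real_normed_vector\<close> into such a space, on which the lemmas ending in \<open>_full_space\<close> express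
  these notions by \<open>sums\<close>, \<open>summable\<close>, \<open>span\<close> and \<open>closure\<close>. The quotient norm is the
  infimum of the norm over a coset.\<close>

record 'v nspace =
  points :: "'v set"
  vzero :: 'v
  vadd :: "'v \<Rightarrow> 'v \<Rightarrow> 'v"
  vscale :: "real \<Rightarrow> 'v \<Rightarrow> 'v"
  vnorm :: "'v \<Rightarrow> real"

definition full_space :: "'a::real_normed_vector nspace" where
  "full_space = \<lparr>points = UNIV, vzero = 0, vadd = (+), vscale = (*\<^sub>R), vnorm = norm\<rparr>"

definition coset :: "'a::real_normed_vector set \<Rightarrow> 'a \<Rightarrow> 'a set" where
  "coset M x = (\<lambda>m. x + m) ` M"

definition quotient_space :: "'a::real_normed_vector set \<Rightarrow> 'a set nspace" where
  "quotient_space M =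
     \<lparr>points = range (coset M),
      vzero = M,
      vadd = (\<lambda>A B. {a + b |a b. a \<in> A \<and> b \<in> B}),
      vscale = (\<lambda>r A. {r *\<^sub>R a + m |a m. a \<in> A \<and> m \<in> M}),
      vnorm = (\<lambda>A. Inf (norm ` A))\<rparr>"

primrec partial_sum :: "'v nspace \<Rightarrow> (nat \<Rightarrow> real) \<Rightarrow> (nat \<Rightarrow> 'v) \<Rightarrow> nat \<Rightarrow> 'v" where
  "partial_sum V a x 0 = vzero V"
| "partial_sum V a x (Suc n) = vadd V (partial_sum V a x n) (vscale V (a n) (x n))"

definition vdist :: "'v nspace \<Rightarrow> 'v \<Rightarrow> 'v \<Rightarrow> real" where
  "vdist V x y = vnorm V (vadd V x (vscale V (- 1) y))"

definition series_sums :: "'v nspace \<Rightarrow> (nat \<Rightarrow> real) \<Rightarrow> (nat \<Rightarrow> 'v) \<Rightarrow> 'v \<Rightarrow> bool" where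
  "series_sums V a x y \<longleftrightarrow> y \<in> points V \<and> (\<lambda>n. vdist V (partial_sum V a x n) y) \<longlonglongrightarrow> 0"

definition series_converges :: "'v nspace \<Rightarrow> (nat \<Rightarrow> real) \<Rightarrow> (nat \<Rightarrow> 'v) \<Rightarrow> bool" where
  "series_converges V a x \<longleftrightarrow> (\<exists>y. series_sums V a x y)"

definition closed_span :: "'v nspace \<Rightarrow> (nat \<Rightarrow> 'v) \<Rightarrow> 'v set" where
  "closed_span V x = {y \<in> points V. \<forall>e>0. \<exists>a n. vdist V (partial_sum V a x n) y < e}"

definition schauder_basis :: "'v nspace \<Rightarrow> (nat \<Rightarrow> 'v) \<Rightarrow> bool" where
  "schauder_basis V x \<longleftrightarrow> range x \<subseteq> points V \<and> (\<forall>y\<in>points V. \<exists>!a. series_sums V a x y)"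

definition basic_sequence :: "'v nspace \<Rightarrow> (nat \<Rightarrow> 'v) \<Rightarrow> bool" where
  "basic_sequence V x \<longleftrightarrow> range x \<subseteq> points V \<and> schauder_basis (V\<lparr>points := closed_span V x\<rparr>) x"

definition unconditional :: "'v nspace \<Rightarrow> (nat \<Rightarrow> 'v) \<Rightarrow> bool" where
  "unconditional V x \<longleftrightarrow>
     (\<forall>a. series_converges V a x \<longrightarrow> (\<forall>\<pi>. bij \<pi> \<longrightarrow> series_converges V (a \<circ> \<pi>) (x \<circ> \<pi>)))"

definition equivalent_sequences :: "'v nspace \<Rightarrow> (nat \<Rightarrow> 'v) \<Rightarrow> (nat \<Rightarrow> 'v) \<Rightarrow> bool" where
  "equivalent_sequences V x y \<longleftrightarrow> (\<forall>a. series_converges V a x \<longleftrightarrow> series_converges V a y)"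

definition subsymmetric :: "'v nspace \<Rightarrow> (nat \<Rightarrow> 'v) \<Rightarrow> bool" where
  "subsymmetric V x \<longleftrightarrow> basic_sequence V x \<and> unconditional V x \<and>
     (\<forall>r. strict_mono r \<longrightarrow> equivalent_sequences V x (x \<circ> r))"

definition fundamental_function :: "'v nspace \<Rightarrow> (nat \<Rightarrow> 'v) \<Rightarrow> nat \<Rightarrow> real" where
  "fundamental_function V u n = vnorm V (partial_sum V (\<lambda>_. 1) u n)"

definition equivalent_fundamental :: "(nat \<Rightarrow> real) \<Rightarrow> (nat \<Rightarrow> real) \<Rightarrow> bool" where
  "equivalent_fundamental \<Phi> \<Psi> \<longleftrightarrow> (\<exists>K>0. \<forall>n. inverse K * \<Phi> n \<le> \<Psi> n \<and> \<Psi> n \<le> K * \<Phi> n)"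

lemma full_space_simps [simp]:
  "points full_space = UNIV" "vzero full_space = 0" "vadd full_space = (+)"
  "vscale full_space = (*\<^sub>R)" "vnorm full_space = norm"
  by (simp_all add: full_space_def)

lemma partial_sum_full_space: "partial_sum full_space a x n = (\<Sum>i<n. a i *\<^sub>R x i)"
  by (induction n) simp_all

lemma series_sums_full_space: "series_sums full_space a x y \<longleftrightarrow> (\<lambda>n. a n *\<^sub>R x n) sums y"
proof -
  have "(\<lambda>n. norm ((\<Sum>i<n. a i *\<^sub>R x i) - y)) \<longlonglongrightarrow> 0 \<longleftrightarrow> (\<lambda>n. \<Sum>i<n. a i *\<^sub>R x i) \<longlonglongrightarrow> y"
    by (simp add: tendsto_norm_zero_iff LIM_zero_iff)
  then show ?thesis by (simp add: series_sums_def sums_def vdist_def partial_sum_full_space)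
qed

lemma series_converges_full_space:
  "series_converges full_space a x \<longleftrightarrow> summable (\<lambda>n. a n *\<^sub>R x n)"
  by (simp add: series_converges_def series_sums_full_space summable_def)

lemma fundamental_function_full_space: "fundamental_function full_space u n = norm (\<Sum>i<n. u i)"
  by (simp add: fundamental_function_def partial_sum_full_space)

lemma closed_span_full_space: "closed_span full_space x = closure (span (range x))"
proof -
  have "span (range x) = {\<Sum>i<n. a i *\<^sub>R x i |a n. True}" (is "_ = ?S")
  proof
    have "(\<Sum>i<n. a i *\<^sub>R x i) \<in> span (range x)" for a n
      by (intro span_sum span_scale span_base rangeI)
    then show "?S \<subseteq> span (range x)" by blast
    show "span (range x) \<subseteq> ?S"
    proof
      fix y assume "y \<in> span (range x)"
      then show "y \<in> ?S"
      proof (induction rule: span_induct_alt)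
        case base
        show ?case by (auto intro!: exI[of _ 0] simp: lessThan_empty_iff)
      next
        case (step c z y)
        then obtain k a n where z: "z = x k" and y: "y = (\<Sum>i<n. a i *\<^sub>R x i)" by auto
        define m where "m = max n (Suc k)"
        define b where "b i = (if i = k then c else 0) + (if i < n then a i else 0)" for i
        have "(\<Sum>i<m. b i *\<^sub>R x i)
            = (\<Sum>i<m. if i = k then c *\<^sub>R x i else 0) + (\<Sum>i<m. if i < n then a i *\<^sub>R x i else 0)"
          unfolding sum.distrib[symmetric] by (rule sum.cong) (auto simp: b_def scaleR_add_left)
        also have "(\<Sum>i<m. if i = k then c *\<^sub>R x i else 0) = c *\<^sub>R z" by (simp add: m_def z less_max_iff_disj)
        also have "(\<Sum>i<m. if i < n then a i *\<^sub>R x i else 0) = y"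
          unfolding y by (rule sum.mono_neutral_cong_right) (auto simp: m_def)
        finally show ?case by (metis (mono_tags, lifting) mem_Collect_eq)
      qed
    qed
  qed
  note span = this
  show ?thesis
    unfolding span by (fastforce simp: closed_span_def vdist_def partial_sum_full_space closure_approachable dist_norm)
qed

lemma coset_self: "subspace M \<Longrightarrow> coset M 0 = M"
  by (simp add: coset_def)

lemma quotient_space_vadd:
  assumes "subspace M"
  shows "vadd (quotient_space M) (coset M x) (coset M y) = coset M (x + y)"
proof (intro equalityI subsetI)
  fix z assume "z \<in> vadd (quotient_space M) (coset M x) (coset M y)"
  then obtain m n where "m \<in> M" "n \<in> M" "z = (x + m) + (y + n)"
    by (auto simp: quotient_space_def coset_def)
  then show "z \<in> coset M (x + y)"
    using subspace_add[OF assms] by (auto simp: coset_def algebra_simps intro!: image_eqI[of _ _ "m + n"])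
next
  fix z assume "z \<in> coset M (x + y)"
  then obtain m where m: "m \<in> M" "z = (x + m) + (y + 0)" by (auto simp: coset_def algebra_simps)
  then have "x + m \<in> coset M x" "y + 0 \<in> coset M y"
    using subspace_0[OF assms] by (auto simp: coset_def)
  with m(2) show "z \<in> vadd (quotient_space M) (coset M x) (coset M y)"
    by (simp add: quotient_space_def, blast)
qed

lemma quotient_space_vscale:
  assumes "subspace M"
  shows "vscale (quotient_space M) r (coset M x) = coset M (r *\<^sub>R x)"
proof (intro equalityI subsetI)
  fix z assume "z \<in> vscale (quotient_space M) r (coset M x)"
  then obtain m n where "m \<in> M" "n \<in> M" "z = r *\<^sub>R (x + m) + n"
    by (auto simp: quotient_space_def coset_def)
  then show "z \<in> coset M (r *\<^sub>R x)"
    using subspace_add[OF assms] subspace_scale[OF assms]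
    by (auto simp: coset_def algebra_simps intro!: image_eqI[of _ _ "r *\<^sub>R m + n"])
next
  fix z assume "z \<in> coset M (r *\<^sub>R x)"
  then obtain m where m: "m \<in> M" "z = r *\<^sub>R (x + 0) + m" by (auto simp: coset_def)
  then have "x + 0 \<in> coset M x" using subspace_0[OF assms] by (auto simp: coset_def)
  with m show "z \<in> vscale (quotient_space M) r (coset M x)"
    by (simp add: quotient_space_def, blast)
qed

lemma quotient_space_vnorm: "vnorm (quotient_space M) (coset M x) = (INF m\<in>M. norm (x + m))"
  by (simp add: quotient_space_def coset_def image_image)

end

theory Submission
  imports Defs
begin

text \<open>Both halves come from one family of functionals. For a vector \<open>y\<close> of \<open>T\<close>-norm at most \<open>1\<close>, placing
the entries of \<open>y\<close> at any increasing sequence of coordinates gives a functional of norm at most \<open>1\<close> on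
\<open>Su(T\<^sup>*)\<close>, because the norm of \<open>Su(T\<^sup>*)\<close> is a supremum of \<open>T\<^sup>*\<close>-norms over subsequences
(\<open>su_pairing_le\<close>). Let \<open>\<phi>(n)\<close> be the norm of \<open>t\<^sub>1\<^sup>* + \<dots> + t\<^sub>n\<^sup>*\<close>, and let \<open>y\<close> be a vector in the
unit ball of \<open>T\<close> the sum of whose first \<open>n\<close> coordinates is at least \<open>\<phi>(n)/2\<close>. How \<open>m\<close> disjoint
copies of these \<open>n\<close> entries add up in \<open>Su(T\<^sup>*)\<^sup>*\<close> depends on the size of \<open>m\<close>:

\<^item> For \<open>m \<le> n\<close> the sum of the copies has norm at least a constant times \<open>m\<close>, as in \<open>\<ell>\<^sub>1\<close>. The reason is
  that \<open>n\<close> successive intervals beyond the first \<open>n\<close> coordinates are admissible, so that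
  \<open>\<phi>(n\<^sup>2) \<le> 3 \<phi>(n)\<close> (\<open>flat_norm_square\<close>) and a constant vector on the copies tests the sum.
\<^item> For fixed \<open>n\<close> and \<open>m \<rightarrow> \<infinity>\<close> the norm is \<open>o(m)\<close>. The reason is that \<open>T\<close> contains convex
  combinations of unit vectors of arbitrarily small norm (\<open>small_convex_combs_exist\<close>), so that a vector in the
  unit ball of \<open>Su(T\<^sup>*)\<close> has boundedly many coordinates of modulus at least a given \<open>\<epsilon>\<close>
  (\<open>few_large_coords\<close>).

Take a unit vector \<open>y\<^sub>0\<close> and choose such vectors \<open>y\<^sub>1, y\<^sub>2, \<dots>\<close> on intervals whose lengths \<open>n\<^sub>s\<close> grow fast enough, and weights
\<open>\<alpha>\<^sub>s = (1/2)^(s s)\<close>. For a set \<open>A\<close> of indices, the functional \<open>u\<^sub>j\<close> is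
\<open>\<Sum> \<alpha>\<^sub>s y\<^sub>s\<close> over \<open>s \<le> j\<close> in \<open>A \<union> {0}\<close>, written into the \<open>j\<close>-th of successive
blocks of coordinates. At \<open>m = n\<^sub>s\<close> with \<open>s > 0\<close> the earlier summands contribute little to the norm of the sum of \<open>m\<close>
of these functionals, and the later ones little because their weights are tiny. So this norm is of order
\<open>\<alpha>\<^sub>s m\<close> if \<open>s \<in> A\<close> and of smaller order if \<open>s \<notin> A\<close>. Sets \<open>A\<close> and \<open>B\<close> with \<open>A - B\<close> infinite
therefore give non-equivalent fundamental functions, and an almost disjoint family of \<open>2\<^sup>\<aleph>\<^sup>0\<close> sets is a
continuum of such \<open>A\<close>.

The sequence \<open>(u\<^sub>j)\<close> is subsymmetric because \<open>u\<^sub>j\<close> has the same entries as an initial part of \<open>u\<^sub>k\<close>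
for \<open>j < k\<close>, and the remaining entries of \<open>u\<^sub>k\<close> have norm at most \<open>2\<^sup>-\<^sup>j\<close>, which is summable.

For the quotients, let \<open>M\<close> be the common kernel of the \<open>u\<^sub>j\<close>. The unit vectors at the beginnings of the blocks
are biorthogonal to \<open>(u\<^sub>j)\<close>, and their cosets form the basis of \<open>Su(T\<^sup>*)/M\<close>. Unconditionality and
subsymmetry of \<open>(u\<^sub>j)\<close> and of these cosets both follow from the same operations on vectors of
\<open>c\<^sub>0\<^sub>0\<close>, which change the values of all \<open>u\<^sub>j\<close> in a prescribed way and control the norm. The two
fundamental functions also obey dual estimates from the same test vectors and functionals.\<close>

section \<open>The norm of the Tsirelson space\<close>

abbreviation T_norm :: "c00 \<Rightarrow> real" where
  "T_norm \<equiv> tsirelson_norm"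

definition finite_vec :: "nat set \<Rightarrow> (nat \<Rightarrow> real) \<Rightarrow> c00" where
  "finite_vec A f = (\<Sum>n\<in>A. f n *\<^sub>R unit_vec n)"

lemma coord_finite_vec:
  assumes "finite A"
  shows "coord (finite_vec A f) n = (if n \<in> A then f n else 0)"
proof -
  have "coord (finite_vec A f) n = (\<Sum>m\<in>A. if m = n then f m else 0)"
    unfolding finite_vec_def coord_sum by (rule sum.cong) auto
  then show ?thesis using assms by simp
qed

lemma supp_finite_vec: "finite A \<Longrightarrow> supp (finite_vec A f) \<subseteq> A"
  by (auto simp: supp_def coord_finite_vec)

lemma T_norm_props:
  "T_norm (x + y) \<le> T_norm x + T_norm y" "T_norm (r *\<^sub>R x) = \<bar>r\<bar> * T_norm x"
  "T_norm 0 = 0" "0 \<le> T_norm x"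
  using is_norm_tsirelson is_norm_nonneg[OF is_norm_tsirelson] by (auto simp: is_norm_def)

lemma admissible_sum_le_T_norm:
  assumes "admissible k E"
  shows "(\<Sum>j<k. T_norm (proj (E j) x)) \<le> 2 * T_norm x"
proof -
  have "(\<Sum>j<k. T_norm (proj (E j) x)) \<le> Sup (admissible_sums T_norm x)"
    using assms is_norm_le_weight_norm[OF is_norm_tsirelson] is_norm_nonneg[OF is_norm_tsirelson]
    by (intro cSup_upper admissible_sums_bdd[of "\<lambda>n. T_norm (unit_vec n)"])
      (auto simp: admissible_sums_def)
  then show ?thesis using tsirelson_norm_eq[of x] by linarith
qed

lemma T_norm_le:
  assumes "\<And>n. \<bar>coord x n\<bar> \<le> c"
    and "\<And>k E. admissible k E \<Longrightarrow> (\<Sum>j<k. T_norm (proj (E j) x)) \<le> 2 * c"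
  shows "T_norm x \<le> c"
proof -
  have "Sup (admissible_sums T_norm x) \<le> 2 * c" by (rule Sup_admissible_sums_le) (rule assms(2))
  moreover have "sup_coord x \<le> c" by (rule sup_coord_le) (rule assms(1))
  ultimately show ?thesis using tsirelson_norm_eq[of x] by linarith
qed

lemma admissible_image:
  assumes p: "strict_mono (p :: nat \<Rightarrow> nat)" and E: "admissible k E"
  shows "admissible k (\<lambda>j. p ` E j)"
proof -
  have m: "mono p" using p by (rule strict_mono_mono)
  have fin: "finite (E j)" "E j \<noteq> {}" if "j < k" for j using E that by (auto simp: admissible_def)
  have Mx: "Max (p ` E j) = p (Max (E j))" "Min (p ` E j) = p (Min (E j))" if "j < k" for j
    using mono_Max_commute[OF m fin[OF that]] mono_Min_commute[OF m fin[OF that]] by auto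
  have k: "k \<ge> 1" "k \<le> Suc (Min (E 0))" and s: "\<And>j. Suc j < k \<Longrightarrow> Max (E j) < Min (E (Suc j))"
    using E by (auto simp: admissible_def)
  have "Min (E 0) \<le> p (Min (E 0))" using p by (rule strict_mono_imp_increasing)
  then have "k \<le> Suc (Min (p ` E 0))" using k Mx(2)[of 0] by simp
  moreover have "Max (p ` E j) < Min (p ` E (Suc j))" if "Suc j < k" for j
    using that s[OF that] p by (simp add: Mx strict_mono_less)
  ultimately show ?thesis using k fin by (simp add: admissible_def)
qed

text \<open>The single comparison principle for the Tsirelson norm: shrinking coefficients, deleting coordinates and moving the
support to the left do not increase the norm. An admissible family for the compressed vector is carried by \<open>p\<close> to
an admissible family for \<open>y\<close>, since \<open>p\<close> does not decrease minima. The induction on the size of the support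
leaves only the case of a set containing the whole support, where the factor \<open>1/2\<close> absorbs \<open>x\<close> itself.\<close>

lemma T_norm_compress:
  assumes p: "strict_mono p" and le: "\<And>i. \<bar>coord x i\<bar> \<le> \<bar>coord y (p i)\<bar>"
  shows "T_norm x \<le> T_norm y"
  using le
proof (induction "card (supp x)" arbitrary: x y rule: less_induct)
  case less
  \<comment> \<open>The bound involves \<open>x\<close> itself, halved; it implies the claim since norms are nonnegative.\<close>
  have "T_norm x \<le> max (T_norm y) (T_norm x / 2)"
  proof (rule T_norm_le)
    fix n show "\<bar>coord x n\<bar> \<le> max (T_norm y) (T_norm x / 2)"
      using less.prems[of n] abs_coord_le_tsirelson_norm[of y "p n"] by linarith
  next
    fix k E assume E: "admissible k E"
    show "(\<Sum>j<k. T_norm (proj (E j) x)) \<le> 2 * max (T_norm y) (T_norm x / 2)"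
    proof (cases "\<exists>i<k. supp x \<subseteq> E i")
      case True
      then obtain i where i: "i < k" "supp x \<subseteq> E i" by blast
      have "T_norm (proj (E j) x) = (if j = i then T_norm x else 0)" if "j < k" for j
      proof (cases "j = i")
        case True
        then have "proj (E j) x = x" using i by (intro c00_eqI) (auto simp: supp_def)
        then show ?thesis using True by simp
      next
        case False
        then have "proj (E j) x = 0"
          using i admissible_disjoint[OF E that i(1)] by (intro c00_eqI) (auto simp: supp_def)
        then show ?thesis using False T_norm_props(3) by simp
      qed
      then have "(\<Sum>j<k. T_norm (proj (E j) x)) = T_norm x" using i(1) by simp
      then show ?thesis by simp
    next
      case False
      have "T_norm (proj (E j) x) \<le> T_norm (proj (p ` E j) y)" if "j < k" for j
      proof (rule less.hyps)
        show "card (supp (proj (E j) x)) < card (supp x)"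
          using False that by (intro psubset_card_mono finite_supp) (auto simp: supp_proj)
      qed (use less.prems in auto)
      then have "(\<Sum>j<k. T_norm (proj (E j) x)) \<le> (\<Sum>j<k. T_norm (proj (p ` E j) y))"
        by (intro sum_mono) auto
      also have "\<dots> \<le> 2 * T_norm y"
        by (rule admissible_sum_le_T_norm[OF admissible_image[OF p E]])
      finally show ?thesis by simp
    qed
  qed
  then show ?case using T_norm_props(4)[of y] by linarith
qed

lemma T_norm_mono: "(\<And>i. \<bar>coord x i\<bar> \<le> \<bar>coord y i\<bar>) \<Longrightarrow> T_norm x \<le> T_norm y"
  by (rule T_norm_compress[of id]) (auto simp: strict_mono_def)

lemma T_norm_proj_le: "T_norm (proj E x) \<le> T_norm x"
  by (rule T_norm_mono) simp

lemma T_norm_unit_vec: "T_norm (unit_vec n) = 1"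
proof (rule antisym)
  let ?u = "unit_vec n"
  have "T_norm ?u \<le> max 1 (T_norm ?u / 2)"
  proof (rule T_norm_le)
    show "\<bar>coord ?u m\<bar> \<le> max 1 (T_norm ?u / 2)" for m by (simp add: le_max_iff_disj)
  next
    fix k E assume E: "admissible k E"
    have single: "T_norm (proj (E j) ?u) = (if n \<in> E j then T_norm ?u else 0)" for j
    proof -
      have "proj (E j) ?u = (if n \<in> E j then ?u else 0)"
        by (rule c00_eqI) auto
      then show ?thesis using T_norm_props(3) by simp
    qed
    have "(\<Sum>j<k. T_norm (proj (E j) ?u)) \<le> T_norm ?u"
    proof (cases "\<exists>i<k. n \<in> E i")
      case True
      then obtain i where i: "i < k" "n \<in> E i" by blast
      have "T_norm (proj (E j) ?u) = (if j = i then T_norm ?u else 0)" if "j < k" for j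
        using i that admissible_disjoint[OF E that i(1)] by (auto simp: single)
      then show ?thesis using i(1) by simp
    next
      case False
      then show ?thesis using T_norm_props(4) by (simp add: single)
    qed
    then show "(\<Sum>j<k. T_norm (proj (E j) ?u)) \<le> 2 * max 1 (T_norm ?u / 2)" by simp
  qed
  then show "T_norm ?u \<le> 1" using T_norm_props(4)[of ?u] by linarith
  show "1 \<le> T_norm ?u" using abs_coord_le_tsirelson_norm[of ?u n] by simp
qed

lemma T_norm_sum: "T_norm (sum f A) \<le> (\<Sum>a\<in>A. T_norm (f a))"
  by (rule is_norm_sum[OF is_norm_tsirelson])

section \<open>Convex combinations of small norm in the Tsirelson space\<close>

text \<open>If the set \<open>E\<^sub>i\<close> meets \<open>y\<^sub>j\<close> then a later set cannot meet an earlier vector. Hence \<open>i + j\<close>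
determines an incident pair, and there are at most \<open>k + R\<close> of them instead of \<open>k R\<close>.\<close>

lemma incidence_sum_le:
  assumes E: "admissible k E" and c: "0 \<le> c"
    and supp: "\<And>j. j < R \<Longrightarrow> supp (y j) \<subseteq> {l j..<l (Suc j)}"
    and mono: "mono l"
    and norm: "\<And>j. j < R \<Longrightarrow> T_norm (y j) \<le> c"
  shows "(\<Sum>i<k. \<Sum>j<R. T_norm (proj (E i) (y j))) \<le> real (k + R) * c"
proof -
  let ?I = "{(i, j). i < k \<and> j < R \<and> E i \<inter> supp (y j) \<noteq> {}}"
  have fin: "finite ?I" by (rule finite_subset[of _ "{..<k} \<times> {..<R}"]) auto
  have before: False
    if "(i, j) \<in> ?I" "(i', j') \<in> ?I" "i < i'" "j' < j" for i i' j j'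
  proof -
    obtain a b where a: "a \<in> E i" "a \<in> supp (y j)" and b: "b \<in> E i'" "b \<in> supp (y j')"
      using \<open>(i, j) \<in> ?I\<close> \<open>(i', j') \<in> ?I\<close> by blast
    have "Max (E i) < Min (E i')" using \<open>i < i'\<close> \<open>(i', j') \<in> ?I\<close> by (intro admissible_increasing[OF E]) auto
    moreover have "finite (E i)" "finite (E i')" using E that(1,2) by (auto simp: admissible_def)
    ultimately have "a < b" using a(1) b(1) Max_ge Min_le by (meson le_less_trans less_le_trans)
    moreover have "l (Suc j') \<le> l j" using mono \<open>j' < j\<close> by (simp add: monoD)
    moreover have "b < l (Suc j')" "l j \<le> a"
      using supp[of j] supp[of j'] a b that(1,2) by auto
    ultimately show False by simp
  qed
  have "inj_on (\<lambda>(i, j). i + j) ?I"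
  proof (rule inj_onI, clarify)
    fix i j i' j' assume s: "i + j = i' + j'"
      and I: "i < k" "j < R" "i' < k" "j' < R" "E i \<inter> supp (y j) \<noteq> {}" "E i' \<inter> supp (y j') \<noteq> {}"
    have "\<not> i < i'" using before[of i j i' j'] s I by auto
    moreover have "\<not> i' < i" using before[of i' j' i j] s I by auto
    ultimately show "i = i' \<and> j = j'" using s by simp
  qed
  moreover have "(\<lambda>(i, j). i + j) ` ?I \<subseteq> {..<k + R}" by auto
  ultimately have card: "card ?I \<le> k + R" using card_inj_on_le[of _ ?I "{..<k + R}"] by simp
  have "(\<Sum>i<k. \<Sum>j<R. T_norm (proj (E i) (y j)))
      = (\<Sum>(i, j)\<in>{..<k} \<times> {..<R}. T_norm (proj (E i) (y j)))"
    by (simp add: sum.cartesian_product)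
  also have "\<dots> = (\<Sum>(i, j)\<in>?I. T_norm (proj (E i) (y j)))"
  proof (rule sum.mono_neutral_right)
    show "\<forall>z\<in>{..<k} \<times> {..<R} - ?I. (case z of (i, j) \<Rightarrow> T_norm (proj (E i) (y j))) = 0"
    proof (intro ballI)
      fix z assume z: "z \<in> {..<k} \<times> {..<R} - ?I"
      obtain i j where ij: "z = (i, j)" by (cases z)
      then have "proj (E i) (y j) = 0" using z by (intro c00_eqI) (auto simp: supp_def)
      then show "(case z of (i, j) \<Rightarrow> T_norm (proj (E i) (y j))) = 0" by (simp add: ij T_norm_props(3))
    qed
  qed auto
  also have "\<dots> \<le> (\<Sum>(i, j)\<in>?I. c)"
    by (rule sum_mono) (auto intro: order_trans[OF T_norm_proj_le norm])
  also have "\<dots> = real (card ?I) * c" by (simp add: case_prod_unfold)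
  also have "\<dots> \<le> real (k + R) * c" using card c by (intro mult_right_mono) auto
  finally show ?thesis .
qed

text \<open>The bound \<open>m\<close> of the support occurs as a parameter so that the next combination can be placed behind it.\<close>

definition small_convex_comb :: "real \<Rightarrow> nat \<Rightarrow> nat \<Rightarrow> c00 \<Rightarrow> bool" where
  "small_convex_comb c n m y \<longleftrightarrow> (\<forall>i. 0 \<le> coord y i) \<and> supp y \<subseteq> {n..<m} \<and>
     (\<Sum>i<m. coord y i) = 1 \<and> T_norm y \<le> c"

lemma sum_coord_superset:
  assumes "supp y \<subseteq> {..<m}" "m \<le> m'"
  shows "(\<Sum>i<m'. coord y i) = (\<Sum>i<m. coord y i)"
  using assms by (intro sum.mono_neutral_right) (auto simp: supp_def)

text \<open>Average \<open>y\<^sub>0\<close> with the mean of \<open>R\<close> later combinations, where \<open>R\<close> is large compared with the end \<open>L\<close>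
of the support of \<open>y\<^sub>0\<close>. An admissible family that meets \<open>y\<^sub>0\<close> has at most \<open>L\<close> members, too few to
cut many of the later combinations into pieces. So the mean contributes only about its \<open>\<ell>\<^sub>1\<close>-sum \<open>c\<close>,
and not \<open>2c\<close>, and the factor \<open>1/2\<close> in the norm brings the total down to at most \<open>7/8 c\<close>.\<close>

lemma small_convex_comb_step:
  assumes ex: "\<And>n. \<exists>m y. small_convex_comb c n m y"
  shows "\<exists>m y. small_convex_comb (7 / 8 * c) n m y"
proof -
  obtain f g where fg: "\<And>n. small_convex_comb c n (f n) (g n)" using ex by metis
  have fge: "n < f n" for n
  proof (rule ccontr)
    assume "\<not> n < f n"
    then have "supp (g n) = {}" using fg[of n] by (auto simp: small_convex_comb_def)
    then show False using fg[of n] by (auto simp: small_convex_comb_def supp_def)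
  qed
  have c: "0 \<le> c" using fg[of 0] T_norm_props(4) by (auto simp: small_convex_comb_def intro: order_trans)
  define l where "l j = (f ^^ j) n" for j
  define y where "y j = g (l j)" for j
  have lS: "l (Suc j) = f (l j)" for j by (simp add: l_def)
  have mono: "mono l" using fge by (intro incseq_SucI) (simp add: lS less_imp_le)
  have y: "small_convex_comb c (l j) (l (Suc j)) (y j)" for j unfolding lS y_def by (rule fg)
  have yp: "0 \<le> coord (y j) i" "supp (y j) \<subseteq> {l j..<l (Suc j)}"
    "(\<Sum>i<l (Suc j). coord (y j) i) = 1" "T_norm (y j) \<le> c" for i j
    using y[of j] by (auto simp: small_convex_comb_def)
  define L where "L = l 1"
  \<comment> \<open>With \<open>k \<le> L = R/4\<close> the incidence bound for the later combinations is at most \<open>5/4 R c\<close>.\<close>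
  define R where "R = 4 * L"
  have R: "0 < R" using fge[of n] by (simp add: R_def L_def l_def)
  define x where "x = (1 / 2) *\<^sub>R y 0 + (1 / (2 * real R)) *\<^sub>R (\<Sum>j<R. y (Suc j))"
  have xc: "coord x i = coord (y 0) i / 2 + (\<Sum>j<R. coord (y (Suc j)) i) / (2 * real R)" for i
    by (simp add: x_def)
  have co: "coord (y j) i \<le> c" for i j
    using abs_coord_le_tsirelson_norm[of "y j" i] yp(4)[of j] by simp
  have "T_norm x \<le> 7 / 8 * c"
  proof (rule T_norm_le)
    fix i
    have x0: "0 \<le> coord x i" unfolding xc using yp(1) by (auto intro!: add_nonneg_nonneg divide_nonneg_nonneg sum_nonneg)
    have "coord x i \<le> c / 2"
    proof (cases "i < L")
      case True
      have "coord (y (Suc j)) i = 0" for j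
      proof -
        have "L \<le> l (Suc j)" unfolding L_def using mono by (simp add: monoD)
        then show ?thesis using True yp(2)[of "Suc j"] by (force simp: supp_def)
      qed
      then show ?thesis using co[of 0 i] by (simp add: xc)
    next
      case False
      have "coord (y 0) i = 0" using False yp(2)[of 0] by (force simp: supp_def L_def)
      moreover have "(\<Sum>j<R. coord (y (Suc j)) i) \<le> real R * c"
        using sum_mono[of "{..<R}" "\<lambda>j. coord (y (Suc j)) i" "\<lambda>_. c"] co by simp
      ultimately show ?thesis using R by (simp add: xc field_simps)
    qed
    then show "\<bar>coord x i\<bar> \<le> 7 / 8 * c" using x0 c by simp
  next
    fix k E assume E: "admissible k E"
    have split: "T_norm (proj (E i) x) \<le> T_norm (proj (E i) (y 0)) / 2
        + (\<Sum>j<R. T_norm (proj (E i) (y (Suc j)))) / (2 * real R)" for i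
    proof -
      have "proj (E i) x = (1 / 2) *\<^sub>R proj (E i) (y 0)
          + (1 / (2 * real R)) *\<^sub>R (\<Sum>j<R. proj (E i) (y (Suc j)))"
        by (rule c00_eqI) (auto simp: x_def)
      then have "T_norm (proj (E i) x) \<le> T_norm ((1 / 2) *\<^sub>R proj (E i) (y 0))
          + T_norm ((1 / (2 * real R)) *\<^sub>R (\<Sum>j<R. proj (E i) (y (Suc j))))"
        using T_norm_props(1) by simp
      also have "\<dots> = T_norm (proj (E i) (y 0)) / 2
          + T_norm (\<Sum>j<R. proj (E i) (y (Suc j))) / (2 * real R)"
        by (simp add: T_norm_props(2))
      also have "\<dots> \<le> T_norm (proj (E i) (y 0)) / 2
          + (\<Sum>j<R. T_norm (proj (E i) (y (Suc j)))) / (2 * real R)"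
        using T_norm_sum by (intro add_left_mono divide_right_mono) auto
      finally show ?thesis .
    qed
    have zero: "(\<Sum>i<k. T_norm (proj (E i) (y 0))) \<le> 2 * c"
      using admissible_sum_le_T_norm[OF E, of "y 0"] yp(4)[of 0] by linarith
    show "(\<Sum>i<k. T_norm (proj (E i) x)) \<le> 2 * (7 / 8 * c)"
    proof (cases "Min (E 0) < L")
      case True
      have k: "k \<le> L" using E True by (simp add: admissible_def)
      have "(\<Sum>i<k. \<Sum>j<R. T_norm (proj (E i) (y (Suc j)))) \<le> real (k + R) * c"
        by (rule incidence_sum_le[OF E c, where l = "\<lambda>j. l (Suc j)"])
          (use yp mono in \<open>auto simp: mono_def\<close>)
      also have "\<dots> \<le> real (L + R) * c" using k c by (intro mult_right_mono) auto
      also have "\<dots> = 5 / 4 * real R * c" by (simp add: R_def)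
      finally have tail: "(\<Sum>i<k. \<Sum>j<R. T_norm (proj (E i) (y (Suc j)))) / (2 * real R) \<le> 5 / 8 * c"
        using R by (simp add: field_simps)
      have "(\<Sum>i<k. T_norm (proj (E i) x)) \<le> (\<Sum>i<k. T_norm (proj (E i) (y 0))) / 2
          + (\<Sum>i<k. \<Sum>j<R. T_norm (proj (E i) (y (Suc j)))) / (2 * real R)"
        using sum_mono[of "{..<k}", OF split] by (simp add: sum.distrib sum_divide_distrib)
      then show ?thesis using zero tail c by linarith
    next
      case False
      have y0: "T_norm (proj (E i) (y 0)) = 0" if "i < k" for i
      proof -
        have "L \<le> a" if "a \<in> E i" for a
        proof -
          have f: "finite (E i)" "finite (E 0)" "E 0 \<noteq> {}" using E \<open>i < k\<close> by (auto simp: admissible_def)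
          have "Min (E 0) \<le> Min (E i)"
            using admissible_increasing[OF E, of 0 i] \<open>i < k\<close> Min_le[OF f(2) Max_in[OF f(2,3)]] by (cases "i = 0") auto
          then show ?thesis using False Min_le[OF f(1) that] by linarith
        qed
        then have "proj (E i) (y 0) = 0"
          using yp(2)[of 0] by (intro c00_eqI) (force simp: supp_def L_def)
        then show ?thesis by (simp add: T_norm_props(3))
      qed
      have "(\<Sum>i<k. \<Sum>j<R. T_norm (proj (E i) (y (Suc j))))
          = (\<Sum>j<R. \<Sum>i<k. T_norm (proj (E i) (y (Suc j))))" by (rule sum.swap)
      also have "\<dots> \<le> (\<Sum>j<R. 2 * c)"
        by (rule sum_mono, rule order_trans[OF admissible_sum_le_T_norm[OF E]]) (use yp(4) in auto)
      finally have tail: "(\<Sum>i<k. \<Sum>j<R. T_norm (proj (E i) (y (Suc j)))) / (2 * real R) \<le> c"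
        using R by (simp add: field_simps)
      have "(\<Sum>i<k. T_norm (proj (E i) x)) \<le> (\<Sum>i<k. T_norm (proj (E i) (y 0))) / 2
          + (\<Sum>i<k. \<Sum>j<R. T_norm (proj (E i) (y (Suc j)))) / (2 * real R)"
        using sum_mono[of "{..<k}", OF split] by (simp add: sum.distrib sum_divide_distrib)
      moreover have "(\<Sum>i<k. T_norm (proj (E i) (y 0))) = 0" using y0 by simp
      ultimately show ?thesis using tail c by linarith
    qed
  qed
  moreover have "0 \<le> coord x i" for i
    unfolding xc using yp(1) by (auto intro!: add_nonneg_nonneg divide_nonneg_nonneg sum_nonneg)
  moreover have "supp x \<subseteq> {n..<l (Suc R)}"
  proof
    fix i assume "i \<in> supp x"
    have "\<exists>j\<le>R. i \<in> supp (y j)"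
    proof (rule ccontr)
      assume none: "\<not> (\<exists>j\<le>R. i \<in> supp (y j))"
      have "coord (y j) i = 0" if "j \<le> R" for j using none that by (auto simp: supp_def)
      then have "coord x i = 0" by (simp add: xc)
      then show False using \<open>i \<in> supp x\<close> by (simp add: supp_def)
    qed
    then obtain j where "j \<le> R" "i \<in> supp (y j)" by blast
    moreover have "n \<le> l j" "l (Suc j) \<le> l (Suc R)"
      using monoD[OF mono, of 0 j] monoD[OF mono, of "Suc j" "Suc R"] \<open>j \<le> R\<close> by (auto simp: l_def)
    ultimately show "i \<in> {n..<l (Suc R)}" using yp(2)[of j] by force
  qed
  moreover have "(\<Sum>i<l (Suc R). coord x i) = 1"
  proof -
    have s: "(\<Sum>i<l (Suc R). coord (y j) i) = 1" if "j \<le> R" for j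
      using sum_coord_superset[of "y j" "l (Suc j)" "l (Suc R)"] yp(2,3)[of j] monoD[OF mono, of "Suc j" "Suc R"] that
      by force
    have "(\<Sum>i<l (Suc R). coord x i) = (\<Sum>i<l (Suc R). coord (y 0) i) / 2
        + (\<Sum>i<l (Suc R). \<Sum>j<R. coord (y (Suc j)) i) / (2 * real R)"
      by (simp add: xc sum.distrib sum_divide_distrib)
    also have "(\<Sum>i<l (Suc R). \<Sum>j<R. coord (y (Suc j)) i) = (\<Sum>j<R. \<Sum>i<l (Suc R). coord (y (Suc j)) i)"
      by (rule sum.swap)
    also have "\<dots> = real R" using s by simp
    finally show ?thesis using s[of 0] R by simp
  qed
  ultimately have "small_convex_comb (7 / 8 * c) n (l (Suc R)) x"
    by (simp add: small_convex_comb_def)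
  then show ?thesis by blast
qed

lemma small_convex_combs_exist:
  assumes "0 < e"
  obtains m y where "small_convex_comb e n m y"
proof -
  have "\<exists>m y. small_convex_comb ((7 / 8) ^ r) n m y" for r n
  proof (induction r arbitrary: n)
    case 0
    have "small_convex_comb 1 n (Suc n) (unit_vec n)"
      by (auto simp: small_convex_comb_def supp_def T_norm_unit_vec)
    then show ?case by auto
  next
    case (Suc r)
    from small_convex_comb_step[of "(7 / 8) ^ r", OF Suc.IH] show ?case by simp
  qed
  moreover obtain r where "(7 / 8 :: real) ^ r < e" using real_arch_pow_inv[OF assms, of "7/8"] by auto
  ultimately obtain r m y where "(7 / 8 :: real) ^ r < e" "small_convex_comb ((7 / 8) ^ r) n m y" by meson
  then have "small_convex_comb e n m y" by (auto simp: small_convex_comb_def)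
  then show ?thesis by (rule that)
qed

section \<open>The norm of the subsymmetrization as a pairing with Tsirelson vectors\<close>

lemma completion_functional_norm_le:
  fixes f :: "'a::real_normed_vector completion \<Rightarrow>\<^sub>L real"
  assumes c: "0 \<le> c" and le: "\<And>a. \<bar>blinfun_apply f (to_completion a)\<bar> \<le> c * norm a"
  shows "norm f \<le> c"
proof (rule norm_blinfun_bound[OF c])
  fix x :: "'a completion"
  obtain z where z: "(\<lambda>k. to_completion (z k)) \<longlonglongrightarrow> x" using completion_approx by blast
  have "(\<lambda>k. norm (blinfun_apply f (to_completion (z k)))) \<longlonglongrightarrow> norm (blinfun_apply f x)"
    "(\<lambda>k. c * norm (to_completion (z k))) \<longlonglongrightarrow> c * norm x"
    by (intro tendsto_intros z)+
  then show "norm (blinfun_apply f x) \<le> c * norm x"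
    using le by (intro LIMSEQ_le) (auto simp: norm_to_completion)
qed

lemma spread_functional_apply:
  assumes r: "strict_mono r" and A: "finite A" "supp y \<subseteq> A"
  shows "blinfun_apply (spread_functional r x) (to_completion (Tsirelson_c00 y))
    = (\<Sum>i\<in>A. coord x (r i) * coord y i)"
proof -
  let ?B = "{i. coord x (r i) \<noteq> 0} \<union> A"
  have B: "finite ?B" using finite_spread[OF r] A by simp
  have "blinfun_apply (spread_functional r x) (to_completion (Tsirelson_c00 y))
      = (\<Sum>i\<in>?B. coord x (r i) * coord y i)"
    by (simp add: spread_functional_superset[OF B] blinfun.sum_left blinfun.scaleR_left t_star_to_completion)
  also have "\<dots> = (\<Sum>i\<in>A. coord x (r i) * coord y i)"
    using A B by (intro sum.mono_neutral_right) (auto simp: supp_def)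
  finally show ?thesis .
qed

text \<open>A pairing along an increasing map on a finite set of indices is one along a subsequence of all of \<open>\<nat>\<close>, as in the
definition of the norm, after the indices in \<open>I\<close> have been compressed: \<open>p\<close> enumerates \<open>I\<close> and then
everything beyond \<open>I\<close>.\<close>

lemma strict_mono_extension:
  fixes g :: "nat \<Rightarrow> nat"
  assumes I: "finite I" and g: "strict_mono_on I g"
  obtains p r :: "nat \<Rightarrow> nat" where "strict_mono p" "strict_mono r" "I \<subseteq> range p" "\<And>k. p k \<in> I \<Longrightarrow> r k = g (p k)"
proof -
  define J where "J = I \<union> {i. \<forall>j\<in>I. j < i}"
  define b where "b = Suc (Max (insert 0 (g ` I)))"
  define h where "h i = (if i \<in> I then g i else b + i)" for i
  have b: "g i < b" if "i \<in> I" for i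
    using I that unfolding b_def by (simp add: less_Suc_eq_le)
  have "{Suc (Max (insert 0 I))..} \<subseteq> J" using I by (auto simp: J_def Suc_le_eq)
  then have inf: "infinite J" using infinite_Ici infinite_super by blast
  have h: "h i < h j" if "i \<in> J" "j \<in> J" "i < j" for i j
  proof (cases "i \<in> I")
    case True
    then show ?thesis
      using that g b[of i] by (auto simp: h_def strict_mono_on_def trans_less_add1)
  next
    case False
    then have "j \<notin> I" using that by (auto simp: J_def)
    then show ?thesis using False that by (simp add: h_def)
  qed
  show ?thesis
  proof (rule that)
    show p: "strict_mono (enumerate J)" by (rule strict_mono_enumerate[OF inf])
    show "strict_mono (h \<circ> enumerate J)"
      using p h enumerate_in_set[OF inf] by (auto simp: strict_mono_def)
    show "I \<subseteq> range (enumerate J)" unfolding range_enumerate[OF inf] by (auto simp: J_def)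
    show "(h \<circ> enumerate J) k = g (enumerate J k)" if "enumerate J k \<in> I" for k
      using that by (simp add: h_def)
  qed
qed

text \<open>Together with \<open>su_norm_leI\<close> this describes the norm of \<open>Su(T\<^sup>*)\<close> without functionals on \<open>T\<close> and without
the restriction to subsequences indexed by all of \<open>\<nat>\<close>. The gaps in \<open>I\<close> are harmless because compressing
\<open>y\<close> does not increase its Tsirelson norm.\<close>

lemma su_pairing_le:
  assumes I: "finite I" and g: "strict_mono_on I g"
  shows "(\<Sum>i\<in>I. \<bar>coord x (g i)\<bar> * \<bar>coord y i\<bar>) \<le> su_norm x * T_norm y"
proof -
  obtain p r :: "nat \<Rightarrow> nat" where p: "strict_mono p" and r: "strict_mono r" and Ip: "I \<subseteq> range p"
    and rp: "\<And>k. p k \<in> I \<Longrightarrow> r k = g (p k)"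
    using strict_mono_extension[OF I g] by blast
  have inj: "inj p" using p by (rule strict_mono_imp_inj_on)
  define K where "K = p -` I"
  have K: "finite K" unfolding K_def by (rule finite_vimageI[OF I inj])
  define y' where "y' = finite_vec K (\<lambda>k. sgn (coord x (r k)) * \<bar>coord y (p k)\<bar>)"
  have y': "coord y' k = (if k \<in> K then sgn (coord x (r k)) * \<bar>coord y (p k)\<bar> else 0)" for k
    unfolding y'_def by (rule coord_finite_vec[OF K])
  have "I = p ` K" using Ip by (auto simp: K_def)
  then have "(\<Sum>i\<in>I. \<bar>coord x (g i)\<bar> * \<bar>coord y i\<bar>) = (\<Sum>k\<in>K. \<bar>coord x (g (p k))\<bar> * \<bar>coord y (p k)\<bar>)"
    using inj by (simp add: sum.reindex inj_on_subset)
  also have "\<dots> = (\<Sum>k\<in>K. coord x (r k) * coord y' k)"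
    by (rule sum.cong) (auto simp: y' rp K_def abs_sgn mult.assoc)
  also have "\<dots> = blinfun_apply (spread_functional r x) (to_completion (Tsirelson_c00 y'))"
    using spread_functional_apply[OF r K, of y' x] supp_finite_vec[OF K] by (simp add: y'_def)
  also have "\<dots> \<le> norm (spread_functional r x) * T_norm y'"
    using norm_blinfun[of "spread_functional r x" "to_completion (Tsirelson_c00 y')"]
    by (simp add: norm_to_completion norm_Tsirelson_c00)
  also have "\<dots> \<le> su_norm x * T_norm y"
  proof (rule mult_mono)
    show "norm (spread_functional r x) \<le> su_norm x" by (rule spread_le_su_norm[OF r])
    show "T_norm y' \<le> T_norm y"
      by (rule T_norm_compress[OF p]) (auto simp: y' abs_mult abs_sgn_eq)
    show "0 \<le> su_norm x" by (rule is_norm_nonneg[OF is_norm_su])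
    show "0 \<le> T_norm y'" by (rule T_norm_props)
  qed
  finally show ?thesis .
qed

lemma su_norm_leI:
  assumes le: "\<And>I g y. finite I \<Longrightarrow> strict_mono_on I g \<Longrightarrow>
    (\<Sum>i\<in>I. \<bar>coord x (g i)\<bar> * \<bar>coord y i\<bar>) \<le> c * T_norm y"
  shows "su_norm x \<le> c"
proof (rule su_norm_le)
  have c: "0 \<le> c" using le[of "{}" id "unit_vec 0"] by (simp add: T_norm_unit_vec)
  fix r :: "nat \<Rightarrow> nat" assume r: "strict_mono r"
  show "norm (spread_functional r x) \<le> c"
  proof (rule completion_functional_norm_le[OF c])
    fix a :: tsirelson_c00
    obtain y where a: "a = Tsirelson_c00 y" by (cases a) auto
    have "\<bar>blinfun_apply (spread_functional r x) (to_completion a)\<bar>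
        = \<bar>\<Sum>i\<in>supp y. coord x (r i) * coord y i\<bar>"
      unfolding a using spread_functional_apply[OF r finite_supp[of y] subset_refl] by simp
    also have "\<dots> \<le> (\<Sum>i\<in>supp y. \<bar>coord x (r i)\<bar> * \<bar>coord y i\<bar>)"
      by (rule order_trans[OF sum_abs]) (simp add: abs_mult)
    also have "\<dots> \<le> c * T_norm y"
      using r by (intro le finite_supp) (auto simp: strict_mono_on_def strict_mono_def)
    finally show "\<bar>blinfun_apply (spread_functional r x) (to_completion a)\<bar> \<le> c * norm a"
      by (simp add: a norm_Tsirelson_c00)
  qed
qed

lemma su_norm_props:
  "su_norm (x + y) \<le> su_norm x + su_norm y" "su_norm (r *\<^sub>R x) = \<bar>r\<bar> * su_norm x"
  "su_norm 0 = 0" "0 \<le> su_norm x"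
  using is_norm_su is_norm_nonneg[OF is_norm_su] by (auto simp: is_norm_def)

lemma abs_coord_le_su_norm: "\<bar>coord x n\<bar> \<le> su_norm x"
proof -
  have "strict_mono_on {0 :: nat} (\<lambda>_. n)" by (auto simp: strict_mono_on_def)
  from su_pairing_le[OF _ this, of x "unit_vec 0"] show ?thesis by (simp add: T_norm_unit_vec)
qed

text \<open>The unit vector basis is \<open>1\<close>-unconditional and isometrically equivalent to its subsequences: coordinates may be
shrunk, deleted, and moved in either direction as long as their order is kept.\<close>

lemma su_norm_transport:
  assumes q: "strict_mono_on (supp x') q"
    and le: "\<And>i. i \<in> supp x' \<Longrightarrow> \<bar>coord x' i\<bar> \<le> \<bar>coord x (q i)\<bar>"
  shows "su_norm x' \<le> su_norm x"
proof (rule su_norm_leI)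
  fix I :: "nat set" and g :: "nat \<Rightarrow> nat" and y
  assume I: "finite I" and g: "strict_mono_on I g"
  let ?J = "{i \<in> I. g i \<in> supp x'}"
  have "(\<Sum>i\<in>I. \<bar>coord x' (g i)\<bar> * \<bar>coord y i\<bar>) = (\<Sum>i\<in>?J. \<bar>coord x' (g i)\<bar> * \<bar>coord y i\<bar>)"
    using I by (intro sum.mono_neutral_right) (auto simp: supp_def)
  also have "\<dots> \<le> (\<Sum>i\<in>?J. \<bar>coord x ((q \<circ> g) i)\<bar> * \<bar>coord y i\<bar>)"
    by (intro sum_mono mult_right_mono) (auto simp: le)
  also have "\<dots> \<le> su_norm x * T_norm y"
  proof (rule su_pairing_le)
    show "strict_mono_on ?J (q \<circ> g)" using q g by (auto simp: strict_mono_on_def)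
  qed (use I in simp)
  finally show "(\<Sum>i\<in>I. \<bar>coord x' (g i)\<bar> * \<bar>coord y i\<bar>) \<le> su_norm x * T_norm y" .
qed

lemma su_norm_mono: "(\<And>i. \<bar>coord x i\<bar> \<le> \<bar>coord y i\<bar>) \<Longrightarrow> su_norm x \<le> su_norm y"
  by (rule su_norm_transport[of _ id]) (auto simp: strict_mono_on_def)

lemma su_norm_unit_vec_le: "su_norm (unit_vec n) \<le> 1"
proof (rule su_norm_leI)
  fix I :: "nat set" and g :: "nat \<Rightarrow> nat" and y
  assume I: "finite I" and g: "strict_mono_on I g"
  show "(\<Sum>i\<in>I. \<bar>coord (unit_vec n) (g i)\<bar> * \<bar>coord y i\<bar>) \<le> 1 * T_norm y"
  proof (cases "\<exists>i\<in>I. g i = n")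
    case True
    then obtain k where k: "k \<in> I" "g k = n" by blast
    have "(\<Sum>i\<in>I. \<bar>coord (unit_vec n) (g i)\<bar> * \<bar>coord y i\<bar>) = (\<Sum>i\<in>I. if i = k then \<bar>coord y i\<bar> else 0)"
    proof (rule sum.cong)
      fix i assume "i \<in> I"
      then have "g i = n \<longleftrightarrow> i = k"
        using inj_on_eq_iff[OF strict_mono_on_imp_inj_on[OF g], of i k] k by simp
      then show "\<bar>coord (unit_vec n) (g i)\<bar> * \<bar>coord y i\<bar> = (if i = k then \<bar>coord y i\<bar> else 0)" by simp
    qed simp
    then show ?thesis using I k(1) abs_coord_le_tsirelson_norm[of y k] by simp
  next
    case False
    then have "(\<Sum>i\<in>I. \<bar>coord (unit_vec n) (g i)\<bar> * \<bar>coord y i\<bar>) = 0" by (intro sum.neutral) simp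
    then show ?thesis by (simp add: T_norm_props)
  qed
qed

section \<open>Sums of unit vectors and of coordinates\<close>

text \<open>This is the norm of \<open>t\<^sub>1\<^sup>* + \<dots> + t\<^sub>n\<^sup>*\<close> in \<open>T\<^sup>*\<close>, by \<open>1\<close>-unconditionality.\<close>

definition flat_norm :: "nat \<Rightarrow> real" where
  "flat_norm n = (SUP y\<in>{y. T_norm y \<le> 1}. \<Sum>i<n. \<bar>coord y i\<bar>)"

lemma flat_norm_bdd: "bdd_above ((\<lambda>y. \<Sum>i<n. \<bar>coord y i\<bar>) ` {y. T_norm y \<le> 1})"
proof (rule bdd_aboveI2)
  fix y assume "y \<in> {y. T_norm y \<le> 1}"
  then have "\<bar>coord y i\<bar> \<le> 1" for i using abs_coord_le_tsirelson_norm[of y i] by simp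
  then show "(\<Sum>i<n. \<bar>coord y i\<bar>) \<le> real n"
    using sum_mono[of "{..<n}" "\<lambda>i. \<bar>coord y i\<bar>" "\<lambda>_. 1"] by simp
qed

lemma sum_abs_coord_le_flat_norm: "(\<Sum>i<n. \<bar>coord y i\<bar>) \<le> flat_norm n * T_norm y"
proof (cases "T_norm y = 0")
  case True
  then have "coord y i = 0" for i using abs_coord_le_tsirelson_norm[of y i] by simp
  then show ?thesis using True by simp
next
  case False
  then have pos: "0 < T_norm y" using T_norm_props(4)[of y] by simp
  let ?y = "inverse (T_norm y) *\<^sub>R y"
  have "T_norm ?y = 1" using pos by (simp add: T_norm_props)
  then have "(\<Sum>i<n. \<bar>coord ?y i\<bar>) \<le> flat_norm n"
    unfolding flat_norm_def by (intro cSUP_upper flat_norm_bdd) simp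
  moreover have "(\<Sum>i<n. \<bar>coord ?y i\<bar>) = inverse (T_norm y) * (\<Sum>i<n. \<bar>coord y i\<bar>)"
    using pos by (simp add: abs_mult sum_distrib_left)
  ultimately have "inverse (T_norm y) * (\<Sum>i<n. \<bar>coord y i\<bar>) \<le> flat_norm n" by simp
  then show ?thesis using pos by (simp only: inverse_eq_divide) (simp add: divide_le_eq)
qed

lemma flat_norm_ge_1: "0 < n \<Longrightarrow> 1 \<le> flat_norm n"
proof -
  assume "0 < n"
  then have "(\<Sum>i<n. \<bar>coord (unit_vec 0) i\<bar>) = 1"
    by (simp add: if_distrib[of abs] cong: if_cong)
  then show ?thesis using sum_abs_coord_le_flat_norm[where n = n and y = "unit_vec 0"] by (simp add: T_norm_unit_vec)
qed

lemma flat_norm_nonneg: "0 \<le> flat_norm n"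
proof -
  have "0 \<le> (\<Sum>i<n. \<bar>coord (unit_vec 0) i\<bar>)" by (rule sum_nonneg) (rule abs_ge_zero)
  also have "\<dots> \<le> flat_norm n * T_norm (unit_vec 0)" by (rule sum_abs_coord_le_flat_norm)
  finally show ?thesis by (simp add: T_norm_unit_vec)
qed

lemma flat_norm_mono: "m \<le> n \<Longrightarrow> flat_norm m \<le> flat_norm n"
  unfolding flat_norm_def
proof (rule cSUP_mono[OF _ flat_norm_bdd])
  show "{y. T_norm y \<le> 1} \<noteq> {}" by (auto intro!: exI[of _ 0] simp: T_norm_props)
  fix y assume "m \<le> n" "y \<in> {y. T_norm y \<le> 1}"
  then show "\<exists>z\<in>{y. T_norm y \<le> 1}. (\<Sum>i<m. \<bar>coord y i\<bar>) \<le> (\<Sum>i<n. \<bar>coord z i\<bar>)"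
    by (intro bexI[of _ y] sum_mono2) auto
qed

text \<open>The \<open>n\<close> intervals of length \<open>n\<close> that follow the first one are admissible, so their contributions add up to at
most twice the norm. On each of them the coordinates can be compressed to the beginning.\<close>

lemma flat_norm_square: "flat_norm (n * n) \<le> 3 * flat_norm n"
proof (cases "n = 0")
  case False
  show ?thesis
    unfolding flat_norm_def[of "n * n"]
  proof (rule cSUP_least)
    show "{y. T_norm y \<le> 1} \<noteq> {}" by (auto intro!: exI[of _ 0] simp: T_norm_props)
    fix y assume y: "y \<in> {y. T_norm y \<le> 1}"
    define E where "E j = {Suc j * n..<Suc (Suc j) * n}" for j
    have fin: "finite (E j)" "E j \<noteq> {}" "Suc j * n \<in> E j" for j
      using False by (auto simp: E_def)
    have "Max (E j) < Min (E (Suc j))" for j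
      using fin by (subst Max_less_iff) (auto simp: E_def)
    moreover have "n \<le> Min (E 0)" using fin by (subst Min_ge_iff) (auto simp: E_def)
    ultimately have E: "admissible n E" using False fin(1,2)
      by (auto simp: admissible_def simp del: Max_less_iff Min_ge_iff Min_gr_iff)
    have block: "(\<Sum>i\<in>E j. \<bar>coord y i\<bar>) \<le> flat_norm n * T_norm (proj (E j) y)" for j
    proof -
      define b where "b = Suc j * n"
      have Eb: "E j = {b..<b + n}" by (auto simp: E_def b_def)
      let ?z = "finite_vec {..<n} (\<lambda>i. coord y (b + i))"
      have z: "coord ?z i = (if i < n then coord y (b + i) else 0)" for i
        by (subst coord_finite_vec) auto
      have "(\<Sum>i\<in>E j. \<bar>coord y i\<bar>) = (\<Sum>i<n. \<bar>coord ?z i\<bar>)"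
        unfolding Eb
        by (rule sum.reindex_bij_witness[of _ "\<lambda>i. b + i" "\<lambda>i. i - b"]) (auto simp: z)
      also have "\<dots> \<le> flat_norm n * T_norm ?z" by (rule sum_abs_coord_le_flat_norm)
      also have "\<dots> \<le> flat_norm n * T_norm (proj (E j) y)"
      proof (rule mult_left_mono)
        show "T_norm ?z \<le> T_norm (proj (E j) y)"
          by (rule T_norm_compress[of "\<lambda>i. b + i"]) (auto simp: strict_mono_def z Eb)
        show "0 \<le> flat_norm n" using flat_norm_ge_1[of n] False by simp
      qed
      finally show ?thesis .
    qed
    have sum: "(\<Sum>i<Suc k * n. \<bar>coord y i\<bar>) = (\<Sum>i<n. \<bar>coord y i\<bar>) + (\<Sum>j<k. \<Sum>i\<in>E j. \<bar>coord y i\<bar>)" for k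
    proof (induction k)
      case (Suc k)
      have "{..<Suc (Suc k) * n} = {..<Suc k * n} \<union> E k" by (auto simp: E_def)
      then have "(\<Sum>i<Suc (Suc k) * n. \<bar>coord y i\<bar>) = (\<Sum>i\<in>{..<Suc k * n} \<union> E k. \<bar>coord y i\<bar>)"
        by (rule arg_cong)
      also have "\<dots> = (\<Sum>i<Suc k * n. \<bar>coord y i\<bar>) + (\<Sum>i\<in>E k. \<bar>coord y i\<bar>)"
        by (rule sum.union_disjoint) (auto simp: E_def)
      finally have "(\<Sum>i<Suc (Suc k) * n. \<bar>coord y i\<bar>)
          = (\<Sum>i<Suc k * n. \<bar>coord y i\<bar>) + (\<Sum>i\<in>E k. \<bar>coord y i\<bar>)" .
      then show ?case using Suc.IH by simp
    qed simp
    have "(\<Sum>i<n * n. \<bar>coord y i\<bar>) \<le> (\<Sum>i<Suc n * n. \<bar>coord y i\<bar>)"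
      by (rule sum_mono2) auto
    also have "\<dots> \<le> flat_norm n * T_norm y + (\<Sum>j<n. flat_norm n * T_norm (proj (E j) y))"
      unfolding sum by (intro add_mono sum_mono block sum_abs_coord_le_flat_norm)
    also have "\<dots> = flat_norm n * (T_norm y + (\<Sum>j<n. T_norm (proj (E j) y)))"
      by (simp add: sum_distrib_left distrib_left)
    also have "\<dots> \<le> flat_norm n * 3"
      using admissible_sum_le_T_norm[OF E, of y] y flat_norm_ge_1[of n] False
      by (intro mult_left_mono) auto
    finally show "(\<Sum>i<n * n. \<bar>coord y i\<bar>) \<le> 3 * flat_norm n" by simp
  qed
qed (use flat_norm_nonneg[of 0] in simp)

lemma finite_set_strict_mono_image:
  fixes J :: "nat set"
  assumes J: "finite J"
  obtains p :: "nat \<Rightarrow> nat" where "strict_mono p" "p ` {..<card J} = J"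
proof -
  obtain r where r: "strict_mono_on {..<card J} r" "\<forall>n<card J. r n \<in> J"
    using finite_enumerate[OF J] by blast
  define b where "b = Suc (Max (insert 0 J))"
  have b: "i < b" if "i \<in> J" for i using J that by (simp add: b_def less_Suc_eq_le)
  define p where "p k = (if k < card J then r k else b + k)" for k
  have "p i < p j" if "i < j" for i j
    using r that b[of "r i"] by (auto simp: p_def strict_mono_on_def trans_less_add1)
  then have "strict_mono p" by (rule strict_monoI)
  moreover have "p ` {..<card J} = J"
  proof (rule card_subset_eq[OF J])
    show "p ` {..<card J} \<subseteq> J" using r(2) by (auto simp: p_def)
    show "card (p ` {..<card J}) = card J"
      using strict_mono_imp_inj_on[OF \<open>strict_mono p\<close>] by (simp add: card_image inj_on_subset)
  qed
  ultimately show ?thesis by (rule that)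
qed

text \<open>Compression shows that the first \<open>card P\<close> coordinates are the worst place for a flat vector.\<close>

lemma su_norm_flat_le:
  assumes P: "finite P" and c: "0 \<le> c"
    and le: "\<And>i. \<bar>coord x i\<bar> \<le> (if i \<in> P then c else 0)"
  shows "su_norm x \<le> c * flat_norm (card P)"
proof (rule su_norm_leI)
  fix I :: "nat set" and g :: "nat \<Rightarrow> nat" and y
  assume I: "finite I" and g: "strict_mono_on I g"
  let ?J = "{i \<in> I. g i \<in> P}"
  have J: "finite ?J" using I by simp
  have inj: "inj_on g ?J" by (rule inj_on_subset[OF strict_mono_on_imp_inj_on[OF g]]) auto
  have "card ?J = card (g ` ?J)" using inj by (simp add: card_image)
  also have "\<dots> \<le> card P" by (rule card_mono[OF P]) auto
  finally have card: "card ?J \<le> card P" .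
  obtain p :: "nat \<Rightarrow> nat" where p: "strict_mono p" and Jp: "p ` {..<card ?J} = ?J"
    using finite_set_strict_mono_image[OF J] by blast
  have injp: "inj_on p {..<card ?J}" using strict_mono_imp_inj_on[OF p] .
  let ?z = "finite_vec {..<card ?J} (\<lambda>k. coord y (p k))"
  have z: "coord ?z i = (if i < card ?J then coord y (p i) else 0)" for i
    by (subst coord_finite_vec) auto
  have "(\<Sum>i\<in>I. \<bar>coord x (g i)\<bar> * \<bar>coord y i\<bar>) = (\<Sum>i\<in>?J. \<bar>coord x (g i)\<bar> * \<bar>coord y i\<bar>)"
    using I le by (intro sum.mono_neutral_right) (fastforce split: if_splits)+
  also have "\<dots> \<le> (\<Sum>i\<in>?J. c * \<bar>coord y i\<bar>)"
  proof (intro sum_mono mult_right_mono)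
    fix i assume "i \<in> ?J"
    then show "\<bar>coord x (g i)\<bar> \<le> c" using le[of "g i"] by simp
  qed simp
  also have "\<dots> = c * (\<Sum>k<card ?J. \<bar>coord ?z k\<bar>)"
  proof -
    have "(\<Sum>i\<in>?J. c * \<bar>coord y i\<bar>) = (\<Sum>i\<in>p ` {..<card ?J}. c * \<bar>coord y i\<bar>)" by (simp only: Jp)
    also have "\<dots> = (\<Sum>k<card ?J. c * \<bar>coord ?z k\<bar>)" by (simp add: sum.reindex[OF injp] z)
    finally show ?thesis by (simp add: sum_distrib_left)
  qed
  also have "\<dots> \<le> c * (flat_norm (card P) * T_norm y)"
  proof (rule mult_left_mono[OF _ c])
    have "(\<Sum>k<card ?J. \<bar>coord ?z k\<bar>) \<le> flat_norm (card ?J) * T_norm ?z"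
      by (rule sum_abs_coord_le_flat_norm)
    also have "\<dots> \<le> flat_norm (card P) * T_norm y"
    proof (rule mult_mono)
      show "T_norm ?z \<le> T_norm y" by (rule T_norm_compress[OF p]) (simp add: z)
      show "flat_norm (card ?J) \<le> flat_norm (card P)" by (rule flat_norm_mono[OF card])
      show "0 \<le> flat_norm (card P)" by (rule flat_norm_nonneg)
    qed (rule T_norm_props)
    finally show "(\<Sum>k<card ?J. \<bar>coord ?z k\<bar>) \<le> flat_norm (card P) * T_norm y" .
  qed
  finally show "(\<Sum>i\<in>I. \<bar>coord x (g i)\<bar> * \<bar>coord y i\<bar>) \<le> c * flat_norm (card P) * T_norm y" by simp
qed

lemma flat_norm_witness:
  assumes "0 < n"
  obtains y where "T_norm y \<le> 1" "flat_norm n / 2 \<le> (\<Sum>i<n. coord y i)"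
proof -
  have "flat_norm n / 2 < flat_norm n" using flat_norm_ge_1[OF assms] by simp
  then obtain z where z: "T_norm z \<le> 1" "flat_norm n / 2 < (\<Sum>i<n. \<bar>coord z i\<bar>)"
  proof -
    have "{y. T_norm y \<le> 1} \<noteq> {}" by (auto intro!: exI[of _ 0] simp: T_norm_props)
    from less_cSUP_iff[OF this flat_norm_bdd, of "flat_norm n / 2" n]
    show ?thesis using that \<open>flat_norm n / 2 < flat_norm n\<close> unfolding flat_norm_def[symmetric] by blast
  qed
  let ?y = "finite_vec {..<n} (\<lambda>i. \<bar>coord z i\<bar>)"
  have y: "coord ?y i = (if i < n then \<bar>coord z i\<bar> else 0)" for i
    by (subst coord_finite_vec) auto
  show ?thesis
  proof (rule that[of ?y])
    show "T_norm ?y \<le> 1" by (rule order_trans[OF T_norm_mono z(1)]) (simp add: y)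
    show "flat_norm n / 2 \<le> (\<Sum>i<n. coord ?y i)" using z(2) by (simp add: y)
  qed
qed

text \<open>Pairing with a convex combination of norm below \<open>\<epsilon>\<close>, spread over the positions in \<open>P\<close>, would give more than
the norm of \<open>x\<close> allows if \<open>P\<close> were longer than that combination.\<close>

lemma few_large_coords:
  assumes e: "0 < e"
  shows "\<exists>k. \<forall>x P. 0 < su_norm x \<longrightarrow> finite P \<longrightarrow> (\<forall>i\<in>P. e * su_norm x \<le> \<bar>coord x i\<bar>) \<longrightarrow> card P \<le> k"
proof -
  obtain m y where "small_convex_comb (e / 2) 0 m y" using small_convex_combs_exist[of "e / 2"] e by auto
  then have y: "\<And>i. 0 \<le> coord y i" "(\<Sum>i<m. coord y i) = 1" "T_norm y \<le> e / 2"
    by (auto simp: small_convex_comb_def)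
  have "card P \<le> m"
    if x: "0 < su_norm x" and P: "finite P" and large: "\<forall>i\<in>P. e * su_norm x \<le> \<bar>coord x i\<bar>" for x P
  proof (rule ccontr)
    assume "\<not> card P \<le> m"
    obtain p :: "nat \<Rightarrow> nat" where p: "strict_mono p" "p ` {..<card P} = P"
      using finite_set_strict_mono_image[OF P] .
    have "p i \<in> P" if "i < m" for i using p(2) that \<open>\<not> card P \<le> m\<close> by auto
    then have "(\<Sum>i<m. (e * su_norm x) * coord y i) \<le> (\<Sum>i<m. \<bar>coord x (p i)\<bar> * \<bar>coord y i\<bar>)"
      using large y(1) by (intro sum_mono) (simp add: mult_right_mono)
    also have "\<dots> \<le> su_norm x * T_norm y"
      by (rule su_pairing_le) (use p in \<open>auto simp: strict_mono_def strict_mono_on_def\<close>)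
    also have "\<dots> \<le> su_norm x * (e / 2)" using x y(3) by (intro mult_left_mono) auto
    finally have "e * su_norm x \<le> su_norm x * (e / 2)" using y(2) by (simp flip: sum_distrib_left)
    then show False using x e by simp
  qed
  then show ?thesis by blast
qed

text \<open>The boundedly many large coordinates are negligible against \<open>M\<close>, and the small ones add up to little.\<close>

lemma coord_sums_small:
  assumes e: "0 < e"
  shows "\<exists>M\<^sub>0. \<forall>M\<ge>M\<^sub>0. \<forall>P x. finite P \<longrightarrow> card P \<le> M * d \<longrightarrow>
    (\<Sum>i\<in>P. \<bar>coord x i\<bar>) \<le> e * real M * su_norm x"
proof -
  \<comment> \<open>At most \<open>M d\<close> coordinates below \<open>e'\<close> times the norm take up at most half of the bound \<open>e M\<close>.\<close>
  define e' where "e' = e / (2 * (real d + 1))"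
  have e': "0 < e'" "e' * real d \<le> e / 2" using e by (auto simp: e'_def field_simps)
  obtain k where k: "\<And>x P. 0 < su_norm x \<Longrightarrow> finite P \<Longrightarrow> (\<forall>i\<in>P. e' * su_norm x \<le> \<bar>coord x i\<bar>) \<Longrightarrow> card P \<le> k"
    using few_large_coords[OF e'(1)] by blast
  obtain M\<^sub>0 :: nat where M\<^sub>0: "2 * real k / e \<le> real M\<^sub>0" using real_arch_simple by blast
  have "(\<Sum>i\<in>P. \<bar>coord x i\<bar>) \<le> e * real M * su_norm x"
    if M: "M\<^sub>0 \<le> M" and P: "finite P" "card P \<le> M * d" for M P x
  proof (cases "su_norm x = 0")
    case True
    then have "coord x i = 0" for i using abs_coord_le_su_norm[of x i] by simp
    then show ?thesis using True by simp
  next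
    case False
    then have pos: "0 < su_norm x" using su_norm_props(4)[of x] by simp
    let ?L = "{i\<in>P. e' * su_norm x \<le> \<bar>coord x i\<bar>}"
    have "(\<Sum>i\<in>P. \<bar>coord x i\<bar>) = (\<Sum>i\<in>?L. \<bar>coord x i\<bar>) + (\<Sum>i\<in>P - ?L. \<bar>coord x i\<bar>)"
      using P(1) by (subst sum.subset_diff[of ?L]) (auto simp: add.commute)
    also have "(\<Sum>i\<in>?L. \<bar>coord x i\<bar>) \<le> real (card ?L) * su_norm x"
      using sum_bounded_above[of ?L "\<lambda>i. \<bar>coord x i\<bar>" "su_norm x"] abs_coord_le_su_norm by simp
    also have "(\<Sum>i\<in>P - ?L. \<bar>coord x i\<bar>) \<le> real (card (P - ?L)) * (e' * su_norm x)"
      by (rule sum_bounded_above) auto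
    finally have "(\<Sum>i\<in>P. \<bar>coord x i\<bar>) \<le> real (card ?L) * su_norm x + real (card (P - ?L)) * (e' * su_norm x)"
      by simp
    also have "\<dots> \<le> (e / 2 * real M) * su_norm x + (e / 2 * real M) * su_norm x"
    proof (rule add_mono)
      have "card ?L \<le> k" by (rule k[OF pos]) (use P(1) in auto)
      then have "real (card ?L) \<le> real k" by simp
      also have "\<dots> \<le> e / 2 * real M\<^sub>0" using M\<^sub>0 e by (simp add: field_simps)
      also have "\<dots> \<le> e / 2 * real M" using M e by simp
      finally show "real (card ?L) * su_norm x \<le> (e / 2 * real M) * su_norm x"
        using pos by (intro mult_right_mono) auto
      have "card (P - ?L) \<le> card P" using P(1) by (intro card_mono) auto
      then have "real (card (P - ?L)) \<le> real (M * d)" using P(2) by linarith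
      then have "real (card (P - ?L)) * e' \<le> real M * (e' * real d)"
        using e'(1) mult_right_mono[of "real (card (P - ?L))" "real (M * d)" e'] by (simp add: mult_ac)
      also have "\<dots> \<le> real M * (e / 2)" using e'(2) by (intro mult_left_mono) auto
      finally have "real (card (P - ?L)) * e' \<le> e / 2 * real M" by (simp add: mult.commute)
      then show "real (card (P - ?L)) * (e' * su_norm x) \<le> (e / 2 * real M) * su_norm x"
        using pos mult_right_mono[of "real (card (P - ?L)) * e'" "e / 2 * real M" "su_norm x"]
        by (simp add: mult.assoc)
    qed
    also have "\<dots> = e * real M * su_norm x" by simp
    finally show ?thesis .
  qed
  then show ?thesis by blast
qed

section \<open>Unconditional and subsymmetric sequences for a complete seminorm\<close>

text \<open>A space with an explicit carrier is handled as the image of an ordinary vector space under a linear map \<open>\<pi>\<close>, its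
norm being a seminorm \<open>q\<close> upstairs. With \<open>\<pi> = id\<close> this is a Banach space, with \<open>\<pi> = coset M\<close> its
quotient by \<open>M\<close>, so that both halves of the theorem share one treatment of basic sequences.\<close>

locale presented_space =
  fixes V :: "'v nspace" and \<pi> :: "'a::real_vector \<Rightarrow> 'v" and q :: "'a \<Rightarrow> real"
  assumes points: "points V = range \<pi>"
    and zero: "vzero V = \<pi> 0"
    and add: "vadd V (\<pi> x) (\<pi> y) = \<pi> (x + y)"
    and scale: "vscale V r (\<pi> x) = \<pi> (r *\<^sub>R x)"
    and norm: "vnorm V (\<pi> x) = q x"
    and q_triangle: "q (x + y) \<le> q x + q y"
    and q_scale: "q (r *\<^sub>R x) = \<bar>r\<bar> * q x"
    and complete: "(\<And>e. 0 < e \<Longrightarrow> \<exists>N. \<forall>m\<ge>N. \<forall>n\<ge>N. q (z m - z n) < e) \<Longrightarrow> \<exists>x. (\<lambda>n. q (z n - x)) \<longlonglongrightarrow> 0"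
begin

lemma q_0: "q 0 = 0"
  using q_scale[of 0 0] by simp

lemma q_minus: "q (- x) = q x"
  using q_scale[of "-1" x] by simp

lemma q_minus_commute: "q (x - y) = q (y - x)"
  using q_minus[of "x - y"] by simp

lemma q_nonneg: "0 \<le> q x"
  using q_triangle[of x "- x"] by (simp add: q_minus q_0)

lemma q_diff: "q (x - z) \<le> q (x - y) + q (y - z)"
  using q_triangle[of "x - y" "y - z"] by simp

lemma q_sum: "q (sum f A) \<le> (\<Sum>i\<in>A. q (f i))"
  by (induction A rule: infinite_finite_induct) (auto simp: q_0 intro: order_trans[OF q_triangle])

abbreviation psum :: "(nat \<Rightarrow> 'a) \<Rightarrow> (nat \<Rightarrow> real) \<Rightarrow> nat \<Rightarrow> 'a" where
  "psum x a n \<equiv> (\<Sum>j<n. a j *\<^sub>R x j)"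

lemma partial_sum_eq: "partial_sum V a (\<pi> \<circ> x) n = \<pi> (psum x a n)"
  by (induction n) (simp_all add: zero add scale)

lemma vdist_eq: "vdist V (\<pi> x) (\<pi> y) = q (x - y)"
  by (simp add: vdist_def scale add norm)

lemma series_sums_iff:
  "series_sums V a (\<pi> \<circ> x) (\<pi> z) \<longleftrightarrow> (\<lambda>n. q (psum x a n - z)) \<longlonglongrightarrow> 0"
  by (simp add: series_sums_def points partial_sum_eq vdist_eq)

lemma psum_diff: "m \<le> n \<Longrightarrow> psum x a n - psum x a m = (\<Sum>j=m..<n. a j *\<^sub>R x j)"
  using sum_diff_nat_ivl[of 0 m n "\<lambda>j. a j *\<^sub>R x j"] by (simp add: atLeast0LessThan)

lemma series_converges_iff:
  "series_converges V a (\<pi> \<circ> x) \<longleftrightarrow>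
    (\<forall>e>0. \<exists>N. \<forall>m n. N \<le> m \<longrightarrow> m \<le> n \<longrightarrow> q (\<Sum>j=m..<n. a j *\<^sub>R x j) < e)" (is "_ \<longleftrightarrow> ?C")
proof
  assume "series_converges V a (\<pi> \<circ> x)"
  then obtain z where z: "(\<lambda>n. q (psum x a n - z)) \<longlonglongrightarrow> 0"
    unfolding series_converges_def using series_sums_iff by (auto simp: series_sums_def points)
  show ?C
  proof (intro allI impI)
    fix e :: real assume "0 < e"
    then have "0 < e / 2" by simp
    from LIMSEQ_D[OF z this] obtain N where N: "\<And>n. N \<le> n \<Longrightarrow> q (psum x a n - z) < e / 2"
      by (auto simp: q_nonneg)
    have "q (\<Sum>j=m..<n. a j *\<^sub>R x j) < e" if "N \<le> m" "m \<le> n" for m n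
      using N[of m] N[of n] q_diff[of "psum x a n" "psum x a m" z] that q_minus_commute[of z "psum x a m"]
      by (simp flip: psum_diff)
    then show "\<exists>N. \<forall>m n. N \<le> m \<longrightarrow> m \<le> n \<longrightarrow> q (\<Sum>j=m..<n. a j *\<^sub>R x j) < e" by blast
  qed
next
  assume C: ?C
  have "\<exists>z. (\<lambda>n. q (psum x a n - z)) \<longlonglongrightarrow> 0"
  proof (rule complete)
    fix e :: real assume "0 < e"
    then obtain N where N: "\<forall>m n. N \<le> m \<longrightarrow> m \<le> n \<longrightarrow> q (\<Sum>j=m..<n. a j *\<^sub>R x j) < e"
      using C by presburger
    then have N: "q (psum x a n - psum x a m) < e" if "N \<le> m" "m \<le> n" for m n
      using that by (simp add: psum_diff)
    have "q (psum x a m - psum x a n) < e" if "N \<le> m" "N \<le> n" for m n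
      using N[of m n] N[of n m] that q_minus_commute[of "psum x a m"] by (cases "m \<le> n") auto
    then show "\<exists>N. \<forall>m\<ge>N. \<forall>n\<ge>N. q (psum x a m - psum x a n) < e" by blast
  qed
  then show "series_converges V a (\<pi> \<circ> x)"
    unfolding series_converges_def using series_sums_iff by blast
qed

lemma series_tail_small:
  assumes "series_converges V a (\<pi> \<circ> x)" "0 < e"
  shows "\<exists>N. \<forall>m n. N \<le> m \<longrightarrow> m \<le> n \<longrightarrow> q (\<Sum>j=m..<n. a j *\<^sub>R x j) < e"
  using assms unfolding series_converges_iff by presburger

end

lemma partial_sum_points: "partial_sum (V\<lparr>points := S\<rparr>) a x n = partial_sum V a x n"
  by (induction n) simp_all

lemma series_sums_points:
  "series_sums (V\<lparr>points := S\<rparr>) a x y \<longleftrightarrow> y \<in> S \<and> (\<lambda>n. vdist V (partial_sum V a x n) y) \<longlonglongrightarrow> 0"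
  by (simp add: series_sums_def partial_sum_points vdist_def)

locale unconditional_sequence = presented_space V \<pi> q
  for V :: "'v nspace" and \<pi> :: "'a::real_vector \<Rightarrow> 'v" and q :: "'a \<Rightarrow> real" +
  fixes x :: "nat \<Rightarrow> 'a" and \<delta> :: real
  assumes uncond: "(\<And>j. j < n \<Longrightarrow> \<bar>a j\<bar> \<le> \<bar>b j\<bar>) \<Longrightarrow> q (\<Sum>j<n. a j *\<^sub>R x j) \<le> q (\<Sum>j<n. b j *\<^sub>R x j)"
    and \<delta>: "0 < \<delta>" and lower: "\<delta> \<le> q (x j)"
begin

lemma q_restrict:
  assumes A: "A \<subseteq> {..<n}"
  shows "q (\<Sum>j\<in>A. a j *\<^sub>R x j) \<le> q (psum x a n)"
proof -
  have "(\<Sum>j\<in>A. a j *\<^sub>R x j) = (\<Sum>j<n. (if j \<in> A then a j else 0) *\<^sub>R x j)"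
    using A by (intro sum.mono_neutral_cong_left) auto
  also have "q \<dots> \<le> q (psum x a n)" by (rule uncond) auto
  finally show ?thesis .
qed

lemma coefficient_le: "k < n \<Longrightarrow> \<bar>a k\<bar> * \<delta> \<le> q (psum x a n)"
proof -
  assume "k < n"
  have "\<bar>a k\<bar> * \<delta> \<le> \<bar>a k\<bar> * q (x k)" by (intro mult_left_mono lower) simp
  also have "\<dots> \<le> q (psum x a n)" using q_restrict[of "{k}" n a] \<open>k < n\<close> by (simp add: q_scale)
  finally show ?thesis .
qed

lemma psum_minus: "psum x (\<lambda>j. a j - b j) n = psum x a n - psum x b n"
  by (simp add: scaleR_diff_left sum_subtractf)

lemma expansion_unique:
  assumes a: "(\<lambda>n. q (psum x a n - z)) \<longlonglongrightarrow> 0" and b: "(\<lambda>n. q (psum x b n - z)) \<longlonglongrightarrow> 0"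
  shows "a = b"
proof
  fix k
  have "\<bar>a k - b k\<bar> * \<delta> \<le> 0"
  proof (rule LIMSEQ_le_const)
    show "(\<lambda>n. q (psum x a n - z) + q (psum x b n - z)) \<longlonglongrightarrow> 0"
      using tendsto_add[OF a b] by simp
    have "\<bar>a k - b k\<bar> * \<delta> \<le> q (psum x a n - z) + q (psum x b n - z)" if "Suc k \<le> n" for n
      using coefficient_le[of k n "\<lambda>j. a j - b j"] that q_diff[of "psum x a n" "psum x b n" z]
        q_minus_commute[of z "psum x b n"] by (simp only: psum_minus) simp
    then show "\<exists>N. \<forall>n\<ge>N. \<bar>a k - b k\<bar> * \<delta> \<le> q (psum x a n - z) + q (psum x b n - z)" by blast
  qed
  then show "a k = b k" using \<delta> by (simp add: mult_le_0_iff)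
qed

text \<open>Coefficients are controlled by \<open>q\<close>, so they converge along approximating combinations. The partial sum
operators are contractive, so the partial sums with the limit coefficients stay close to the approximations,
uniformly in the length.\<close>

lemma expansion_exists:
  assumes approx: "\<And>e. 0 < e \<Longrightarrow> \<exists>a n. q (psum x a n - z) < e"
  shows "\<exists>a. (\<lambda>n. q (psum x a n - z)) \<longlonglongrightarrow> 0"
proof -
  have "\<exists>b n. (\<forall>m\<ge>n. psum x b m = psum x b n) \<and> q (psum x b n - z) < inverse (real (Suc k))" for k
  proof -
    obtain a n where an: "q (psum x a n - z) < inverse (real (Suc k))"
      using approx[of "inverse (real (Suc k))"] by auto
    define b where "b j = (if j < n then a j else 0)" for j
    have "psum x b m = psum x a n" if "n \<le> m" for m
      using that by (intro sum.mono_neutral_cong_right) (auto simp: b_def)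
    then show ?thesis using an by (intro exI[of _ b] exI[of _ n]) simp
  qed
  then obtain b n where stable: "\<And>k m. n k \<le> m \<Longrightarrow> psum x (b k) m = psum x (b k) (n k)"
    and close: "\<And>k. q (psum x (b k) (n k) - z) < inverse (real (Suc k))"
    by metis
  define \<epsilon> where "\<epsilon> k = inverse (real (Suc k))" for k
  have \<epsilon>: "\<epsilon> \<longlonglongrightarrow> 0" unfolding \<epsilon>_def by (rule LIMSEQ_inverse_real_of_nat)
  have diff: "q (psum x (b k) m - psum x (b l) m) \<le> \<epsilon> k + \<epsilon> l" for k l m
  proof -
    define M where "M = max m (max (n k) (n l))"
    have "q (psum x (b k) m - psum x (b l) m) = q (\<Sum>j<m. (b k j - b l j) *\<^sub>R x j)"
      by (simp only: psum_minus)
    also have "\<dots> \<le> q (psum x (\<lambda>j. b k j - b l j) M)" by (rule q_restrict) (auto simp: M_def)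
    also have "\<dots> = q (psum x (b k) (n k) - psum x (b l) (n l))"
      using stable[of k M] stable[of l M] by (simp only: psum_minus) (simp add: M_def)
    also have "\<dots> \<le> \<epsilon> k + \<epsilon> l"
      using q_diff[of "psum x (b k) (n k)" "psum x (b l) (n l)" z] close[of k] close[of l]
        q_minus_commute[of z "psum x (b l) (n l)"] by (simp add: \<epsilon>_def)
    finally show ?thesis .
  qed
  have "Cauchy (\<lambda>k. b k j)" for j
    unfolding Cauchy_iff
  proof (intro allI impI)
    fix e :: real assume "0 < e"
    then have "0 < e * \<delta> / 2" using \<delta> by simp
    from LIMSEQ_D[OF \<epsilon> this] obtain N where N: "\<forall>k\<ge>N. norm (\<epsilon> k - 0) < e * \<delta> / 2" by blast
    have N: "\<epsilon> k < e * \<delta> / 2" if "N \<le> k" for k using N that by force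
    have "norm (b k j - b l j) < e" if "N \<le> k" "N \<le> l" for k l
    proof -
      have "\<bar>b k j - b l j\<bar> * \<delta> \<le> \<epsilon> k + \<epsilon> l"
        using coefficient_le[of j "Suc j" "\<lambda>j. b k j - b l j"] diff[of k "Suc j" l] by (simp only: psum_minus) simp
      also have "\<dots> < e * \<delta>" using N[of k] N[of l] that by simp
      finally show ?thesis using \<delta> by simp
    qed
    then show "\<exists>M. \<forall>m\<ge>M. \<forall>n\<ge>M. norm (b m j - b n j) < e" by blast
  qed
  then have "\<exists>a. (\<lambda>k. b k j) \<longlonglongrightarrow> a" for j by (simp add: Cauchy_convergent_iff convergent_def)
  then obtain a where a: "\<And>j. (\<lambda>k. b k j) \<longlonglongrightarrow> a j" by metis
  have limit: "q (psum x a m - psum x (b k) m) \<le> \<epsilon> k" for k m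
  proof (rule LIMSEQ_le_const)
    have "(\<lambda>l. (\<Sum>j<m. \<bar>a j - b l j\<bar> * q (x j)) + (\<epsilon> l + \<epsilon> k)) \<longlonglongrightarrow> (\<Sum>j<m. \<bar>a j - a j\<bar> * q (x j)) + (0 + \<epsilon> k)"
      by (intro tendsto_intros a \<epsilon>)
    then show "(\<lambda>l. (\<Sum>j<m. \<bar>a j - b l j\<bar> * q (x j)) + (\<epsilon> l + \<epsilon> k)) \<longlonglongrightarrow> \<epsilon> k" by simp
    have "q (psum x a m - psum x (b l) m) \<le> (\<Sum>j<m. \<bar>a j - b l j\<bar> * q (x j))" for l
      using q_sum[of "\<lambda>j. (a j - b l j) *\<^sub>R x j" "{..<m}"] by (simp only: psum_minus q_scale)
    then have "q (psum x a m - psum x (b k) m) \<le> (\<Sum>j<m. \<bar>a j - b l j\<bar> * q (x j)) + (\<epsilon> l + \<epsilon> k)" for l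
      using diff[of l m k] q_diff[of "psum x a m" "psum x (b k) m" "psum x (b l) m"] by (meson add_mono order_trans)
    then show "\<exists>N. \<forall>l\<ge>N. q (psum x a m - psum x (b k) m) \<le> (\<Sum>j<m. \<bar>a j - b l j\<bar> * q (x j)) + (\<epsilon> l + \<epsilon> k)"
      by blast
  qed
  have "(\<lambda>m. q (psum x a m - z)) \<longlonglongrightarrow> 0"
  proof (rule LIMSEQ_I)
    fix e :: real assume "0 < e"
    then have "0 < e / 2" by simp
    from LIMSEQ_D[OF \<epsilon> this] obtain k where "norm (\<epsilon> k - 0) < e / 2" by blast
    then have k: "\<epsilon> k < e / 2" by simp
    have "q (psum x a m - z) < e" if "n k \<le> m" for m
      using q_diff[of "psum x a m" z "psum x (b k) m"] limit[of m k] stable[OF that] close[of k] k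
      by (simp add: \<epsilon>_def)
    then show "\<exists>N. \<forall>m\<ge>N. norm (q (psum x a m - z) - 0) < e" by (auto simp: q_nonneg)
  qed
  then show ?thesis by blast
qed

lemma basic: "basic_sequence V (\<pi> \<circ> x)"
proof -
  let ?S = "closed_span V (\<pi> \<circ> x)"
  have S: "\<pi> z \<in> ?S \<longleftrightarrow> (\<forall>e>0. \<exists>a n. q (psum x a n - z) < e)" for z
    by (simp add: closed_span_def points partial_sum_eq vdist_eq)
  have "\<pi> (x k) \<in> ?S" for k
  proof -
    have "psum x (\<lambda>j. if j = k then 1 else 0) (Suc k) = (\<Sum>j<Suc k. if j = k then x j else 0)"
      by (rule sum.cong) auto
    then have "psum x (\<lambda>j. if j = k then 1 else 0) (Suc k) = x k" by simp
    then have "q (psum x (\<lambda>j. if j = k then 1 else 0) (Suc k) - x k) = 0" by (simp add: q_0 del: sum.lessThan_Suc)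
    then show ?thesis unfolding S by metis
  qed
  moreover have "\<exists>!a. series_sums (V\<lparr>points := ?S\<rparr>) a (\<pi> \<circ> x) y" if y: "y \<in> ?S" for y
  proof -
    obtain z where z: "y = \<pi> z" using y by (auto simp: closed_span_def points)
    have "\<exists>a. (\<lambda>n. q (psum x a n - z)) \<longlonglongrightarrow> 0"
      by (rule expansion_exists) (use y in \<open>simp add: z S\<close>)
    then obtain a where a: "(\<lambda>n. q (psum x a n - z)) \<longlonglongrightarrow> 0" by blast
    have iff: "series_sums (V\<lparr>points := ?S\<rparr>) a (\<pi> \<circ> x) y \<longleftrightarrow> (\<lambda>n. q (psum x a n - z)) \<longlonglongrightarrow> 0" for a
      using y by (simp add: series_sums_points partial_sum_eq vdist_eq z)
    show ?thesis
    proof (rule ex1I[of _ a])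
      show "series_sums (V\<lparr>points := ?S\<rparr>) a (\<pi> \<circ> x) y" using a iff by simp
      fix b assume "series_sums (V\<lparr>points := ?S\<rparr>) b (\<pi> \<circ> x) y"
      then show "b = a" using expansion_unique[OF _ a] iff by simp
    qed
  qed
  ultimately show ?thesis
    by (auto simp: basic_sequence_def schauder_basis_def points)
qed

lemma schauder_basis_if_dense:
  assumes "\<And>z e. 0 < e \<Longrightarrow> \<exists>a n. q (psum x a n - z) < e"
  shows "schauder_basis V (\<pi> \<circ> x)"
proof -
  have "closed_span V (\<pi> \<circ> x) = points V"
    using assms by (auto simp: closed_span_def points partial_sum_eq vdist_eq)
  then show ?thesis using basic by (simp add: basic_sequence_def)
qed

text \<open>A block of the rearranged series that starts late enough is a finite subsum of a tail of the original series, and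
\<open>1\<close>-unconditionality bounds it by that tail.\<close>

lemma unconditional_image: "unconditional V (\<pi> \<circ> x)"
  unfolding unconditional_def
proof (intro allI impI)
  fix a and s :: "nat \<Rightarrow> nat" assume conv: "series_converges V a (\<pi> \<circ> x)" and s: "bij s"
  have "series_converges V (a \<circ> s) (\<pi> \<circ> (x \<circ> s))"
    unfolding series_converges_iff
  proof (intro allI impI)
    fix e :: real assume "0 < e"
    obtain N where N: "\<forall>m n. N \<le> m \<longrightarrow> m \<le> n \<longrightarrow> q (\<Sum>j=m..<n. a j *\<^sub>R x j) < e"
      using series_tail_small[OF conv \<open>0 < e\<close>] by (rule exE)
    have inj: "inj s" using s by (rule bij_is_inj)
    have "finite (s -` {..<N})" by (rule finite_vimageI[OF _ inj]) simp
    then obtain K where K: "\<And>j. s j < N \<Longrightarrow> j < K" using finite_nat_set_iff_bounded[of "s -` {..<N}"] by auto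
    have "q (\<Sum>j=m..<n. (a \<circ> s) j *\<^sub>R (x \<circ> s) j) < e" if m: "K \<le> m" "m \<le> n" for m n
    proof -
      define A where "A = s ` {m..<n}"
      define L where "L = Suc (Max (insert N A))"
      have A: "A \<subseteq> {N..<L}"
      proof
        fix i assume i: "i \<in> A"
        then have "i < L" by (simp add: L_def A_def less_Suc_eq_le)
        moreover have "N \<le> i"
        proof (rule ccontr)
          obtain j where j: "i = s j" "m \<le> j" using i by (auto simp: A_def)
          assume "\<not> N \<le> i"
          then show False using K[of j] j m by simp
        qed
        ultimately show "i \<in> {N..<L}" by simp
      qed
      have "N \<le> L" by (simp add: L_def A_def le_SucI)
      have "(\<Sum>j=m..<n. (a \<circ> s) j *\<^sub>R (x \<circ> s) j) = (\<Sum>i\<in>A. (if N \<le> i then a i else 0) *\<^sub>R x i)"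
        using A unfolding A_def by (subst sum.reindex) (auto intro!: inj_on_subset[OF inj] sum.cong)
      also have "q \<dots> \<le> q (psum x (\<lambda>i. if N \<le> i then a i else 0) L)"
        by (rule q_restrict) (use A in auto)
      also have "psum x (\<lambda>i. if N \<le> i then a i else 0) L = (\<Sum>i=N..<L. a i *\<^sub>R x i)"
        by (rule sum.mono_neutral_cong_right) auto
      also have "q \<dots> < e" using N \<open>N \<le> L\<close> by simp
      finally show ?thesis .
    qed
    then show "\<exists>N. \<forall>m n. N \<le> m \<longrightarrow> m \<le> n \<longrightarrow> q (\<Sum>j=m..<n. (a \<circ> s) j *\<^sub>R (x \<circ> s) j) < e" by blast
  qed
  then show "series_converges V (a \<circ> s) (\<pi> \<circ> x \<circ> s)" by (simp only: comp_assoc)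
qed

lemma series_converges_transfer:
  assumes le: "\<And>b n. q (psum y b n) \<le> C * q (psum x' b n)"
    and conv: "series_converges V a (\<pi> \<circ> x')"
  shows "series_converges V a (\<pi> \<circ> y)"
  unfolding series_converges_iff
proof (intro allI impI)
  fix e :: real assume e: "0 < e"
  define D where "D = max C 1"
  have D: "0 < D" by (simp add: D_def)
  obtain N where N: "\<forall>m n. N \<le> m \<longrightarrow> m \<le> n \<longrightarrow> q (\<Sum>j=m..<n. a j *\<^sub>R x' j) < e / D"
    using series_tail_small[OF conv divide_pos_pos[OF e D]] by (rule exE)
  have "q (\<Sum>j=m..<n. a j *\<^sub>R y j) < e" if m: "N \<le> m" "m \<le> n" for m n
  proof -
    have tail: "(\<Sum>j=m..<n. a j *\<^sub>R w j) = psum w (\<lambda>j. if m \<le> j then a j else 0) n" for w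
      by (rule sum.mono_neutral_cong_left) auto
    have "q (\<Sum>j=m..<n. a j *\<^sub>R y j) \<le> C * q (\<Sum>j=m..<n. a j *\<^sub>R x' j)"
      unfolding tail by (rule le)
    also have "\<dots> \<le> D * q (\<Sum>j=m..<n. a j *\<^sub>R x' j)"
      by (rule mult_right_mono) (auto simp: D_def q_nonneg)
    also have "\<dots> < e" using N[rule_format, OF m] D by (simp add: field_simps)
    finally show ?thesis .
  qed
  then show "\<exists>N. \<forall>m n. N \<le> m \<longrightarrow> m \<le> n \<longrightarrow> q (\<Sum>j=m..<n. a j *\<^sub>R y j) < e" by blast
qed

text \<open>Estimates between finite combinations in both directions make the two series Cauchy simultaneously.\<close>

lemma subsymmetric_if_spreading:
  assumes "\<And>r a n. strict_mono r \<Longrightarrow> q (psum x a n) \<le> C * q (psum (x \<circ> r) a n)"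
    and "\<And>r a n. strict_mono r \<Longrightarrow> q (psum (x \<circ> r) a n) \<le> C' * q (psum x a n)"
  shows "subsymmetric V (\<pi> \<circ> x)"
  unfolding subsymmetric_def equivalent_sequences_def
proof (intro conjI basic unconditional_image allI impI)
  fix r :: "nat \<Rightarrow> nat" and a assume r: "strict_mono r"
  show "series_converges V a (\<pi> \<circ> x) \<longleftrightarrow> series_converges V a (\<pi> \<circ> x \<circ> r)"
    unfolding comp_assoc
    using series_converges_transfer[of x C "x \<circ> r" a, OF assms(1)[OF r]]
      series_converges_transfer[of "x \<circ> r" C' x a, OF assms(2)[OF r]] by blast
qed

end

section \<open>Banach spaces and their quotients\<close>

lemma presented_space_full: "presented_space (full_space :: 'a::banach nspace) id norm"
proof
  fix z :: "nat \<Rightarrow> 'a"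
  assume "\<And>e. 0 < e \<Longrightarrow> \<exists>N. \<forall>m\<ge>N. \<forall>n\<ge>N. norm (z m - z n) < e"
  then have "Cauchy z" unfolding Cauchy_iff by blast
  then obtain x where "z \<longlonglongrightarrow> x" using Cauchy_convergent convergent_def by blast
  then have "(\<lambda>n. z n - x) \<longlonglongrightarrow> 0" by (simp add: LIM_zero)
  then show "\<exists>x. (\<lambda>n. norm (z n - x)) \<longlonglongrightarrow> 0" using tendsto_norm_zero by blast
qed (simp_all add: norm_triangle_ineq)

definition quotient_seminorm :: "'a::real_normed_vector set \<Rightarrow> 'a \<Rightarrow> real" where
  "quotient_seminorm M x = (INF m\<in>M. norm (x + m))"

lemma quotient_seminorm_le: "m \<in> M \<Longrightarrow> quotient_seminorm M x \<le> norm (x + m)"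
  unfolding quotient_seminorm_def by (rule cINF_lower) (auto intro!: bdd_belowI2[where m = 0])

lemma quotient_seminorm_ge:
  "M \<noteq> {} \<Longrightarrow> (\<And>m. m \<in> M \<Longrightarrow> c \<le> norm (x + m)) \<Longrightarrow> c \<le> quotient_seminorm M x"
  unfolding quotient_seminorm_def by (rule cINF_greatest)

lemma quotient_seminorm_less:
  assumes "M \<noteq> {}" "quotient_seminorm M x < c"
  shows "\<exists>m\<in>M. norm (x + m) < c"
  using quotient_seminorm_ge[OF assms(1), of c x] assms(2) by force

text \<open>Completeness: along a subsequence with \<open>q\<close>-increments below \<open>2\<^sup>-\<^sup>k\<close> the increments can be corrected by elements of
\<open>M\<close> to have norm below \<open>2\<^sup>-\<^sup>k\<close>, so the corrected series converges in the Banach space.\<close>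

lemma presented_space_quotient:
  fixes M :: "'a::banach set"
  assumes M: "subspace M"
  shows "presented_space (quotient_space M) (coset M) (quotient_seminorm M)"
proof
  note ne = subspace_0[OF M]
  have ne': "M \<noteq> {}" using ne by blast
  have nonneg: "0 \<le> quotient_seminorm M x" for x by (rule quotient_seminorm_ge[OF ne']) simp
  show tri: "quotient_seminorm M (x + y) \<le> quotient_seminorm M x + quotient_seminorm M y" for x y
  proof (rule field_le_epsilon)
    fix e :: real assume e: "0 < e"
    obtain m where m: "m \<in> M" "norm (x + m) < quotient_seminorm M x + e / 2"
      using quotient_seminorm_less[OF ne', of x "quotient_seminorm M x + e / 2"] e by auto
    obtain n where n: "n \<in> M" "norm (y + n) < quotient_seminorm M y + e / 2"
      using quotient_seminorm_less[OF ne', of y "quotient_seminorm M y + e / 2"] e by auto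
    have "quotient_seminorm M (x + y) \<le> norm (x + y + (m + n))"
      by (rule quotient_seminorm_le) (rule subspace_add[OF M m(1) n(1)])
    also have "\<dots> = norm ((x + m) + (y + n))" by (simp add: algebra_simps)
    also have "\<dots> \<le> norm (x + m) + norm (y + n)" by (rule norm_triangle_ineq)
    finally show "quotient_seminorm M (x + y) \<le> quotient_seminorm M x + quotient_seminorm M y + e"
      using m(2) n(2) by simp
  qed
  have scale_le: "quotient_seminorm M (r *\<^sub>R x) \<le> \<bar>r\<bar> * quotient_seminorm M x" if "r \<noteq> 0" for r x
  proof -
    have "quotient_seminorm M (r *\<^sub>R x) / \<bar>r\<bar> \<le> quotient_seminorm M x"
    proof (rule quotient_seminorm_ge[OF ne'])
      fix m assume "m \<in> M"
      then have "quotient_seminorm M (r *\<^sub>R x) \<le> norm (r *\<^sub>R x + r *\<^sub>R m)"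
        by (intro quotient_seminorm_le subspace_scale[OF M])
      also have "\<dots> = \<bar>r\<bar> * norm (x + m)" by (simp only: scaleR_add_right[symmetric] norm_scaleR)
      finally show "quotient_seminorm M (r *\<^sub>R x) / \<bar>r\<bar> \<le> norm (x + m)"
        using that by (simp add: divide_le_eq mult.commute)
    qed
    then show ?thesis using that by (simp add: field_simps)
  qed
  show "quotient_seminorm M (r *\<^sub>R x) = \<bar>r\<bar> * quotient_seminorm M x" for r x
  proof (cases "r = 0")
    case True
    have "quotient_seminorm M 0 \<le> 0" using quotient_seminorm_le[OF ne, of 0] by simp
    then show ?thesis using True nonneg[of 0] by simp
  next
    case False
    have "quotient_seminorm M (inverse r *\<^sub>R r *\<^sub>R x) \<le> \<bar>inverse r\<bar> * quotient_seminorm M (r *\<^sub>R x)"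
      using False by (intro scale_le) simp
    then have "\<bar>r\<bar> * quotient_seminorm M x \<le> quotient_seminorm M (r *\<^sub>R x)"
      using False by (simp add: field_simps)
    then show ?thesis using scale_le[OF False, of x] by simp
  qed
  fix z :: "nat \<Rightarrow> 'a"
  assume C: "\<And>e. 0 < e \<Longrightarrow> \<exists>N. \<forall>m\<ge>N. \<forall>n\<ge>N. quotient_seminorm M (z m - z n) < e"
  have "\<exists>N. \<forall>m\<ge>N. \<forall>n\<ge>N. quotient_seminorm M (z m - z n) < (1 / 2) ^ k" for k :: nat
    by (rule C) simp
  then obtain N where N: "\<And>k m n. N k \<le> m \<Longrightarrow> N k \<le> n \<Longrightarrow> quotient_seminorm M (z m - z n) < (1 / 2) ^ k"
    by metis
  \<comment> \<open>Summing makes the indices increasing while keeping them above \<open>N k\<close>.\<close>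
  define idx where "idx k = (\<Sum>i\<le>k. N i)" for k
  have idx: "N k \<le> idx k" "idx k \<le> idx (Suc k)" for k by (simp_all add: idx_def member_le_sum)
  have "\<exists>m\<in>M. norm (z (idx (Suc k)) - z (idx k) + m) < (1 / 2) ^ k" for k
    using idx[of k] by (intro quotient_seminorm_less[OF ne'] N) auto
  then obtain m where m: "\<And>k. m k \<in> M" "\<And>k. norm (z (idx (Suc k)) - z (idx k) + m k) < (1 / 2) ^ k"
    by metis
  define w where "w k = z (idx (Suc k)) - z (idx k) + m k" for k
  have "summable w"
    by (rule summable_comparison_test'[of "\<lambda>k. (1 / 2) ^ k" 0])
      (use m(2) in \<open>auto simp: w_def summable_geometric intro: less_imp_le\<close>)
  define x where "x = z (idx 0) + suminf w"
  have telescope: "z (idx K) + (\<Sum>k<K. m k) = z (idx 0) + (\<Sum>k<K. w k)" for K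
    by (induction K) (simp_all add: w_def algebra_simps)
  have idx_le: "quotient_seminorm M (z (idx K) - x) \<le> norm ((\<Sum>k<K. w k) - suminf w)" for K
  proof -
    have "z (idx K) - x + (\<Sum>k<K. m k) = (\<Sum>k<K. w k) - suminf w"
      using telescope[of K] by (simp add: x_def algebra_simps)
    then show ?thesis
      using quotient_seminorm_le[of "\<Sum>k<K. m k" M "z (idx K) - x"] subspace_sum[OF M, of "{..<K}" m] m(1) by simp
  qed
  have "(\<lambda>n. quotient_seminorm M (z n - x)) \<longlonglongrightarrow> 0"
  proof (rule LIMSEQ_I)
    fix e :: real assume "0 < e"
    then have e: "0 < e / 2" by simp
    obtain K\<^sub>1 where K1: "\<And>K. K\<^sub>1 \<le> K \<Longrightarrow> norm ((\<Sum>k<K. w k) - suminf w) < e / 2"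
      using LIMSEQ_D[OF summable_LIMSEQ[OF \<open>summable w\<close>] e] by blast
    obtain K\<^sub>2 where K2: "(1 / 2 :: real) ^ K\<^sub>2 < e / 2" using real_arch_pow_inv[OF e, of "1/2"] by auto
    define K where "K = max K\<^sub>1 K\<^sub>2"
    have K: "(1 / 2 :: real) ^ K < e / 2"
      by (rule order_le_less_trans[OF power_decreasing K2]) (auto simp: K_def)
    have "quotient_seminorm M (z n - x) < e" if "N K \<le> n" for n
    proof -
      have "quotient_seminorm M (z n - x) \<le> quotient_seminorm M (z n - z (idx K)) + quotient_seminorm M (z (idx K) - x)"
        using tri[of "z n - z (idx K)" "z (idx K) - x"] by simp
      also have "\<dots> < e / 2 + e / 2"
        using N[OF that idx(1)] K idx_le[of K] K1[of K] by (intro add_strict_mono) (auto simp: K_def)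
      finally show ?thesis by simp
    qed
    then show "\<exists>N. \<forall>n\<ge>N. norm (quotient_seminorm M (z n - x) - 0) < e" by (auto simp: nonneg)
  qed
  then show "\<exists>x. (\<lambda>n. quotient_seminorm M (z n - x)) \<longlonglongrightarrow> 0" by blast
qed (auto simp: quotient_space_vadd[OF M] quotient_space_vscale[OF M] quotient_space_vnorm coset_self[OF M]
    quotient_seminorm_def, auto simp: quotient_space_def)

section \<open>Subsymmetry of a biorthogonal system on both sides\<close>

text \<open>The last three assumptions say that the values \<open>(u\<^sub>j(w))\<close> of a vector \<open>w\<close> can be multiplied by bounded
scalars, spread out along a subsequence, or read off along a subsequence, without increasing the norm of the vector
by more than a constant. They are stated only for vectors of a dense subspace, which makes them statements about
finitely supported vectors below. By duality they give subsymmetry of \<open>(u\<^sub>j)\<close> as well as of the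
cosets of \<open>(x\<^sub>j)\<close> in the quotient by the common kernel of the \<open>u\<^sub>j\<close>.\<close>

locale biorthogonal_system =
  fixes D :: "'a::banach set" and u :: "nat \<Rightarrow> 'a \<Rightarrow>\<^sub>L real" and x :: "nat \<Rightarrow> 'a" and K C :: real
  assumes D: "subspace D" and dense: "closure D = UNIV"
    and x_in: "x j \<in> D" and norm_x: "norm (x j) \<le> 1"
    and biorthogonal: "blinfun_apply (u i) (x j) = (if i = j then 1 else 0)"
    and K: "0 < K" and norm_u: "norm (u j) \<le> K" and C: "0 < C"
    and finite_u: "w \<in> D \<Longrightarrow> finite {j. blinfun_apply (u j) w \<noteq> 0}"
    and multiplier: "w \<in> D \<Longrightarrow> (\<And>j. \<bar>\<theta> j\<bar> \<le> 1) \<Longrightarrow>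
      \<exists>w'\<in>D. norm w' \<le> norm w \<and> (\<forall>j. blinfun_apply (u j) w' = \<theta> j * blinfun_apply (u j) w)"
    and spread: "w \<in> D \<Longrightarrow> strict_mono r \<Longrightarrow>
      \<exists>w'\<in>D. norm w' \<le> norm w \<and> (\<forall>j. blinfun_apply (u (r j)) w' = blinfun_apply (u j) w)"
    and compress: "w \<in> D \<Longrightarrow> strict_mono r \<Longrightarrow>
      \<exists>w'\<in>D. norm w' \<le> C * norm w \<and> (\<forall>j. blinfun_apply (u j) w' = blinfun_apply (u (r j)) w)"
begin

lemma functional_norm_le:
  assumes c: "0 \<le> c" and le: "\<And>w. w \<in> D \<Longrightarrow> blinfun_apply f w \<le> c * norm w"
  shows "norm (f :: 'a \<Rightarrow>\<^sub>L real) \<le> c"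
proof (rule norm_blinfun_bound[OF c])
  fix z
  have abs_le: "\<bar>blinfun_apply f w\<bar> \<le> c * norm w" if "w \<in> D" for w
    using le[OF that] le[OF subspace_neg[OF D that]] by (simp add: blinfun.minus_right abs_le_iff)
  obtain w where w: "\<And>n. w n \<in> D" "w \<longlonglongrightarrow> z" using dense closure_sequential[of z D] by blast
  have "(\<lambda>n. norm (blinfun_apply f (w n))) \<longlonglongrightarrow> norm (blinfun_apply f z)"
    "(\<lambda>n. c * norm (w n)) \<longlonglongrightarrow> c * norm z"
    by (intro tendsto_intros w)+
  then show "norm (blinfun_apply f z) \<le> c * norm z"
    using abs_le w(1) by (intro LIMSEQ_le) auto
qed

text \<open>The duality step: if the values of \<open>\<Sum>a\<^sub>jf\<^sub>j\<close> at \<open>w\<close> are those of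
\<open>\<Sum>b\<^sub>jg\<^sub>j\<close> at a vector \<open>w'\<close> that is not much longer, then the norms compare.\<close>

lemma sum_functional_le:
  assumes w': "w' \<in> D" "norm w' \<le> c * norm w"
    and eq: "(\<Sum>j<n. a j * blinfun_apply (f j) w) = (\<Sum>j<n. b j * blinfun_apply (g j) w')"
  shows "blinfun_apply (\<Sum>j<n. a j *\<^sub>R f j) w \<le> (c * norm (\<Sum>j<n. b j *\<^sub>R g j :: 'a \<Rightarrow>\<^sub>L real)) * norm w"
proof -
  let ?g = "\<Sum>j<n. b j *\<^sub>R g j :: 'a \<Rightarrow>\<^sub>L real"
  have "blinfun_apply (\<Sum>j<n. a j *\<^sub>R f j) w = blinfun_apply ?g w'"
    using eq by (simp add: blinfun.sum_left blinfun.scaleR_left)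
  also have "\<dots> \<le> norm ?g * norm w'" using norm_blinfun[of ?g w'] by simp
  also have "\<dots> \<le> norm ?g * (c * norm w)" by (rule mult_left_mono[OF w'(2)]) simp
  finally show ?thesis by (simp add: mult_ac)
qed

lemma dual_subsymmetric: "subsymmetric full_space u"
proof -
  interpret full: presented_space "full_space :: ('a \<Rightarrow>\<^sub>L real) nspace" id norm
    by (rule presented_space_full)
  interpret dual: unconditional_sequence "full_space :: ('a \<Rightarrow>\<^sub>L real) nspace" id norm u 1
  proof
    fix n and a b :: "nat \<Rightarrow> real"
    assume ab: "\<And>j. j < n \<Longrightarrow> \<bar>a j\<bar> \<le> \<bar>b j\<bar>"
    define \<theta> where "\<theta> j = (if j < n then a j / b j else 0)" for j
    have \<theta>: "\<bar>\<theta> j\<bar> \<le> 1" for j using ab[of j] by (auto simp: \<theta>_def divide_le_eq_1)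
    have ab': "a j = b j * \<theta> j" if "j < n" for j using ab[OF that] that by (auto simp: \<theta>_def)
    have "norm (\<Sum>j<n. a j *\<^sub>R u j) \<le> 1 * norm (\<Sum>j<n. b j *\<^sub>R u j)"
    proof (rule functional_norm_le)
      fix w assume "w \<in> D"
      then obtain w' where w': "w' \<in> D" "norm w' \<le> norm w"
        "\<And>j. blinfun_apply (u j) w' = \<theta> j * blinfun_apply (u j) w" using multiplier[of w \<theta>] \<theta> by blast
      show "blinfun_apply (\<Sum>j<n. a j *\<^sub>R u j) w \<le> (1 * norm (\<Sum>j<n. b j *\<^sub>R u j)) * norm w"
        by (rule sum_functional_le[OF w'(1)]) (auto simp: w' ab' mult.assoc)
    qed simp
    then show "norm (\<Sum>j<n. a j *\<^sub>R u j) \<le> norm (\<Sum>j<n. b j *\<^sub>R u j)" by simp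
  next
    fix j
    have "1 = blinfun_apply (u j) (x j)" by (simp add: biorthogonal)
    also have "\<dots> \<le> norm (u j) * norm (x j)" using norm_blinfun[of "u j" "x j"] by simp
    also have "\<dots> \<le> norm (u j) * 1" by (rule mult_left_mono[OF norm_x]) simp
    finally show "1 \<le> norm (u j)" by simp
  qed simp
  have "subsymmetric full_space (id \<circ> u)"
  proof (rule dual.subsymmetric_if_spreading[where C = 1 and C' = C])
    fix r :: "nat \<Rightarrow> nat" and a n assume r: "strict_mono r"
    show "norm (\<Sum>j<n. a j *\<^sub>R u j) \<le> 1 * norm (\<Sum>j<n. a j *\<^sub>R (u \<circ> r) j)"
    proof (rule functional_norm_le)
      fix w assume "w \<in> D"
      then obtain w' where w': "w' \<in> D" "norm w' \<le> norm w"
        "\<And>j. blinfun_apply (u (r j)) w' = blinfun_apply (u j) w" using spread[OF _ r] by blast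
      show "blinfun_apply (\<Sum>j<n. a j *\<^sub>R u j) w \<le> (1 * norm (\<Sum>j<n. a j *\<^sub>R (u \<circ> r) j)) * norm w"
        by (rule sum_functional_le[OF w'(1)]) (auto simp: w')
    qed simp
    show "norm (\<Sum>j<n. a j *\<^sub>R (u \<circ> r) j) \<le> C * norm (\<Sum>j<n. a j *\<^sub>R u j)"
    proof (rule functional_norm_le)
      fix w assume "w \<in> D"
      then obtain w' where w': "w' \<in> D" "norm w' \<le> C * norm w"
        "\<And>j. blinfun_apply (u j) w' = blinfun_apply (u (r j)) w" using compress[OF _ r] by blast
      show "blinfun_apply (\<Sum>j<n. a j *\<^sub>R (u \<circ> r) j) w \<le> (C * norm (\<Sum>j<n. a j *\<^sub>R u j)) * norm w"
        by (rule sum_functional_le[OF w'(1,2)]) (auto simp: w')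
    qed (use C in simp)
  qed
  then show ?thesis by simp
qed

definition annihilator :: "'a set" where
  "annihilator = {z. \<forall>j. blinfun_apply (u j) z = 0}"

lemma subspace_annihilator: "subspace annihilator"
  by (auto simp: annihilator_def subspace_def blinfun.add_right blinfun.scaleR_right)

lemma closed_annihilator: "closed annihilator"
proof -
  have "annihilator = (\<Inter>j. {z. blinfun_apply (u j) z = 0})" by (auto simp: annihilator_def)
  moreover have "closed {z. blinfun_apply (u j) z = 0}" for j
    by (intro closed_Collect_eq continuous_intros)
  ultimately show ?thesis by auto
qed

abbreviation qnorm :: "'a \<Rightarrow> real" where
  "qnorm \<equiv> quotient_seminorm annihilator"

lemma qnorm_le: "(\<And>i. blinfun_apply (u i) w = blinfun_apply (u i) z) \<Longrightarrow> qnorm z \<le> norm w"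
  using quotient_seminorm_le[of "w - z" annihilator z] by (simp add: annihilator_def blinfun.diff_right)

lemma qnorm_ge:
  assumes "\<And>w. (\<And>i. blinfun_apply (u i) w = blinfun_apply (u i) z) \<Longrightarrow> c \<le> norm w"
  shows "c \<le> qnorm z"
proof (rule quotient_seminorm_ge)
  show "annihilator \<noteq> {}" using subspace_0[OF subspace_annihilator] by blast
  fix m assume "m \<in> annihilator"
  then show "c \<le> norm (z + m)" by (intro assms) (simp add: annihilator_def blinfun.add_right)
qed

text \<open>Near-optimal representatives of a coset can be found in the dense subspace. An approximation \<open>d\<close> of a
near-optimal representative has nearly the right values \<open>u\<^sub>j(d)\<close>; the multiplier removes the values outside the
finite set \<open>J\<close>, and multiples of the \<open>x\<^sub>j\<close> repair those in \<open>J\<close>.\<close>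

lemma qnorm_less:
  assumes z: "z \<in> D" and c: "qnorm z < c"
  shows "\<exists>w\<in>D. (\<forall>i. blinfun_apply (u i) w = blinfun_apply (u i) z) \<and> norm w < c"
proof -
  have "annihilator \<noteq> {}" using subspace_0[OF subspace_annihilator] by blast
  then obtain m where m: "m \<in> annihilator" "norm (z + m) < c" using quotient_seminorm_less c by blast
  define J where "J = {j. blinfun_apply (u j) z \<noteq> 0}"
  have J: "finite J" unfolding J_def by (rule finite_u[OF z])
  define \<eta> where "\<eta> = (c - norm (z + m)) / (1 + real (card J) * K)"
  have den: "0 < 1 + real (card J) * K" using K by (simp add: add_pos_nonneg)
  have "\<eta> * (1 + real (card J) * K) = c - norm (z + m)" using den by (simp add: \<eta>_def)
  then have \<eta>: "0 < \<eta>" "\<eta> + real (card J) * (K * \<eta>) = c - norm (z + m)"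
    using m(2) den by (simp add: \<eta>_def, simp add: algebra_simps)
  obtain d where d: "d \<in> D" "dist d (z + m) < \<eta>"
    using dense \<eta>(1) closure_approachable[of "z + m" D] by auto
  define \<theta> where "\<theta> j = (if j \<in> J then 1 else 0 :: real)" for j
  have \<theta>: "\<bar>\<theta> j\<bar> \<le> 1" for j by (simp add: \<theta>_def)
  obtain d' where d': "d' \<in> D" "norm d' \<le> norm d" "\<And>j. blinfun_apply (u j) d' = \<theta> j * blinfun_apply (u j) d"
    using multiplier[of d \<theta>] d(1) \<theta> by blast
  define w where "w = d' + (\<Sum>j\<in>J. (blinfun_apply (u j) z - blinfun_apply (u j) d) *\<^sub>R x j)"
  have "w \<in> D" unfolding w_def
    by (intro subspace_add[OF D] d' subspace_sum[OF D] subspace_scale[OF D] x_in)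
  moreover have "blinfun_apply (u i) w = blinfun_apply (u i) z" for i
  proof -
    have "(\<Sum>j\<in>J. (blinfun_apply (u j) z - blinfun_apply (u j) d) * (if i = j then 1 else 0))
        = (\<Sum>j\<in>J. if j = i then blinfun_apply (u j) z - blinfun_apply (u j) d else 0)"
      by (rule sum.cong) auto
    then have "blinfun_apply (u i) w = \<theta> i * blinfun_apply (u i) d
        + (if i \<in> J then blinfun_apply (u i) z - blinfun_apply (u i) d else 0)"
      using J by (simp add: w_def blinfun.add_right blinfun.sum_right blinfun.scaleR_right d' biorthogonal)
    then show ?thesis by (auto simp: \<theta>_def J_def)
  qed
  moreover have "norm w < c"
  proof -
    have coeff: "\<bar>blinfun_apply (u j) z - blinfun_apply (u j) d\<bar> \<le> K * \<eta>" for j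
    proof -
      have "blinfun_apply (u j) z - blinfun_apply (u j) d = blinfun_apply (u j) (z + m - d)"
        using m(1) by (simp add: blinfun.diff_right blinfun.add_right annihilator_def)
      also have "\<bar>\<dots>\<bar> \<le> norm (u j) * norm (z + m - d)"
        using norm_blinfun[of "u j" "z + m - d"] by simp
      also have "\<dots> \<le> K * \<eta>"
        using d(2) K by (intro mult_mono norm_u) (auto simp: dist_norm norm_minus_commute)
      finally show ?thesis .
    qed
    have "norm w \<le> norm d' + (\<Sum>j\<in>J. norm ((blinfun_apply (u j) z - blinfun_apply (u j) d) *\<^sub>R x j))"
      unfolding w_def by (rule order_trans[OF norm_triangle_ineq add_left_mono[OF norm_sum]])
    also have "\<dots> \<le> norm d + real (card J) * (K * \<eta>)"
    proof (rule add_mono[OF d'(2)], rule sum_bounded_above)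
      fix j
      have "\<bar>blinfun_apply (u j) z - blinfun_apply (u j) d\<bar> * norm (x j) \<le> (K * \<eta>) * 1"
        using K \<eta>(1) by (intro mult_mono coeff norm_x) auto
      then show "norm ((blinfun_apply (u j) z - blinfun_apply (u j) d) *\<^sub>R x j) \<le> K * \<eta>" by simp
    qed
    also have "norm d < norm (z + m) + \<eta>"
      using d(2) norm_triangle_ineq2[of d "z + m"] by (simp add: dist_norm)
    finally show ?thesis using \<eta>(2) by simp
  qed
  ultimately show ?thesis by blast
qed

text \<open>The quotient norm of \<open>z\<close> depends only on the values \<open>u\<^sub>i(z)\<close>, so inequalities between quotient norms come
from operations that act on these values.\<close>

lemma qnorm_transfer:
  assumes z: "z \<in> D" and c: "0 < c"
    and transfer: "\<And>w. w \<in> D \<Longrightarrow> (\<And>i. blinfun_apply (u i) w = blinfun_apply (u i) z) \<Longrightarrow>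
      \<exists>w'. (\<forall>i. blinfun_apply (u i) w' = blinfun_apply (u i) z') \<and> norm w' \<le> c * norm w"
  shows "qnorm z' \<le> c * qnorm z"
proof (rule ccontr)
  assume "\<not> qnorm z' \<le> c * qnorm z"
  then have "qnorm z < qnorm z' / c" using c by (simp add: field_simps)
  from qnorm_less[OF z this] obtain w where w: "w \<in> D" "\<And>i. blinfun_apply (u i) w = blinfun_apply (u i) z"
    "norm w < qnorm z' / c" by blast
  obtain w' where "\<forall>i. blinfun_apply (u i) w' = blinfun_apply (u i) z'" "norm w' \<le> c * norm w"
    using transfer[OF w(1,2)] by blast
  then have "qnorm z' \<le> c * norm w" using qnorm_le[of w' z'] by simp
  also have "\<dots> < qnorm z'" using w(3) c by (simp add: field_simps)
  finally show False by simp
qed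

lemma u_sum: "finite F \<Longrightarrow> blinfun_apply (u i) (\<Sum>j\<in>F. a j *\<^sub>R x j) = (if i \<in> F then a i else 0)"
proof -
  assume F: "finite F"
  have "(\<Sum>j\<in>F. a j * (if i = j then 1 else 0)) = (\<Sum>j\<in>F. if j = i then a j else 0)"
    by (rule sum.cong) auto
  then show ?thesis using F by (simp add: blinfun.sum_right blinfun.scaleR_right biorthogonal)
qed

lemma combination_in: "(\<Sum>j\<in>F. a j *\<^sub>R x (r j)) \<in> D"
  by (intro subspace_sum[OF D] subspace_scale[OF D] x_in)

lemma u_sum_subseq:
  assumes r: "strict_mono r"
  shows "blinfun_apply (u (r i)) (\<Sum>j<n. a j *\<^sub>R x (r j)) = (if i < n then a i else 0)"
    "i \<notin> range r \<Longrightarrow> blinfun_apply (u i) (\<Sum>j<n. a j *\<^sub>R x (r j)) = 0"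
proof -
  have inj: "inj r" using r by (rule strict_mono_imp_inj_on)
  have "(\<Sum>j<n. a j *\<^sub>R x (r j)) = (\<Sum>k\<in>r ` {..<n}. a (inv r k) *\<^sub>R x k)"
    using inj by (simp add: sum.reindex inj_on_subset)
  then show "blinfun_apply (u (r i)) (\<Sum>j<n. a j *\<^sub>R x (r j)) = (if i < n then a i else 0)"
    "i \<notin> range r \<Longrightarrow> blinfun_apply (u i) (\<Sum>j<n. a j *\<^sub>R x (r j)) = 0"
    using inj by (auto simp: u_sum inj_image_mem_iff)
qed

lemma quotient_unconditional:
  "unconditional_sequence (quotient_space annihilator) (coset annihilator) qnorm x (1 / K)"
proof -
  interpret presented_space "quotient_space annihilator" "coset annihilator" qnorm
    by (rule presented_space_quotient[OF subspace_annihilator])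
  show ?thesis
  proof
    fix n and a b :: "nat \<Rightarrow> real"
    assume ab: "\<And>j. j < n \<Longrightarrow> \<bar>a j\<bar> \<le> \<bar>b j\<bar>"
    define \<theta> where "\<theta> j = (if j < n then a j / b j else 0)" for j
    have \<theta>: "\<bar>\<theta> j\<bar> \<le> 1" for j using ab[of j] by (auto simp: \<theta>_def divide_le_eq_1)
    have ab': "a j = \<theta> j * b j" if "j < n" for j using ab[OF that] that by (auto simp: \<theta>_def)
    have "qnorm (\<Sum>j<n. a j *\<^sub>R x j) \<le> 1 * qnorm (\<Sum>j<n. b j *\<^sub>R x j)"
    proof (rule qnorm_transfer)
      fix w assume w: "w \<in> D" "\<And>i. blinfun_apply (u i) w = blinfun_apply (u i) (\<Sum>j<n. b j *\<^sub>R x j)"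
      then obtain w' where "norm w' \<le> norm w" "\<And>j. blinfun_apply (u j) w' = \<theta> j * blinfun_apply (u j) w"
        using multiplier[of w \<theta>] \<theta> by blast
      then show "\<exists>w'. (\<forall>i. blinfun_apply (u i) w' = blinfun_apply (u i) (\<Sum>j<n. a j *\<^sub>R x j)) \<and> norm w' \<le> 1 * norm w"
        using w(2) ab' by (intro exI[of _ w']) (simp add: u_sum)
    qed (use combination_in[of b id] in simp_all)
    then show "qnorm (\<Sum>j<n. a j *\<^sub>R x j) \<le> qnorm (\<Sum>j<n. b j *\<^sub>R x j)" by simp
  next
    show "0 < 1 / K" using K by simp
    fix j show "1 / K \<le> qnorm (x j)"
    proof (rule qnorm_ge)
      fix w assume w: "\<And>i. blinfun_apply (u i) w = blinfun_apply (u i) (x j)"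
      have "1 = blinfun_apply (u j) w" by (simp add: w biorthogonal)
      also have "\<dots> \<le> norm (u j) * norm w" using norm_blinfun[of "u j" w] by simp
      also have "\<dots> \<le> K * norm w" by (rule mult_right_mono[OF norm_u]) simp
      finally show "1 / K \<le> norm w" using K by (simp add: field_simps)
    qed
  qed
qed

lemma quotient_subsymmetric:
  "subsymmetric (quotient_space annihilator) (coset annihilator \<circ> x)"
proof -
  interpret unconditional_sequence "quotient_space annihilator" "coset annihilator" qnorm x "1 / K"
    by (rule quotient_unconditional)
  show ?thesis
  proof (rule subsymmetric_if_spreading[where C = C and C' = 1])
    fix r :: "nat \<Rightarrow> nat" and a n assume r: "strict_mono r"
    show "qnorm (\<Sum>j<n. a j *\<^sub>R x j) \<le> C * qnorm (\<Sum>j<n. a j *\<^sub>R (x \<circ> r) j)"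
      unfolding o_apply
    proof (rule qnorm_transfer[OF combination_in C])
      fix w assume w: "w \<in> D" "\<And>i. blinfun_apply (u i) w = blinfun_apply (u i) (\<Sum>j<n. a j *\<^sub>R x (r j))"
      then obtain w' where "norm w' \<le> C * norm w" "\<And>j. blinfun_apply (u j) w' = blinfun_apply (u (r j)) w"
        using compress[OF _ r] by blast
      then show "\<exists>w'. (\<forall>i. blinfun_apply (u i) w' = blinfun_apply (u i) (\<Sum>j<n. a j *\<^sub>R x j)) \<and> norm w' \<le> C * norm w"
        using w(2) by (intro exI[of _ w']) (simp add: u_sum u_sum_subseq[OF r])
    qed
    show "qnorm (\<Sum>j<n. a j *\<^sub>R (x \<circ> r) j) \<le> 1 * qnorm (\<Sum>j<n. a j *\<^sub>R x j)"
      unfolding o_apply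
    proof (rule qnorm_transfer)
      fix w assume w: "w \<in> D" "\<And>i. blinfun_apply (u i) w = blinfun_apply (u i) (\<Sum>j<n. a j *\<^sub>R x j)"
      obtain v where v: "v \<in> D" "norm v \<le> norm w" "\<And>j. blinfun_apply (u (r j)) v = blinfun_apply (u j) w"
        using spread[OF w(1) r] by blast
      define \<theta> where "\<theta> i = (if i \<in> range r then 1 else 0 :: real)" for i
      have \<theta>: "\<bar>\<theta> j\<bar> \<le> 1" for j by (simp add: \<theta>_def)
      obtain w' where w': "norm w' \<le> norm v" "\<And>j. blinfun_apply (u j) w' = \<theta> j * blinfun_apply (u j) v"
        using multiplier[of v \<theta>] v(1) \<theta> by blast
      have "blinfun_apply (u i) w' = blinfun_apply (u i) (\<Sum>j<n. a j *\<^sub>R x (r j))" for i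
      proof (cases "i \<in> range r")
        case True
        then obtain k where k: "i = r k" by blast
        show ?thesis by (simp add: k w' \<theta>_def v w(2) u_sum u_sum_subseq[OF r])
      next
        case False
        then show ?thesis by (simp add: w' \<theta>_def u_sum_subseq[OF r])
      qed
      then show "\<exists>w'. (\<forall>i. blinfun_apply (u i) w' = blinfun_apply (u i) (\<Sum>j<n. a j *\<^sub>R x (r j))) \<and> norm w' \<le> 1 * norm w"
        using w'(1) v(2) by (intro exI[of _ w']) simp
    qed (use combination_in[of a id] in simp_all)
  qed
qed

text \<open>An element \<open>d\<close> of the dense subspace and the finite sum of the \<open>u\<^sub>j(d) x\<^sub>j\<close> have the same coset.\<close>

lemma quotient_schauder_basis:
  "schauder_basis (quotient_space annihilator) (coset annihilator \<circ> x)"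
proof -
  interpret unconditional_sequence "quotient_space annihilator" "coset annihilator" qnorm x "1 / K"
    by (rule quotient_unconditional)
  show ?thesis
  proof (rule schauder_basis_if_dense)
    fix z :: 'a and e :: real assume "0 < e"
    then obtain d where d: "d \<in> D" "dist d z < e" using dense closure_approachable[of z D] by auto
    obtain n where n: "{j. blinfun_apply (u j) d \<noteq> 0} \<subseteq> {..<n}"
      using finite_nat_set_iff_bounded[THEN iffD1, OF finite_u[OF d(1)]] by blast
    have "qnorm ((\<Sum>j<n. blinfun_apply (u j) d *\<^sub>R x j) - z) \<le> norm (d - z)"
      by (rule qnorm_le) (use n in \<open>auto simp: blinfun.diff_right u_sum\<close>)
    then show "\<exists>a n. qnorm ((\<Sum>j<n. a j *\<^sub>R x j) - z) < e" using d(2)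
      by (intro exI[of _ "\<lambda>j. blinfun_apply (u j) d"] exI[of _ n]) (simp add: dist_norm)
  qed
qed

definition dual_fundamental :: "nat \<Rightarrow> real" where
  "dual_fundamental = fundamental_function full_space u"

definition quotient_fundamental :: "nat \<Rightarrow> real" where
  "quotient_fundamental = fundamental_function (quotient_space annihilator) (coset annihilator \<circ> x)"

lemma dual_fundamental_eq: "dual_fundamental m = norm (\<Sum>j<m. u j)"
  by (simp add: dual_fundamental_def fundamental_function_full_space)

lemma quotient_fundamental_eq: "quotient_fundamental m = qnorm (\<Sum>j<m. x j)"
proof -
  interpret presented_space "quotient_space annihilator" "coset annihilator" qnorm
    by (rule presented_space_quotient[OF subspace_annihilator])
  show ?thesis unfolding quotient_fundamental_def fundamental_function_def partial_sum_eq norm by simp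
qed

text \<open>A vector on which \<open>u\<^sub>0, \<dots>, u\<^sub>m\<^sub>-\<^sub>1\<close> take the value \<open>1\<close> represents the coset of \<open>x\<^sub>0 + \<dots> +
x\<^sub>m\<^sub>-\<^sub>1\<close> once its other values are removed, and it tests \<open>u\<^sub>0 + \<dots> + u\<^sub>m\<^sub>-\<^sub>1\<close>.\<close>

lemma fundamental_bounds_of_vector:
  assumes w: "w \<in> D" "\<And>j. j < m \<Longrightarrow> blinfun_apply (u j) w = 1" "norm w \<le> c"
  shows "quotient_fundamental m \<le> c" "real m \<le> dual_fundamental m * c"
proof -
  define \<theta> where "\<theta> j = (if j < m then 1 else 0 :: real)" for j
  have \<theta>: "\<bar>\<theta> j\<bar> \<le> 1" for j by (simp add: \<theta>_def)
  obtain w' where w': "norm w' \<le> norm w" "\<And>j. blinfun_apply (u j) w' = \<theta> j * blinfun_apply (u j) w"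
    using multiplier[of w \<theta>] w(1) \<theta> by blast
  have "qnorm (\<Sum>j<m. 1 *\<^sub>R x j) \<le> norm w'"
    by (rule qnorm_le) (simp only: u_sum finite_lessThan w', simp add: \<theta>_def w(2))
  then show "quotient_fundamental m \<le> c" using w'(1) w(3) by (simp add: quotient_fundamental_eq)
  have "real m = blinfun_apply (\<Sum>j<m. u j) w" using w(2) by (simp add: blinfun.sum_left)
  also have "\<dots> \<le> norm (\<Sum>j<m. u j) * norm w" using norm_blinfun[of "\<Sum>j<m. u j" w] by simp
  also have "\<dots> \<le> norm (\<Sum>j<m. u j) * c" by (rule mult_left_mono[OF w(3)]) simp
  finally show "real m \<le> dual_fundamental m * c" by (simp add: dual_fundamental_eq)
qed

lemma fundamental_bounds_of_functional:
  assumes c: "0 < c" and le: "\<And>w. w \<in> D \<Longrightarrow> (\<Sum>j<m. blinfun_apply (u j) w) \<le> c * norm w"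
  shows "dual_fundamental m \<le> c" "real m / c \<le> quotient_fundamental m"
proof -
  show d: "dual_fundamental m \<le> c"
    unfolding dual_fundamental_eq by (rule functional_norm_le) (use c le in \<open>auto simp: blinfun.sum_left\<close>)
  have "real m / c \<le> qnorm (\<Sum>j<m. 1 *\<^sub>R x j)"
  proof (rule qnorm_ge)
    fix w assume w: "\<And>i. blinfun_apply (u i) w = blinfun_apply (u i) (\<Sum>j<m. 1 *\<^sub>R x j)"
    have "blinfun_apply (u i) w = 1" if "i < m" for i
      unfolding w using that by (simp only: u_sum finite_lessThan) simp
    then have "real m = blinfun_apply (\<Sum>j<m. u j) w" by (simp add: blinfun.sum_left)
    also have "\<dots> \<le> norm (\<Sum>j<m. u j) * norm w" using norm_blinfun[of "\<Sum>j<m. u j" w] by simp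
    also have "\<dots> \<le> c * norm w" using d by (intro mult_right_mono) (auto simp: dual_fundamental_eq)
    finally show "real m / c \<le> norm w" using c by (simp add: field_simps)
  qed
  then show "real m / c \<le> quotient_fundamental m" by (simp add: quotient_fundamental_eq)
qed

end

section \<open>Weights and lengths\<close>

definition weight :: "nat \<Rightarrow> real" where
  "weight s = (1 / 2) ^ (s * s)"

lemma weight_bounds: "0 < weight s" "weight s \<le> 1" "weight 0 = 1"
  by (simp_all add: weight_def power_le_one)

text \<open>The exponent \<open>s s\<close> is chosen so that the weights after \<open>s\<close> sum to at most \<open>2\<^sup>-\<^sup>s\<close> times the weight of \<open>s\<close>.\<close>

lemma weight_shift:
  assumes "0 < d"
  shows "weight (s + d) \<le> weight s * (1 / 2) ^ s * (1 / 2) ^ d"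
proof -
  obtain e where d: "d = Suc e" using assms by (cases d) auto
  have "s * s + s + d \<le> (s + d) * (s + d)" by (simp add: d algebra_simps)
  then have "weight (s + d) \<le> (1 / 2) ^ (s * s + s + d)"
    unfolding weight_def by (intro power_decreasing) auto
  then show ?thesis by (simp add: weight_def power_add)
qed

lemma weight_tail: "(\<Sum>t\<in>{s<..n}. weight t) \<le> weight s * (1 / 2) ^ s"
proof (cases "s \<le> n")
  case True
  have "(\<Sum>t\<in>{s<..s + d}. weight t) \<le> weight s * (1 / 2) ^ s * (1 - (1 / 2) ^ d)" for d
  proof (induction d)
    case (Suc d)
    have "{s<..s + Suc d} = insert (s + Suc d) {s<..s + d}" by auto
    then have "(\<Sum>t\<in>{s<..s + Suc d}. weight t) = weight (s + Suc d) + (\<Sum>t\<in>{s<..s + d}. weight t)"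
      by (simp add: add.commute)
    also have "\<dots> \<le> weight s * (1 / 2) ^ s * (1 / 2) ^ Suc d + weight s * (1 / 2) ^ s * (1 - (1 / 2) ^ d)"
      using weight_shift[of "Suc d" s] Suc.IH by (intro add_mono) auto
    also have "\<dots> = weight s * (1 / 2) ^ s * (1 - (1 / 2) ^ Suc d)" by (simp add: algebra_simps)
    finally show ?case .
  qed simp
  from this[of "n - s"] have "(\<Sum>t\<in>{s<..n}. weight t) \<le> weight s * (1 / 2) ^ s * (1 - (1 / 2) ^ (n - s))"
    using True by simp
  also have "\<dots> \<le> weight s * (1 / 2) ^ s * 1"
    using weight_bounds(1)[of s] by (intro mult_left_mono) auto
  finally show ?thesis by simp
qed (simp add: weight_bounds(1) less_imp_le)

lemma weight_sum: "(\<Sum>t\<le>n. weight t) \<le> 2"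
proof -
  have "{..n} = insert 0 {0<..n}" by auto
  then have "(\<Sum>t\<le>n. weight t) = weight 0 + (\<Sum>t\<in>{0<..n}. weight t)" by simp
  then show ?thesis using weight_tail[of 0 n] by (simp add: weight_bounds)
qed

lemma index_times_weight: "real s * weight s \<le> 1"
proof -
  have "s \<le> 2 ^ s" using less_exp[of s] by simp
  also have "\<dots> \<le> (2 :: nat) ^ (s * s)" by (intro power_increasing) (auto simp: le_square)
  finally have "real s \<le> 2 ^ (s * s)" by (simp only: of_nat_le_iff[symmetric, where 'a = real] of_nat_power) simp
  then have "real s * weight s \<le> 2 ^ (s * s) * weight s" using weight_bounds(1)[of s] by simp
  also have "\<dots> = 1" by (simp add: weight_def power_divide)
  finally show ?thesis .
qed

text \<open>The role of \<open>d\<close> is the total length of the components before the \<open>s\<close>-th one. For a length \<open>n\<close> with this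
property, \<open>n\<close> copies of those components together have a norm that is negligible against \<open>\<alpha>\<^sub>s n\<close>.\<close>

definition good_length :: "nat \<Rightarrow> nat \<Rightarrow> nat \<Rightarrow> bool" where
  "good_length s d n \<longleftrightarrow> 0 < n \<and> (\<forall>P x. finite P \<longrightarrow> card P \<le> n * d \<longrightarrow>
     (\<Sum>i\<in>P. \<bar>coord x i\<bar>) \<le> ((1 / 2) ^ s * weight s) * real n * su_norm x)"

lemma good_length_exists: "\<exists>n. good_length s d n"
proof -
  obtain M where M: "\<forall>n\<ge>M. \<forall>P x. finite P \<longrightarrow> card P \<le> n * d \<longrightarrow>
     (\<Sum>i\<in>P. \<bar>coord x i\<bar>) \<le> ((1 / 2) ^ s * weight s) * real n * su_norm x"
    using coord_sums_small[of "(1 / 2) ^ s * weight s" d] weight_bounds(1)[of s] by auto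
  then have "good_length s d (max M 1)" unfolding good_length_def by (intro conjI) auto
  then show ?thesis by blast
qed

primrec offset :: "nat \<Rightarrow> nat" where
  "offset 0 = 0"
| "offset (Suc s) = offset s + (SOME n. good_length s (offset s) n)"

definition len :: "nat \<Rightarrow> nat" where
  "len s = (SOME n. good_length s (offset s) n)"

lemma offset_Suc: "offset (Suc s) = offset s + len s"
  by (simp add: len_def)

declare offset.simps(2) [simp del]

lemma good_length_len: "good_length s (offset s) (len s)"
  unfolding len_def by (rule someI_ex[OF good_length_exists])

lemma len_pos: "0 < len s"
  using good_length_len by (simp add: good_length_def)

lemma coord_sum_le:
  "finite P \<Longrightarrow> card P \<le> len s * offset s \<Longrightarrow>
    (\<Sum>i\<in>P. \<bar>coord x i\<bar>) \<le> ((1 / 2) ^ s * weight s) * real (len s) * su_norm x"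
  using good_length_len by (simp add: good_length_def)

lemma mono_offset: "mono offset"
  by (rule incseq_SucI) (simp add: offset_Suc)

lemma offset_less: "s < t \<Longrightarrow> i < len s \<Longrightarrow> offset s + i < offset t"
  using monoD[OF mono_offset, of "Suc s" t] by (simp add: offset_Suc)

lemma offset_pos: "0 < s \<Longrightarrow> 0 < offset s"
  using offset_less[of 0 s 0] len_pos by simp

text \<open>The component with index \<open>0\<close> is a unit vector, so that its first coordinate alone yields a biorthogonal sequence.\<close>

definition shape :: "nat \<Rightarrow> c00" where
  "shape s = (if s = 0 then unit_vec 0 else
     SOME y. T_norm y \<le> 1 \<and> flat_norm (len s) / 2 \<le> (\<Sum>i<len s. coord y i))"

lemma shape_pos:
  assumes "0 < s"
  shows "T_norm (shape s) \<le> 1 \<and> flat_norm (len s) / 2 \<le> (\<Sum>i<len s. coord (shape s) i)"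
proof -
  have "\<exists>y. T_norm y \<le> 1 \<and> flat_norm (len s) / 2 \<le> (\<Sum>i<len s. coord y i)"
    using flat_norm_witness[OF len_pos[of s]] by blast
  from someI_ex[OF this] show ?thesis using assms by (simp add: shape_def)
qed

lemma T_norm_shape: "T_norm (shape s) \<le> 1"
  using shape_pos[of s] by (auto simp: shape_def T_norm_unit_vec)

lemma abs_shape_le: "\<bar>coord (shape s) i\<bar> \<le> 1"
  using abs_coord_le_tsirelson_norm[of "shape s" i] T_norm_shape[of s] by simp

lemma shape_sum: "0 < s \<Longrightarrow> flat_norm (len s) / 2 \<le> (\<Sum>i<len s. coord (shape s) i)"
  using shape_pos by blast

definition component :: "nat \<Rightarrow> nat \<Rightarrow> c00 \<Rightarrow> real" where
  "component s k w = (\<Sum>i<len s. coord (shape s) i * coord w (k + i))"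

lemma component_linear:
  "component s k (x + y) = component s k x + component s k y"
  "component s k (r *\<^sub>R x) = r * component s k x"
  by (simp_all add: component_def distrib_left sum.distrib sum_distrib_left mult_ac)

lemma abs_component_le_sum: "\<bar>component s k w\<bar> \<le> (\<Sum>i<len s. \<bar>coord w (k + i)\<bar>)"
proof -
  have "\<bar>component s k w\<bar> \<le> (\<Sum>i<len s. \<bar>coord (shape s) i\<bar> * \<bar>coord w (k + i)\<bar>)"
    unfolding component_def by (rule order_trans[OF sum_abs]) (simp add: abs_mult)
  also have "\<dots> \<le> (\<Sum>i<len s. 1 * \<bar>coord w (k + i)\<bar>)"
    by (intro sum_mono mult_right_mono abs_shape_le) simp
  finally show ?thesis by simp
qed

text \<open>It matters here that the shapes have Tsirelson norm at most \<open>1\<close>.\<close>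

lemma abs_component_le: "\<bar>component s k w\<bar> \<le> su_norm w"
proof -
  have "\<bar>component s k w\<bar> \<le> (\<Sum>i<len s. \<bar>coord w (k + i)\<bar> * \<bar>coord (shape s) i\<bar>)"
    unfolding component_def by (rule order_trans[OF sum_abs]) (simp add: abs_mult mult.commute)
  also have "\<dots> \<le> su_norm w * T_norm (shape s)"
    by (rule su_pairing_le) (auto simp: strict_mono_on_def)
  also have "\<dots> \<le> su_norm w * 1"
    by (rule mult_left_mono[OF T_norm_shape]) (rule su_norm_props)
  finally show ?thesis by simp
qed

lemma sum_abs_component_le:
  "(\<Sum>t<r. \<bar>component t (k + offset t) w\<bar>) \<le> (\<Sum>i<offset r. \<bar>coord w (k + i)\<bar>)"
proof (induction r)
  case (Suc r)
  have "{..<offset (Suc r)} = {..<offset r} \<union> {offset r..<offset r + len r}"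
    by (auto simp: offset_Suc)
  then have "(\<Sum>i<offset (Suc r). \<bar>coord w (k + i)\<bar>)
      = (\<Sum>i\<in>{..<offset r} \<union> {offset r..<offset r + len r}. \<bar>coord w (k + i)\<bar>)" by (rule arg_cong)
  also have "\<dots> = (\<Sum>i<offset r. \<bar>coord w (k + i)\<bar>) + (\<Sum>i\<in>{offset r..<offset r + len r}. \<bar>coord w (k + i)\<bar>)"
    by (rule sum.union_disjoint) auto
  also have "(\<Sum>i\<in>{offset r..<offset r + len r}. \<bar>coord w (k + i)\<bar>) = (\<Sum>i<len r. \<bar>coord w (k + offset r + i)\<bar>)"
    by (rule sum.reindex_bij_witness[of _ "\<lambda>i. offset r + i" "\<lambda>i. i - offset r"]) (auto simp: add.assoc)
  finally show ?case using Suc.IH abs_component_le_sum[of r "k + offset r" w] by simp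
qed simp

section \<open>The block functionals\<close>

text \<open>The \<open>j\<close>-th block has room for the components \<open>0, \<dots>, j\<close>.\<close>

primrec start :: "nat \<Rightarrow> nat" where
  "start 0 = 0"
| "start (Suc j) = start j + offset (Suc j)"

lemma strict_mono_start: "strict_mono start"
  unfolding strict_mono_Suc_iff using offset_pos by simp

lemma start_mono: "i \<le> j \<Longrightarrow> start i \<le> start j"
  using strict_mono_start by (simp add: strict_mono_less_eq)

definition block_of :: "nat \<Rightarrow> nat" where
  "block_of k = (LEAST j. k < start (Suc j))"

lemma block_of_eq:
  assumes "start j \<le> k" "k < start (Suc j)"
  shows "block_of k = j"
  unfolding block_of_def
proof (rule Least_equality)
  show "k < start (Suc j)" by (rule assms(2))
  fix i assume "k < start (Suc i)"
  then have "\<not> Suc i \<le> j" using assms(1) start_mono[of "Suc i" j] by linarith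
  then show "j \<le> i" by simp
qed

lemma block_of_bounds: "start (block_of k) \<le> k" "k < start (Suc (block_of k))"
proof -
  have "Suc k \<le> start (Suc k)" using strict_mono_start by (rule strict_mono_imp_increasing)
  then have "k < start (Suc k)" by simp
  then show 1: "k < start (Suc (block_of k))" unfolding block_of_def by (rule LeastI)
  show "start (block_of k) \<le> k"
  proof (cases "block_of k")
    case (Suc j)
    then have "\<not> k < start (Suc j)" unfolding block_of_def using not_less_Least by (metis lessI)
    then show ?thesis using Suc by simp
  qed simp
qed

lemma block_of_position:
  assumes "s \<le> j" "i < len s"
  shows "block_of (start j + offset s + i) = j"
proof (rule block_of_eq)
  show "start j + offset s + i < start (Suc j)"
    using offset_less[of s "Suc j" i] assms by simp
qed simp

text \<open>The index \<open>0\<close> always takes part, whatever \<open>A\<close> is, to keep the block functionals away from \<open>0\<close>.\<close>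

definition coefficient :: "nat set \<Rightarrow> nat \<Rightarrow> real" where
  "coefficient A s = (if s = 0 \<or> s \<in> A then weight s else 0)"

lemma coefficient_bounds: "0 \<le> coefficient A s" "coefficient A s \<le> weight s" "coefficient A 0 = 1"
  using weight_bounds(1,2)[of s] weight_bounds(3) by (auto simp: coefficient_def)

definition block_functional :: "nat set \<Rightarrow> nat \<Rightarrow> c00 \<Rightarrow> real" where
  "block_functional A j w = (\<Sum>s\<le>j. coefficient A s * component s (start j + offset s) w)"

lemma block_functional_linear:
  "block_functional A j (x + y) = block_functional A j x + block_functional A j y"
  "block_functional A j (r *\<^sub>R x) = r * block_functional A j x"
  by (simp_all add: block_functional_def component_linear distrib_left sum.distrib sum_distrib_left mult_ac)

lemma block_functional_sum: "block_functional A j (sum f F) = (\<Sum>i\<in>F. block_functional A j (f i))"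
proof (induction F rule: infinite_finite_induct)
  have "block_functional A j 0 = 0" using block_functional_linear(2)[of A j 0 0] by simp
  then show "block_functional A j (sum f {}) = (\<Sum>i\<in>{}. block_functional A j (f i))"
    "\<And>F. infinite F \<Longrightarrow> block_functional A j (sum f F) = (\<Sum>i\<in>F. block_functional A j (f i))" by simp_all
qed (simp add: block_functional_linear)

lemma abs_weighted_sum_le:
  assumes "finite F"
  shows "\<bar>\<Sum>s\<in>F. coefficient A s * component s (k s) w\<bar> \<le> (\<Sum>s\<in>F. weight s) * su_norm w"
proof -
  have "\<bar>\<Sum>s\<in>F. coefficient A s * component s (k s) w\<bar> \<le> (\<Sum>s\<in>F. \<bar>coefficient A s * component s (k s) w\<bar>)"
    by (rule sum_abs)
  also have "\<dots> \<le> (\<Sum>s\<in>F. weight s * su_norm w)"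
    unfolding abs_mult using coefficient_bounds weight_bounds(1)
    by (intro sum_mono mult_mono abs_component_le) (auto intro: less_imp_le)
  finally show ?thesis by (simp add: sum_distrib_right)
qed

lemma abs_block_functional_le: "\<bar>block_functional A j w\<bar> \<le> 2 * su_norm w"
proof -
  have "\<bar>block_functional A j w\<bar> \<le> (\<Sum>s\<le>j. weight s) * su_norm w"
    unfolding block_functional_def by (rule abs_weighted_sum_le) simp
  also have "\<dots> \<le> 2 * su_norm w" by (intro mult_right_mono weight_sum su_norm_props)
  finally show ?thesis .
qed

lemma block_functional_cong:
  assumes "\<And>k. block_of k = j \<Longrightarrow> coord w k = c * coord w' k"
  shows "block_functional A j w = c * block_functional A j w'"
proof -
  have "component s (start j + offset s) w = c * component s (start j + offset s) w'" if "s \<le> j" for s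
  proof -
    have "coord (shape s) i * coord w (start j + offset s + i)
        = c * (coord (shape s) i * coord w' (start j + offset s + i))" if "i < len s" for i
      using assms[OF block_of_position[OF \<open>s \<le> j\<close> that]] by simp
    then show ?thesis unfolding component_def sum_distrib_left by (intro sum.cong) auto
  qed
  then have "block_functional A j w = (\<Sum>s\<le>j. c * (coefficient A s * component s (start j + offset s) w'))"
    unfolding block_functional_def by (intro sum.cong) auto
  then show ?thesis by (simp add: block_functional_def sum_distrib_left)
qed

lemma finite_block_functional: "finite {j. block_functional A j w \<noteq> 0}"
proof (rule finite_subset)
  show "{j. block_functional A j w \<noteq> 0} \<subseteq> block_of ` supp w"
  proof
    fix j assume j: "j \<in> {j. block_functional A j w \<noteq> 0}"
    show "j \<in> block_of ` supp w"
    proof (rule ccontr)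
      assume "j \<notin> block_of ` supp w"
      then have "coord w k = 0 * coord 0 k" if "block_of k = j" for k using that by (auto simp: supp_def)
      then have "block_functional A j w = 0 * block_functional A j 0" by (rule block_functional_cong)
      then show False using j by simp
    qed
  qed
qed (simp add: finite_supp)

lemma block_functional_unit_vec:
  "block_functional A i (unit_vec (start j)) = (if i = j then 1 else 0)"
proof (cases "i = j")
  case False
  have "coord (unit_vec (start j)) k = 0 * coord 0 k" if "block_of k = i" for k
    using False block_of_eq[of j k] that offset_pos[of "Suc j"] by auto
  then have "block_functional A i (unit_vec (start j)) = 0 * block_functional A i 0"
    by (rule block_functional_cong)
  then show ?thesis using False by simp
next
  case True
  have "component s (start j + offset s) (unit_vec (start j)) = (if s = 0 then 1 else 0)" for s
  proof (cases "s = 0")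
    case True
    have "component s (start j + offset s) (unit_vec (start j)) = (\<Sum>i<len 0. if i = 0 then 1 else 0)"
      unfolding component_def True by (rule sum.cong) (auto simp: shape_def)
    then show ?thesis using True len_pos[of 0] by simp
  next
    case False
    then show ?thesis using offset_pos[of s] by (simp add: component_def)
  qed
  then have "block_functional A j (unit_vec (start j)) = (\<Sum>s\<le>j. if s = 0 then 1 else 0)"
    unfolding block_functional_def by (intro sum.cong) (auto simp: coefficient_bounds(3))
  then show ?thesis using True by simp
qed

section \<open>Operations on blocks\<close>

lemma multiplier_exists:
  assumes "\<And>j. \<bar>\<theta> j\<bar> \<le> 1"
  shows "\<exists>w'. su_norm w' \<le> su_norm w \<and> (\<forall>j. block_functional A j w' = \<theta> j * block_functional A j w)"
proof (intro exI[of _ "finite_vec (supp w) (\<lambda>k. \<theta> (block_of k) * coord w k)"] conjI allI)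
  let ?w = "finite_vec (supp w) (\<lambda>k. \<theta> (block_of k) * coord w k)"
  have c: "coord ?w k = \<theta> (block_of k) * coord w k" for k
    unfolding coord_finite_vec[OF finite_supp] by (auto simp: supp_def)
  show "su_norm ?w \<le> su_norm w"
    by (rule su_norm_mono) (simp add: c abs_mult mult_left_le_one_le assms)
  show "block_functional A j ?w = \<theta> j * block_functional A j w" for j
    by (rule block_functional_cong) (simp add: c)
qed

text \<open>The order-preserving map that moves the \<open>j\<close>-th block onto the initial part of the \<open>r(j)\<close>-th one.\<close>

definition block_shift :: "(nat \<Rightarrow> nat) \<Rightarrow> nat \<Rightarrow> nat" where
  "block_shift r k = start (r (block_of k)) + (k - start (block_of k))"

lemma block_shift_position:
  assumes "s \<le> j" "i < len s"
  shows "block_shift r (start j + offset s + i) = start (r j) + offset s + i"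
  using block_of_position[OF assms] by (simp add: block_shift_def)

lemma block_shift_bounds:
  assumes r: "strict_mono r"
  shows "start (r (block_of k)) \<le> block_shift r k"
    "block_shift r k < start (r (block_of k)) + offset (Suc (block_of k))"
    "block_of (block_shift r k) = r (block_of k)"
proof -
  show 1: "start (r (block_of k)) \<le> block_shift r k" by (simp add: block_shift_def)
  show 2: "block_shift r k < start (r (block_of k)) + offset (Suc (block_of k))"
    using block_of_bounds[of k] by (simp add: block_shift_def)
  have "block_of k \<le> r (block_of k)" using r by (rule strict_mono_imp_increasing)
  then have "offset (Suc (block_of k)) \<le> offset (Suc (r (block_of k)))"
    by (intro monoD[OF mono_offset]) simp
  then show "block_of (block_shift r k) = r (block_of k)"
    using 1 2 by (intro block_of_eq) auto
qed

lemma strict_mono_block_shift: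
  assumes r: "strict_mono r"
  shows "strict_mono (block_shift r)"
proof (rule strict_monoI)
  fix k l :: nat assume "k < l"
  have "block_of k \<le> block_of l"
  proof (rule ccontr)
    assume "\<not> block_of k \<le> block_of l"
    then have "start (Suc (block_of l)) \<le> start (block_of k)" by (intro start_mono) simp
    then show False using block_of_bounds[of k] block_of_bounds[of l] \<open>k < l\<close> by linarith
  qed
  show "block_shift r k < block_shift r l"
  proof (cases "block_of k = block_of l")
    case True
    then show ?thesis using \<open>k < l\<close> block_of_bounds(1)[of k] block_of_bounds(1)[of l] by (simp add: block_shift_def)
  next
    case False
    then have "r (block_of k) < r (block_of l)"
      using \<open>block_of k \<le> block_of l\<close> r by (simp add: strict_mono_less)
    then have "start (Suc (r (block_of k))) \<le> start (r (block_of l))" by (intro start_mono) simp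
    moreover have "block_shift r k < start (Suc (r (block_of k)))"
      using block_of_bounds(2)[of "block_shift r k"] by (simp add: block_shift_bounds(3)[OF r])
    ultimately show ?thesis using block_shift_bounds(1)[OF r, of l] by linarith
  qed
qed

text \<open>Move the contents of each block \<open>j\<close> to the initial part of block \<open>r(j)\<close>. There the additional components of the
longer functional find only zeros.\<close>

lemma spread_exists:
  assumes r: "strict_mono r"
  shows "\<exists>w'. su_norm w' \<le> su_norm w \<and> (\<forall>j. block_functional A (r j) w' = block_functional A j w)"
proof -
  let ?\<tau> = "block_shift r"
  have \<tau>: "strict_mono ?\<tau>" by (rule strict_mono_block_shift[OF r])
  have inj: "inj ?\<tau>" using \<tau> by (rule strict_mono_imp_inj_on)
  define w' where "w' = finite_vec (?\<tau> ` supp w) (\<lambda>k. coord w (inv ?\<tau> k))"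
  have c: "coord w' k = (if k \<in> ?\<tau> ` supp w then coord w (inv ?\<tau> k) else 0)" for k
    unfolding w'_def by (rule coord_finite_vec) (simp add: finite_supp)
  have c\<tau>: "coord w' (?\<tau> k) = coord w k" for k
    using inj by (auto simp: c inj_image_mem_iff supp_def)
  have c0: "coord w' k = 0" if "k \<notin> range ?\<tau>" for k using that by (auto simp: c)
  have supp: "supp w' \<subseteq> range ?\<tau>" using c0 by (auto simp: supp_def)
  have "su_norm w' \<le> su_norm w"
  proof (rule su_norm_transport)
    show "strict_mono_on (supp w') (inv ?\<tau>)"
    proof (rule strict_mono_onI)
      fix k l assume "k \<in> supp w'" "l \<in> supp w'" "k < l"
      then obtain k' l' where "k = ?\<tau> k'" "l = ?\<tau> l'" using supp by blast
      then show "inv ?\<tau> k < inv ?\<tau> l" using inj \<open>k < l\<close> strict_mono_less[OF \<tau>] by simp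
    qed
    fix k assume "k \<in> supp w'"
    then obtain k' where "k = ?\<tau> k'" using supp by blast
    then show "\<bar>coord w' k\<bar> \<le> \<bar>coord w (inv ?\<tau> k)\<bar>" using inj by (simp add: c\<tau>)
  qed
  moreover have "block_functional A (r j) w' = block_functional A j w" for j
  proof -
    have "j \<le> r j" using r by (rule strict_mono_imp_increasing)
    have low: "component s (start (r j) + offset s) w' = component s (start j + offset s) w" if "s \<le> j" for s
      unfolding component_def
      by (rule sum.cong) (auto simp: block_shift_position[OF that, of _ r, symmetric] c\<tau>)
    have high: "component s (start (r j) + offset s) w' = 0" if "j < s" "s \<le> r j" for s
    proof -
      have "start (r j) + offset s + i \<notin> range ?\<tau>" if "i < len s" for i
      proof
        assume "start (r j) + offset s + i \<in> range ?\<tau>"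
        then obtain k where k: "start (r j) + offset s + i = ?\<tau> k" by blast
        have "r (block_of k) = r j"
          using block_shift_bounds(3)[OF r, of k] block_of_position[OF \<open>s \<le> r j\<close> that] by (simp add: k)
        then have "block_of k = j" using strict_mono_eq[OF r] by blast
        then have "offset s + i < offset (Suc j)" using block_shift_bounds(2)[OF r, of k] by (simp flip: k)
        moreover have "offset (Suc j) \<le> offset s" using \<open>j < s\<close> by (intro monoD[OF mono_offset]) simp
        ultimately show False by simp
      qed
      then show ?thesis by (simp add: component_def c0)
    qed
    have "block_functional A (r j) w' = (\<Sum>s\<le>j. coefficient A s * component s (start (r j) + offset s) w')"
      unfolding block_functional_def using \<open>j \<le> r j\<close>
      by (intro sum.mono_neutral_right) (auto simp: high)
    then show ?thesis by (simp add: block_functional_def low)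
  qed
  ultimately show ?thesis by blast
qed

lemma sum_half_powers: "finite F \<Longrightarrow> (\<Sum>j\<in>F. (1 / 2 :: real) ^ j) \<le> 2"
proof -
  assume F: "finite F"
  have "(\<Sum>j\<in>F. (1 / 2 :: real) ^ j) \<le> (\<Sum>j. (1 / 2) ^ j)"
    by (rule sum_le_suminf[OF _ F]) (auto simp: summable_geometric)
  then show ?thesis using suminf_geometric[of "1 / 2 :: real"] by simp
qed

text \<open>Read the initial part of block \<open>r(j)\<close> as block \<open>j\<close>. The values lost are those of the components with index
above \<open>j\<close>, at most \<open>2\<^sup>-\<^sup>j\<close> times the norm of \<open>w\<close>. They are restored by multiples of the unit
vectors at the beginnings of the blocks, which costs twice the norm of \<open>w\<close> in total.\<close>

lemma compress_exists:
  assumes r: "strict_mono r"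
  shows "\<exists>w'. su_norm w' \<le> 3 * su_norm w \<and> (\<forall>j. block_functional A j w' = block_functional A (r j) w)"
proof -
  let ?\<tau> = "block_shift r"
  have \<tau>: "strict_mono ?\<tau>" by (rule strict_mono_block_shift[OF r])
  have inj: "inj ?\<tau>" using \<tau> by (rule strict_mono_imp_inj_on)
  have fin: "finite (?\<tau> -` supp w)" by (rule finite_vimageI[OF finite_supp inj])
  define v where "v = finite_vec (?\<tau> -` supp w) (\<lambda>k. coord w (?\<tau> k))"
  have c: "coord v k = coord w (?\<tau> k)" for k
    unfolding v_def coord_finite_vec[OF fin] by (auto simp: supp_def)
  have v: "su_norm v \<le> su_norm w"
    by (rule su_norm_transport[where q = ?\<tau>]) (use \<tau> in \<open>auto simp: c strict_mono_def strict_mono_on_def\<close>)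
  define d where "d j = block_functional A (r j) w - block_functional A j v" for j
  have d: "\<bar>d j\<bar> \<le> (1 / 2) ^ j * su_norm w" for j
  proof -
    have "j \<le> r j" using r by (rule strict_mono_imp_increasing)
    have low: "component s (start j + offset s) v = component s (start (r j) + offset s) w" if "s \<le> j" for s
      unfolding component_def by (rule sum.cong) (auto simp: c block_shift_position[OF that])
    have "{..r j} = {..j} \<union> {j<..r j}" using \<open>j \<le> r j\<close> by auto
    then have "block_functional A (r j) w
        = (\<Sum>s\<in>{..j} \<union> {j<..r j}. coefficient A s * component s (start (r j) + offset s) w)"
      by (simp only: block_functional_def)
    also have "\<dots> = (\<Sum>s\<le>j. coefficient A s * component s (start (r j) + offset s) w)
        + (\<Sum>s\<in>{j<..r j}. coefficient A s * component s (start (r j) + offset s) w)"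
      by (rule sum.union_disjoint) auto
    finally have "d j = (\<Sum>s\<in>{j<..r j}. coefficient A s * component s (start (r j) + offset s) w)"
      by (simp add: d_def block_functional_def low)
    then have "\<bar>d j\<bar> \<le> (\<Sum>s\<in>{j<..r j}. weight s) * su_norm w" using abs_weighted_sum_le by simp
    also have "\<dots> \<le> (weight j * (1 / 2) ^ j) * su_norm w"
      by (intro mult_right_mono weight_tail su_norm_props)
    also have "\<dots> \<le> (1 * (1 / 2) ^ j) * su_norm w"
      by (intro mult_right_mono weight_bounds su_norm_props) simp
    finally show ?thesis by simp
  qed
  define F where "F = {j. d j \<noteq> 0}"
  have F: "finite F"
  proof (rule finite_subset)
    show "F \<subseteq> r -` {j. block_functional A j w \<noteq> 0} \<union> {j. block_functional A j v \<noteq> 0}"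
      by (auto simp: F_def d_def)
    show "finite (r -` {j. block_functional A j w \<noteq> 0} \<union> {j. block_functional A j v \<noteq> 0})"
      using strict_mono_imp_inj_on[OF r] by (intro finite_UnI finite_vimageI finite_block_functional)
  qed
  define w' where "w' = v + (\<Sum>j\<in>F. d j *\<^sub>R unit_vec (start j))"
  have "su_norm w' \<le> su_norm v + (\<Sum>j\<in>F. su_norm (d j *\<^sub>R unit_vec (start j)))"
    unfolding w'_def by (rule order_trans[OF su_norm_props(1) add_left_mono[OF is_norm_sum[OF is_norm_su]]])
  also have "\<dots> \<le> su_norm w + (\<Sum>j\<in>F. (1 / 2) ^ j * su_norm w)"
  proof (intro add_mono v sum_mono)
    fix j
    have "\<bar>d j\<bar> * su_norm (unit_vec (start j)) \<le> \<bar>d j\<bar> * 1"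
      by (intro mult_left_mono su_norm_unit_vec_le) simp
    then show "su_norm (d j *\<^sub>R unit_vec (start j)) \<le> (1 / 2) ^ j * su_norm w"
      using d[of j] by (simp add: su_norm_props(2))
  qed
  also have "\<dots> = (1 + (\<Sum>j\<in>F. (1 / 2) ^ j)) * su_norm w" by (simp add: sum_distrib_right distrib_right)
  also have "\<dots> \<le> 3 * su_norm w"
    using sum_half_powers[OF F] by (intro mult_right_mono su_norm_props) simp
  finally have "su_norm w' \<le> 3 * su_norm w" .
  moreover have "block_functional A i w' = block_functional A (r i) w" for i
  proof -
    have "(\<Sum>j\<in>F. d j * (if i = j then 1 else 0)) = (\<Sum>j\<in>F. if j = i then d j else 0)"
      by (rule sum.cong) auto
    then have "(\<Sum>j\<in>F. d j * (if i = j then 1 else 0)) = d i" using F by (simp add: F_def)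
    then show ?thesis
      by (simp add: w'_def block_functional_linear block_functional_sum block_functional_unit_vec d_def)
  qed
  ultimately show ?thesis by blast
qed

section \<open>Estimates at the critical lengths\<close>

text \<open>On the \<open>s\<close>-th components of \<open>n\<^sub>s\<close> blocks put the constant that makes every block functional \<open>1\<close>. There are at most
\<open>n\<^sub>s\<^sup>2\<close> such coordinates, so by \<open>flat_norm_square\<close> this vector costs only three times as much as one on a
single block. The first \<open>s\<close> blocks have no \<open>s\<close>-th component; they get a unit vector each, whose number is
at most \<open>1/\<alpha>\<^sub>s\<close>.\<close>

lemma normalising_vector:
  assumes s: "0 < s" "s \<in> A"
  shows "\<exists>w. (\<forall>j<len s. block_functional A j w = 1) \<and> su_norm w \<le> 7 / weight s"
proof -
  define m where "m = len s"
  define \<sigma> where "\<sigma> = (\<Sum>i<m. coord (shape s) i)"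
  have \<sigma>: "flat_norm m / 2 \<le> \<sigma>" unfolding \<sigma>_def m_def by (rule shape_sum[OF s(1)])
  have fm: "1 \<le> flat_norm m" unfolding m_def by (rule flat_norm_ge_1[OF len_pos])
  have \<sigma>0: "0 < \<sigma>" using \<sigma> fm by linarith
  have \<alpha>: "0 < weight s" by (rule weight_bounds)
  define c where "c = 1 / (weight s * \<sigma>)"
  have c: "0 < c" using \<sigma>0 \<alpha> by (simp add: c_def)
  define P where "P = (\<lambda>(j, i). start j + offset s + i) ` ({s..<m} \<times> {..<m})"
  have P: "finite P" by (simp add: P_def)
  define v where "v = finite_vec P (\<lambda>_. c)"
  have v: "coord v k = (if k \<in> P then c else 0)" for k unfolding v_def by (rule coord_finite_vec[OF P])
  have P_block: "s \<le> block_of k" if "k \<in> P" for k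
    using that block_of_position[of s] by (auto simp: P_def m_def)
  have low: "block_functional A j v = 0" if "j < s" for j
  proof -
    have "coord v k = 0 * coord 0 k" if "block_of k = j" for k
      using P_block[of k] that \<open>j < s\<close> by (auto simp: v)
    then have "block_functional A j v = 0 * block_functional A j 0" by (rule block_functional_cong)
    then show ?thesis by simp
  qed
  have high: "block_functional A j v = 1" if j: "s \<le> j" "j < m" for j
  proof -
    have comp: "component t (start j + offset t) v = (if t = s then c * \<sigma> else 0)" if "t \<le> j" for t
    proof (cases "t = s")
      case True
      have "start j + offset s + i \<in> P" if "i < m" for i using j that by (force simp: P_def)
      then have "component s (start j + offset s) v = (\<Sum>i<m. coord (shape s) i * c)"
        unfolding component_def m_def[symmetric] by (intro sum.cong) (auto simp: v)
      then show ?thesis using True by (simp add: \<sigma>_def sum_distrib_left mult.commute)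
    next
      case False
      have "start j + offset t + i \<notin> P" if i: "i < len t" for i
      proof
        assume "start j + offset t + i \<in> P"
        then obtain j' i' where e: "start j + offset t + i = start j' + offset s + i'" "s \<le> j'" "i' < len s"
          by (auto simp: P_def m_def)
        then have "j = j'"
          using block_of_position[OF \<open>t \<le> j\<close> i] block_of_position[OF e(2,3)] by simp
        then have "offset t + i = offset s + i'" using e(1) by simp
        then show False
          using offset_less[of t s i] offset_less[of s t i'] i e(3) False by (cases "t < s") auto
      qed
      then show ?thesis using False by (simp add: component_def v)
    qed
    have "block_functional A j v = (\<Sum>t\<le>j. if t = s then coefficient A s * (c * \<sigma>) else 0)"
      unfolding block_functional_def by (rule sum.cong) (auto simp: comp)
    also have "\<dots> = weight s * (c * \<sigma>)" using j s by (simp add: coefficient_def)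
    also have "\<dots> = 1" using \<alpha> \<sigma>0 by (simp add: c_def)
    finally show ?thesis .
  qed
  define w where "w = v + (\<Sum>j<s. unit_vec (start j))"
  have "block_functional A j w = 1" if "j < m" for j
  proof -
    have "block_functional A j w = block_functional A j v + (\<Sum>i<s. if i = j then 1 else 0)"
      by (simp add: w_def block_functional_linear block_functional_sum block_functional_unit_vec eq_commute)
    then show ?thesis using low[of j] high[of j] that by (cases "j < s") auto
  qed
  moreover have "su_norm w \<le> 7 / weight s"
  proof -
    have "card P \<le> card ({s..<m} \<times> {..<m})" unfolding P_def by (rule card_image_le) simp
    also have "\<dots> \<le> m * m" by (simp add: card_cartesian_product)
    finally have "flat_norm (card P) \<le> 3 * flat_norm m"
      using flat_norm_mono flat_norm_square order_trans by blast
    moreover have "su_norm v \<le> c * flat_norm (card P)"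
      by (rule su_norm_flat_le[OF P]) (use c in \<open>auto simp: v\<close>)
    ultimately have "su_norm v \<le> c * (3 * flat_norm m)"
      using c by (meson mult_left_mono less_imp_le order_trans)
    also have "\<dots> \<le> c * (6 * \<sigma>)" using \<sigma> c by (intro mult_left_mono) auto
    also have "\<dots> = 6 / weight s" using \<sigma>0 by (simp add: c_def)
    finally have 1: "su_norm v \<le> 6 / weight s" .
    have "su_norm (\<Sum>j<s. unit_vec (start j)) \<le> (\<Sum>j<s. su_norm (unit_vec (start j)))"
      by (rule is_norm_sum[OF is_norm_su])
    also have "\<dots> \<le> (\<Sum>j<s. 1)" by (intro sum_mono su_norm_unit_vec_le)
    also have "\<dots> \<le> 1 / weight s" using index_times_weight[of s] \<alpha> by (simp add: field_simps)
    finally have "su_norm w \<le> 6 / weight s + 1 / weight s"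
      unfolding w_def using 1 su_norm_props(1) by (meson add_mono order_trans)
    then show ?thesis by (simp flip: add_divide_distrib)
  qed
  ultimately show ?thesis unfolding m_def by blast
qed

text \<open>The components before the \<open>s\<close>-th one occupy at most \<open>n\<^sub>s\<close> times \<open>offset s\<close> coordinates in all, and
\<open>n\<^sub>s\<close> was chosen so large that the coordinates there add up to little. The components after it have small weights.\<close>

lemma block_sum_le:
  assumes s: "0 < s" "s \<notin> A"
  shows "(\<Sum>j<len s. block_functional A j w) \<le> (2 * (1 / 2) ^ s * weight s * real (len s)) * su_norm w"
proof -
  define m where "m = len s"
  \<comment> \<open>The coordinates of the components before \<open>s\<close>; block \<open>j\<close> holds only \<open>Suc j\<close> components.\<close>
  define P where "P j = {start j..<start j + offset (min s (Suc j))}" for j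
  have block: "block_functional A j w
      \<le> (\<Sum>k\<in>P j. \<bar>coord w k\<bar>) + (weight s * (1 / 2) ^ s) * su_norm w" for j
  proof -
    define r where "r = min s (Suc j)"
    \<comment> \<open>Since \<open>s \<notin> A\<close>, the \<open>s\<close>-th component is absent.\<close>
    have split: "{..j} - {s} = {..<r} \<union> {s<..j}" by (auto simp: r_def)
    have "block_functional A j w = (\<Sum>t\<in>{..j} - {s}. coefficient A t * component t (start j + offset t) w)"
      unfolding block_functional_def using s by (intro sum.mono_neutral_right) (auto simp: coefficient_def)
    also have "\<dots> = (\<Sum>t<r. coefficient A t * component t (start j + offset t) w)
        + (\<Sum>t\<in>{s<..j}. coefficient A t * component t (start j + offset t) w)"
      unfolding split by (rule sum.union_disjoint) (auto simp: r_def)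
    also have "(\<Sum>t<r. coefficient A t * component t (start j + offset t) w)
        \<le> (\<Sum>t<r. 1 * \<bar>component t (start j + offset t) w\<bar>)"
    proof (rule sum_mono)
      fix t
      have "coefficient A t * component t (start j + offset t) w
          \<le> coefficient A t * \<bar>component t (start j + offset t) w\<bar>"
        by (intro mult_left_mono coefficient_bounds) simp
      also have "\<dots> \<le> 1 * \<bar>component t (start j + offset t) w\<bar>"
        using coefficient_bounds(2)[of A t] weight_bounds(2)[of t] by (intro mult_right_mono) auto
      finally show "coefficient A t * component t (start j + offset t) w
          \<le> 1 * \<bar>component t (start j + offset t) w\<bar>" .
    qed
    also have "(\<Sum>t<r. 1 * \<bar>component t (start j + offset t) w\<bar>) \<le> (\<Sum>i<offset r. \<bar>coord w (start j + i)\<bar>)"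
      using sum_abs_component_le[of "start j" w r] by simp
    also have "(\<Sum>i<offset r. \<bar>coord w (start j + i)\<bar>) = (\<Sum>k\<in>P j. \<bar>coord w k\<bar>)"
      unfolding P_def r_def
      by (rule sum.reindex_bij_witness[of _ "\<lambda>k. k - start j" "\<lambda>i. start j + i"]) auto
    also have "(\<Sum>t\<in>{s<..j}. coefficient A t * component t (start j + offset t) w)
        \<le> (\<Sum>t\<in>{s<..j}. weight t) * su_norm w"
      by (rule order_trans[OF abs_ge_self abs_weighted_sum_le]) simp
    also have "\<dots> \<le> (weight s * (1 / 2) ^ s) * su_norm w"
      by (intro mult_right_mono weight_tail su_norm_props)
    finally show ?thesis by simp
  qed
  have P_block: "block_of k = j" if "k \<in> P j" for k j
  proof (rule block_of_eq)
    have "offset (min s (Suc j)) \<le> offset (Suc j)" by (intro monoD[OF mono_offset]) simp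
    then show "k < start (Suc j)" using that by (simp add: P_def)
  qed (use that in \<open>simp add: P_def\<close>)
  have "card (\<Union>j<m. P j) \<le> (\<Sum>j<m. card (P j))" by (rule card_UN_le) simp
  also have "\<dots> \<le> (\<Sum>j<m. offset s)"
    by (intro sum_mono) (auto simp: P_def intro!: monoD[OF mono_offset])
  finally have card: "card (\<Union>j<m. P j) \<le> m * offset s" by simp
  have "(\<Sum>j<m. block_functional A j w)
      \<le> (\<Sum>j<m. (\<Sum>k\<in>P j. \<bar>coord w k\<bar>) + (weight s * (1 / 2) ^ s) * su_norm w)"
    by (intro sum_mono block)
  also have "\<dots> = (\<Sum>j<m. \<Sum>k\<in>P j. \<bar>coord w k\<bar>) + real m * (weight s * (1 / 2) ^ s * su_norm w)"
    by (simp add: sum.distrib)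
  also have "(\<Sum>j<m. \<Sum>k\<in>P j. \<bar>coord w k\<bar>) = (\<Sum>k\<in>(\<Union>j<m. P j). \<bar>coord w k\<bar>)"
  proof (rule sum.UNION_disjoint[symmetric])
    show "\<forall>j\<in>{..<m}. finite (P j)" by (simp add: P_def)
    show "\<forall>i\<in>{..<m}. \<forall>j\<in>{..<m}. i \<noteq> j \<longrightarrow> P i \<inter> P j = {}" using P_block by blast
  qed simp
  also have "\<dots> \<le> ((1 / 2) ^ s * weight s) * real m * su_norm w"
    unfolding m_def by (rule coord_sum_le) (use card in \<open>auto simp: P_def m_def\<close>)
  finally show ?thesis by (simp add: m_def algebra_simps)
qed

section \<open>The sequences and quotients given by an index set\<close>

definition su_embed :: "c00 \<Rightarrow> Su" where
  "su_embed w = to_completion (Su_c00 w)"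

lemma linear_su_embed: "linear su_embed"
  by (rule linearI) (simp_all add: su_embed_def plus_su_c00.abs_eq[symmetric] scaleR_su_c00.abs_eq[symmetric]
      to_completion_add to_completion_scaleR)

lemma norm_su_embed: "norm (su_embed w) = su_norm w"
  by (simp add: su_embed_def norm_to_completion norm_su_c00.abs_eq)

lemma range_su_embed: "range su_embed = range to_completion"
  by (auto simp: su_embed_def) (metis Su_c00_cases rangeI)

lemma block_dual_exists: "\<exists>f :: Su_dual. \<forall>w. blinfun_apply f (su_embed w) = block_functional A j w"
proof -
  have "bounded_linear (\<lambda>a. block_functional A j (seq_of_su a))"
  proof (rule bounded_linear_intro)
    fix a b :: su_c00 and r :: real
    show "block_functional A j (seq_of_su (a + b)) = block_functional A j (seq_of_su a) + block_functional A j (seq_of_su b)"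
      by (simp add: plus_su_c00.rep_eq block_functional_linear)
    show "block_functional A j (seq_of_su (r *\<^sub>R a)) = r *\<^sub>R block_functional A j (seq_of_su a)"
      by (simp add: scaleR_su_c00.rep_eq block_functional_linear)
    show "norm (block_functional A j (seq_of_su a)) \<le> norm a * 2"
      using abs_block_functional_le[of A j "seq_of_su a"] by (simp add: norm_su_c00.rep_eq)
  qed
  from completion_extend[OF this] obtain g :: Su_dual
    where "\<And>a. blinfun_apply g (to_completion a) = block_functional A j (seq_of_su a)" by blast
  then show ?thesis by (intro exI[of _ g]) (simp add: su_embed_def Su_c00_inverse)
qed

definition block_dual :: "nat set \<Rightarrow> nat \<Rightarrow> Su_dual" where
  "block_dual A j = (SOME f. \<forall>w. blinfun_apply f (su_embed w) = block_functional A j w)"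

lemma block_dual_su_embed [simp]: "blinfun_apply (block_dual A j) (su_embed w) = block_functional A j w"
  using someI_ex[OF block_dual_exists[of A j]] unfolding block_dual_def by blast

definition block_vec :: "nat \<Rightarrow> Su" where
  "block_vec j = su_embed (unit_vec (start j))"

interpretation block: biorthogonal_system "range su_embed" "block_dual A" block_vec 2 3 for A
proof
  show "subspace (range su_embed)" by (rule linear_subspace_image[OF linear_su_embed subspace_UNIV])
  show "closure (range su_embed) = UNIV" by (simp add: range_su_embed closure_range_to_completion)
  show "block_vec j \<in> range su_embed" for j by (simp add: block_vec_def)
  show "norm (block_vec j) \<le> 1" for j by (simp add: block_vec_def norm_su_embed su_norm_unit_vec_le)
  show "blinfun_apply (block_dual A i) (block_vec j) = (if i = j then 1 else 0)" for i j
    by (simp add: block_vec_def block_functional_unit_vec)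
  show "norm (block_dual A j) \<le> 2" for j
  proof (rule completion_functional_norm_le)
    fix a :: su_c00
    obtain w where "a = Su_c00 w" by (cases a) auto
    then show "\<bar>blinfun_apply (block_dual A j) (to_completion a)\<bar> \<le> 2 * norm a"
      using abs_block_functional_le[of A j w] by (simp add: su_embed_def[symmetric] norm_su_c00.abs_eq)
  qed simp
  fix w assume "w \<in> range su_embed"
  then obtain v where v: "w = su_embed v" by blast
  show "finite {j. blinfun_apply (block_dual A j) w \<noteq> 0}" by (simp add: v finite_block_functional)
  show "\<exists>w'\<in>range su_embed. norm w' \<le> norm w \<and>
      (\<forall>j. blinfun_apply (block_dual A j) w' = \<theta> j * blinfun_apply (block_dual A j) w)"
    if "\<And>j. \<bar>\<theta> j\<bar> \<le> 1" for \<theta>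
    using multiplier_exists[of \<theta> v A, OF that] by (force simp: v norm_su_embed)
  show "\<exists>w'\<in>range su_embed. norm w' \<le> norm w \<and>
      (\<forall>j. blinfun_apply (block_dual A (r j)) w' = blinfun_apply (block_dual A j) w)"
    if "strict_mono r" for r
    using spread_exists[OF that, of v A] by (force simp: v norm_su_embed)
  show "\<exists>w'\<in>range su_embed. norm w' \<le> 3 * norm w \<and>
      (\<forall>j. blinfun_apply (block_dual A j) w' = blinfun_apply (block_dual A (r j)) w)"
    if "strict_mono r" for r
    using compress_exists[OF that, of v A] by (force simp: v norm_su_embed)
qed simp_all

lemma fundamental_bounds_in:
  assumes s: "0 < s" "s \<in> A"
  shows "real (len s) * weight s \<le> 7 * block.dual_fundamental A (len s)"
    "block.quotient_fundamental A (len s) * weight s \<le> 7"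
proof -
  obtain w where w: "\<And>j. j < len s \<Longrightarrow> block_functional A j w = 1" "su_norm w \<le> 7 / weight s"
    using normalising_vector[OF s] by blast
  have \<alpha>: "0 < weight s" by (rule weight_bounds)
  show "real (len s) * weight s \<le> 7 * block.dual_fundamental A (len s)"
    "block.quotient_fundamental A (len s) * weight s \<le> 7"
    using block.fundamental_bounds_of_vector[of "su_embed w" "len s" A "7 / weight s"] w \<alpha>
    by (simp_all add: norm_su_embed field_simps)
qed

text \<open>For \<open>s \<in> A\<close> the norm of the sum is comparable with \<open>n\<^sub>s \<alpha>\<^sub>s\<close> and the quotient norm with
\<open>1/\<alpha>\<^sub>s\<close>; for \<open>s \<notin> A\<close> the first is smaller and the second larger, both by a factor of at least order \<open>2\<^sup>s\<close>.\<close>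

lemma fundamental_bounds_not_in:
  assumes s: "0 < s" "s \<notin> A"
  shows "block.dual_fundamental A (len s) \<le> 2 * (1 / 2) ^ s * (real (len s) * weight s)"
    "1 \<le> 2 * (1 / 2) ^ s * (block.quotient_fundamental A (len s) * weight s)"
proof -
  define c where "c = 2 * (1 / 2) ^ s * weight s * real (len s)"
  have c: "0 < c" using weight_bounds(1)[of s] len_pos[of s] by (simp add: c_def)
  have le: "(\<Sum>j<len s. blinfun_apply (block_dual A j) w) \<le> c * norm w" if "w \<in> range su_embed" for w
    using that block_sum_le[OF s] by (auto simp: norm_su_embed c_def)
  note b = block.fundamental_bounds_of_functional[OF c le]
  show "block.dual_fundamental A (len s) \<le> 2 * (1 / 2) ^ s * (real (len s) * weight s)"
    using b(1) by (simp add: c_def mult_ac)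
  have "real (len s) \<le> block.quotient_fundamental A (len s) * c" using b(2) c by (simp add: field_simps)
  then have "real (len s) * 1 \<le> real (len s) * (2 * (1 / 2) ^ s * (block.quotient_fundamental A (len s) * weight s))"
    by (simp add: c_def mult_ac)
  then show "1 \<le> 2 * (1 / 2) ^ s * (block.quotient_fundamental A (len s) * weight s)"
    using len_pos[of s] by (simp only: mult_le_cancel_left_pos of_nat_0_less_iff)
qed

section \<open>A continuum of non-equivalent fundamental functions\<close>

lemma infinite_difference_unbounded:
  fixes A B :: "nat set" and c :: real
  assumes inf: "infinite (A - B)"
  obtains s where "0 < s" "s \<in> A" "s \<notin> B" "c * (1 / 2) ^ s < 1"
proof -
  obtain n where n: "(1 / 2 :: real) ^ n < 1 / (\<bar>c\<bar> + 1)"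
    using real_arch_pow_inv[of "1 / (\<bar>c\<bar> + 1)" "1 / 2"] by (auto simp: add_nonneg_pos)
  obtain s where s: "n < s" "s \<in> A - B" using inf infinite_nat_iff_unbounded[of "A - B"] by blast
  have "c * (1 / 2) ^ s \<le> \<bar>c\<bar> * (1 / 2) ^ n"
    using s(1) by (intro mult_mono power_decreasing) auto
  also have "\<dots> \<le> \<bar>c\<bar> * (1 / (\<bar>c\<bar> + 1))" using n by (intro mult_left_mono) auto
  also have "\<dots> < 1" by (simp add: field_simps)
  finally show ?thesis using s by (intro that[of s]) auto
qed

lemma not_equivalent_dual_fundamental:
  assumes "infinite (A - B)"
  shows "\<not> equivalent_fundamental (block.dual_fundamental A) (block.dual_fundamental B)"
proof
  assume "equivalent_fundamental (block.dual_fundamental A) (block.dual_fundamental B)"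
  then obtain K where K: "0 < K" "\<And>n. inverse K * block.dual_fundamental A n \<le> block.dual_fundamental B n"
    unfolding equivalent_fundamental_def by blast
  obtain s where s: "0 < s" "s \<in> A" "s \<notin> B" "14 * K * (1 / 2) ^ s < 1"
    using infinite_difference_unbounded[OF assms] .
  define L where "L = real (len s) * weight s"
  have L: "0 < L" using len_pos[of s] weight_bounds(1)[of s] by (simp add: L_def)
  have "L \<le> 7 * block.dual_fundamental A (len s)" using fundamental_bounds_in(1)[OF s(1,2)] by (simp add: L_def)
  also have "\<dots> \<le> 7 * (K * block.dual_fundamental B (len s))" using K(1) K(2)[of "len s"] by (simp add: field_simps)
  also have "\<dots> \<le> 7 * (K * (2 * (1 / 2) ^ s * L))"
    using fundamental_bounds_not_in(1)[OF s(1,3)] K(1) unfolding L_def by (intro mult_left_mono) auto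
  also have "\<dots> = (14 * K * (1 / 2) ^ s) * L" by simp
  also have "\<dots> < 1 * L" using s(4) L by (rule mult_strict_right_mono)
  finally show False by simp
qed

lemma not_equivalent_quotient_fundamental:
  assumes "infinite (A - B)"
  shows "\<not> equivalent_fundamental (block.quotient_fundamental A) (block.quotient_fundamental B)"
proof
  assume "equivalent_fundamental (block.quotient_fundamental A) (block.quotient_fundamental B)"
  then obtain K where K: "0 < K" "\<And>n. block.quotient_fundamental B n \<le> K * block.quotient_fundamental A n"
    unfolding equivalent_fundamental_def by blast
  obtain s where s: "0 < s" "s \<in> A" "s \<notin> B" "14 * K * (1 / 2) ^ s < 1"
    using infinite_difference_unbounded[OF assms] .
  have \<alpha>: "0 < weight s" by (rule weight_bounds)
  have "1 \<le> 2 * (1 / 2) ^ s * (block.quotient_fundamental B (len s) * weight s)"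
    by (rule fundamental_bounds_not_in(2)[OF s(1,3)])
  also have "\<dots> \<le> 2 * (1 / 2) ^ s * ((K * block.quotient_fundamental A (len s)) * weight s)"
    using K(2) \<alpha> by (intro mult_left_mono mult_right_mono) auto
  also have "\<dots> = (2 * (1 / 2) ^ s * K) * (block.quotient_fundamental A (len s) * weight s)" by simp
  also have "\<dots> \<le> (2 * (1 / 2) ^ s * K) * 7"
    using fundamental_bounds_in(2)[OF s(1,2)] K(1) by (intro mult_left_mono) auto
  also have "\<dots> < 1" using s(4) by (simp add: mult_ac)
  finally show False by simp
qed

text \<open>The codes of the initial segments of \<open>X\<close>. The element \<open>n\<close> that is inserted makes the length of the segment part
of the code.\<close>

definition branch :: "nat set \<Rightarrow> nat set" where
  "branch X = (\<lambda>n. set_encode (insert n (X \<inter> {..<n}))) ` UNIV"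

text \<open>Segments that extend beyond a point where \<open>X\<close> and \<open>Y\<close> differ belong to only one of the two branches.\<close>

lemma infinite_branch_difference:
  assumes "X \<noteq> Y"
  shows "infinite (branch X - branch Y)"
proof -
  let ?code = "\<lambda>X n. set_encode (insert n (X \<inter> {..<n :: nat}))"
  obtain k where k: "k \<in> X \<longleftrightarrow> k \<notin> Y" using assms by blast
  have code: "n = n' \<and> X \<inter> {..<n} = Y \<inter> {..<n}" if "?code X n = ?code Y n'" for X Y n n'
  proof -
    have eq: "insert n (X \<inter> {..<n}) = insert n' (Y \<inter> {..<n'})"
      using that by (subst (asm) set_encode_eq) auto
    have "n = n'"
    proof (rule ccontr)
      assume "n \<noteq> n'"
      then show False using eq by (metis Int_iff insert_iff lessThan_iff not_less_iff_gr_or_eq)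
    qed
    then show ?thesis using eq by (metis Int_iff insert_ident lessThan_iff less_irrefl)
  qed
  have "inj (?code X)"
  proof (rule injI)
    fix a b assume "?code X a = ?code X b"
    from code[OF this] show "a = b" by (rule conjunct1)
  qed
  then have "infinite (?code X ` {k<..})"
    using infinite_Ioi[of k] by (simp add: finite_image_iff inj_on_subset)
  moreover have "?code X ` {k<..} \<subseteq> branch X - branch Y"
  proof
    fix a assume "a \<in> ?code X ` {k<..}"
    then obtain n where n: "k < n" "a = ?code X n" by blast
    have "a \<notin> branch Y"
    proof
      assume "a \<in> branch Y"
      then obtain n' where "?code X n = ?code Y n'" using n by (auto simp: branch_def)
      from code[OF this] have "X \<inter> {..<n} = Y \<inter> {..<n}" by (rule conjunct2)
      then show False using k n(1) by blast
    qed
    then show "a \<in> branch X - branch Y" using n by (auto simp: branch_def)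
  qed
  ultimately show ?thesis using infinite_super by blast
qed

text \<open>Inequivalence also shows that \<open>f\<close> is injective, as every function is equivalent to itself.\<close>

lemma continuum_image:
  fixes f :: "nat set \<Rightarrow> 'b"
  assumes "\<And>X Y. X \<noteq> Y \<Longrightarrow> \<not> equivalent_fundamental (\<Phi> (f X)) (\<Phi> (f Y))"
  shows "range f \<approx> (UNIV :: nat set set)"
    and "pairwise (\<lambda>a b. \<not> equivalent_fundamental (\<Phi> a) (\<Phi> b)) (range f)"
proof -
  have "equivalent_fundamental (\<Phi> a) (\<Phi> a)" for a
    unfolding equivalent_fundamental_def by (intro exI[of _ 1]) simp
  then have "inj f" using assms by (metis injI)
  then show "range f \<approx> (UNIV :: nat set set)" by (rule inj_on_image_eqpoll_self)
  show "pairwise (\<lambda>a b. \<not> equivalent_fundamental (\<Phi> a) (\<Phi> b)) (range f)"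
  proof (rule pairwiseI)
    fix a b assume "a \<in> range f" "b \<in> range f" "a \<noteq> b"
    then obtain X Y where "a = f X" "b = f Y" "X \<noteq> Y" by blast
    then show "\<not> equivalent_fundamental (\<Phi> a) (\<Phi> b)" using assms by simp
  qed
qed

theorem corollary25:
  shows "(\<exists>U :: (nat \<Rightarrow> Su_dual) set.
            U \<approx> (UNIV :: nat set set) \<and>
            (\<forall>u\<in>U. subsymmetric full_space u) \<and>
            pairwise (\<lambda>u v. \<not> equivalent_fundamental
              (fundamental_function full_space u) (fundamental_function full_space v)) U)
       \<and> (\<exists>(Q :: Su set set) (b :: Su set \<Rightarrow> nat \<Rightarrow> Su set).
            Q \<approx> (UNIV :: nat set set) \<and>
            (\<forall>M\<in>Q. subspace M \<and> closed M \<and>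
              schauder_basis (quotient_space M) (b M) \<and> subsymmetric (quotient_space M) (b M)) \<and>
            pairwise (\<lambda>M N. \<not> equivalent_fundamental
              (fundamental_function (quotient_space M) (b M))
              (fundamental_function (quotient_space N) (b N))) Q)"
proof (intro conjI)
  let ?u = "\<lambda>X. block_dual (branch X)"
  have u: "\<not> equivalent_fundamental (fundamental_function full_space (?u X)) (fundamental_function full_space (?u Y))"
    if "X \<noteq> Y" for X Y
    using not_equivalent_dual_fundamental[OF infinite_branch_difference[OF that]]
    by (simp only: block.dual_fundamental_def not_False_eq_True)
  have "\<forall>u\<in>range ?u. subsymmetric full_space u" using block.dual_subsymmetric by blast
  then show "\<exists>U :: (nat \<Rightarrow> Su_dual) set.
            U \<approx> (UNIV :: nat set set) \<and>
            (\<forall>u\<in>U. subsymmetric full_space u) \<and>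
            pairwise (\<lambda>u v. \<not> equivalent_fundamental
              (fundamental_function full_space u) (fundamental_function full_space v)) U"
    using continuum_image[of "fundamental_function full_space" ?u, OF u] by (intro exI[of _ "range ?u"] conjI)
next
  let ?M = "\<lambda>X. block.annihilator (branch X)"
  \<comment> \<open>The vectors \<open>block_vec\<close> do not depend on the index set, so the basis is a function of the subspace alone.\<close>
  let ?b = "\<lambda>M. coset M \<circ> block_vec"
  let ?\<Phi> = "\<lambda>M. fundamental_function (quotient_space M) (?b M)"
  have M: "\<not> equivalent_fundamental (?\<Phi> (?M X)) (?\<Phi> (?M Y))" if "X \<noteq> Y" for X Y
    using not_equivalent_quotient_fundamental[OF infinite_branch_difference[OF that]]
    by (simp only: block.quotient_fundamental_def not_False_eq_True)
  have "\<forall>M\<in>range ?M. subspace M \<and> closed M \<and>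
      schauder_basis (quotient_space M) (?b M) \<and> subsymmetric (quotient_space M) (?b M)"
    using block.subspace_annihilator block.closed_annihilator block.quotient_schauder_basis
      block.quotient_subsymmetric by blast
  then show "\<exists>(Q :: Su set set) (b :: Su set \<Rightarrow> nat \<Rightarrow> Su set).
            Q \<approx> (UNIV :: nat set set) \<and>
            (\<forall>M\<in>Q. subspace M \<and> closed M \<and>
              schauder_basis (quotient_space M) (b M) \<and> subsymmetric (quotient_space M) (b M)) \<and>
            pairwise (\<lambda>M N. \<not> equivalent_fundamental
              (fundamental_function (quotient_space M) (b M))
              (fundamental_function (quotient_space N) (b N))) Q"
    using continuum_image[of ?\<Phi> ?M, OF M] by (intro exI[of _ "range ?M"] exI[of _ ?b] conjI)
qed

end
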